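(* Let $\mathcal{E}$ be a locally convex space with $\dim_{\mathbb{R}}\mathcal{E}\ge2$, and let $f:\mathcal{F}(V,\mathcal{E})\to\mathcal{E}$ be a range decreasing additive group homomorphism such that $f|_{\mathcal{F}_c(V,\mathcal{E})}\not\equiv\mathbf{0}$. Then there is a point $\bar v\in V$ such that $f$ is the evaluation $E_{\bar v}$ at $\bar v$, i.e. $f(x)=x(\bar v)$ for all $x\in\mathcal{F}(V,\mathcal{E})$.
   Context: All manifolds and topological spaces are Hausdorff; all locally convex spaces are sequentially complete. $V$ is a finite dimensional $C^\infty$ manifold, possibly with boundary, not necessarily paracompact or connected. Smoothness class: $\mathcal{F}$ is a fixed class among $C^k_{MB}$ ($C^k$ in the Michal–Bastiani sense, defined through continuous iterated directional derivatives), $k=0,1,\dots,\infty$. If $\mathcal{E}$ is a Banach space, $\mathcal{F}$ may also be $C^k$ in the sense of Fréchet differentiability, $k=0,1,\dots,\infty$. If $\mathcal{E}$ is finite dimensional, $\mathcal{F}$ may also be locally Hölder $C^{k,\alpha}$, $k=0,1,\dots$, $0\le\alpha\le1$ ($C^{k,0}=C^k$), or locally Sobolev $W^{k,p}$, $k=1,2,\dots$, $1\le p<\infty$, with $kp>\dim_{\mathbb{R}}V$, or $k=\dim_{\mathbb{R}}V$ and $p=1$. $\mathcal{F}(V,\mathcal{E})$ is the additive group of $\mathcal{F}$ maps $V\to\mathcal{E}$ and $\mathcal{F}_c(V,\mathcal{E})$ the subgroup of those with compact support. A map $f:\mathcal{F}(V,\mathcal{E})\to\mathcal{E}$ is range decreasing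 if $f(x)\in x(V)$ for every $x$. *)

theory Defs
  imports "HOL-Analysis.Analysis"
begin

section \<open>Locally convex spaces\<close>

text \<open>Sequentially complete Hausdorff locally convex topological vector spaces over the reals
  (a complex space is regarded as a real one).\<close>

class seq_complete_lcs = real_vector + topological_ab_group_add + t2_space +
  assumes scaleR_continuous:
      "open U \<Longrightarrow> a *\<^sub>R x \<in> U \<Longrightarrow>
         \<exists>e>0. \<exists>W. open W \<and> x \<in> W \<and> (\<forall>b y. \<bar>b - a\<bar> < e \<and> y \<in> W \<longrightarrow> b *\<^sub>R y \<in> U)"
    and ex_convex_nhd_0:
      "open U \<Longrightarrow> 0 \<in> U \<Longrightarrow> \<exists>C. open C \<and> 0 \<in> C \<and> C \<subseteq> U \<and>
         (\<forall>x\<in>C. \<forall>y\<in>C. \<forall>s\<ge>0. \<forall>t\<ge>0. s + t = 1 \<longrightarrow> s *\<^sub>R x + t *\<^sub>R y \<in> C)"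
    and seq_complete:
      "(\<And>U. open U \<Longrightarrow> 0 \<in> U \<Longrightarrow> \<exists>N. \<forall>i\<ge>N. \<forall>j\<ge>N. X i - X j \<in> U) \<Longrightarrow> \<exists>l. X \<longlonglongrightarrow> l"

text \<open>The library's \<^term>\<open>dim\<close> is a natural number and gives \<open>0\<close> on infinite dimensional spaces,
  hence the explicit predicates.\<close>

definition dim_at_least_2 :: "'e::real_vector itself \<Rightarrow> bool" where
  "dim_at_least_2 _ \<longleftrightarrow> (\<exists>a b :: 'e. a \<noteq> b \<and> independent {a, b})"

definition finite_dim :: "'e::real_vector itself \<Rightarrow> bool" where
  "finite_dim _ \<longleftrightarrow> (\<exists>B :: 'e set. finite B \<and> span B = UNIV)"

definition defining_norm :: "('e::{real_vector,topological_space} \<Rightarrow> real) \<Rightarrow> bool" where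
  "defining_norm N \<longleftrightarrow>
     (\<forall>x. N x \<ge> 0) \<and> (\<forall>x. N x = 0 \<longleftrightarrow> x = 0) \<and>
     (\<forall>a x. N (a *\<^sub>R x) = \<bar>a\<bar> * N x) \<and> (\<forall>x y. N (x + y) \<le> N x + N y) \<and>
     (\<forall>U. open U \<longleftrightarrow> (\<forall>x\<in>U. \<exists>e>0. \<forall>y. N (y - x) < e \<longrightarrow> y \<in> U))"

section \<open>The model spaces\<close>

text \<open>\<open>\<real>\<^sup>n\<close> (with \<open>n = 0\<close> allowed) is the set of functions on \<open>{..<n}\<close>, extended by \<^term>\<open>undefined\<close>,
  with the topology of \<^typ>\<open>nat \<Rightarrow> real\<close>. It is the space of the measure
  \<^term>\<open>PiM {..<n} (\<lambda>_. lborel)\<close>.\<close>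

abbreviation Rn :: "nat \<Rightarrow> (nat \<Rightarrow> real) set" where
  "Rn n \<equiv> {..<n} \<rightarrow>\<^sub>E UNIV"

definition half_space :: "nat \<Rightarrow> (nat \<Rightarrow> real) set" where
  "half_space n = {p \<in> Rn n. n > 0 \<longrightarrow> p 0 \<ge> 0}"

definition lincomb :: "nat \<Rightarrow> real \<Rightarrow> (nat \<Rightarrow> real) \<Rightarrow> real \<Rightarrow> (nat \<Rightarrow> real) \<Rightarrow> nat \<Rightarrow> real" where
  "lincomb n a u b w = (\<lambda>i\<in>{..<n}. a * u i + b * w i)"

definition enorm :: "nat \<Rightarrow> (nat \<Rightarrow> real) \<Rightarrow> real" where
  "enorm n u = L2_set u {..<n}"

definition unit_vec :: "nat \<Rightarrow> nat \<Rightarrow> nat \<Rightarrow> real" where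
  "unit_vec n i = (\<lambda>m\<in>{..<n}. if m = i then 1 else 0)"

definition model_open :: "nat \<Rightarrow> (nat \<Rightarrow> real) set \<Rightarrow> bool" where
  "model_open n D \<longleftrightarrow> openin (top_of_set (Rn n)) D \<or> openin (top_of_set (half_space n)) D"

section \<open>Smoothness classes on open subsets of the model spaces\<close>

subsection \<open>Michal--Bastiani\<close>

text \<open>The limit is over all \<open>t \<noteq> 0\<close> with \<open>p + t w \<in> D\<close>; at a boundary point of a half space this
  gives one-sided derivatives in the directions transverse to the boundary.\<close>

definition has_dir_deriv ::
    "nat \<Rightarrow> (nat \<Rightarrow> real) set \<Rightarrow> ((nat \<Rightarrow> real) \<Rightarrow> 'e) \<Rightarrow> (nat \<Rightarrow> real) \<Rightarrow> (nat \<Rightarrow> real) \<Rightarrow>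
      'e::{real_vector,t2_space} \<Rightarrow> bool" where
  "has_dir_deriv n D x w p l \<longleftrightarrow>
     ((\<lambda>t. (1 / t) *\<^sub>R (x (lincomb n 1 p t w) - x p)) \<longlongrightarrow> l) (at 0 within {t. lincomb n 1 p t w \<in> D})"

definition dir_deriv ::
    "nat \<Rightarrow> (nat \<Rightarrow> real) set \<Rightarrow> ((nat \<Rightarrow> real) \<Rightarrow> 'e) \<Rightarrow> (nat \<Rightarrow> real) \<Rightarrow> (nat \<Rightarrow> real) \<Rightarrow>
      'e::{real_vector,t2_space}" where
  "dir_deriv n D x w p = (THE l. has_dir_deriv n D x w p l)"

primrec iter_deriv ::
    "nat \<Rightarrow> (nat \<Rightarrow> real) set \<Rightarrow> ((nat \<Rightarrow> real) \<Rightarrow> 'e) \<Rightarrow> nat \<Rightarrow> (nat \<Rightarrow> nat \<Rightarrow> real) \<Rightarrow> (nat \<Rightarrow> real) \<Rightarrow>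
      'e::{real_vector,t2_space}" where
  "iter_deriv n D x 0 v = x"
| "iter_deriv n D x (Suc j) v = dir_deriv n D (iter_deriv n D x j v) (v j)"

definition Ck_MB ::
    "nat \<Rightarrow> (nat \<Rightarrow> real) set \<Rightarrow> enat \<Rightarrow> ((nat \<Rightarrow> real) \<Rightarrow> 'e::{real_vector,t2_space}) \<Rightarrow> bool" where
  "Ck_MB n D k x \<longleftrightarrow>
     (\<forall>j. enat j < k \<longrightarrow> (\<forall>p\<in>D. \<forall>v\<in>{..<Suc j} \<rightarrow>\<^sub>E Rn n.
        \<exists>l. has_dir_deriv n D (iter_deriv n D x j v) (v j) p l)) \<and>
     (\<forall>j. enat j \<le> k \<longrightarrow>
        continuous_on (D \<times> ({..<j} \<rightarrow>\<^sub>E Rn n)) (\<lambda>(p, v). iter_deriv n D x j v p))"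

subsection \<open>Frechet\<close>

definition multilinear_Rn ::
    "nat \<Rightarrow> nat \<Rightarrow> ((nat \<Rightarrow> nat \<Rightarrow> real) \<Rightarrow> 'e::real_vector) \<Rightarrow> bool" where
  "multilinear_Rn n j T \<longleftrightarrow>
     (\<forall>v\<in>{..<j} \<rightarrow>\<^sub>E Rn n. \<forall>i<j. \<forall>u\<in>Rn n. \<forall>w\<in>Rn n. \<forall>a b.
        T (v(i := lincomb n a u b w)) = a *\<^sub>R T (v(i := u)) + b *\<^sub>R T (v(i := w)))"

definition unit_tuples :: "nat \<Rightarrow> nat \<Rightarrow> (nat \<Rightarrow> nat \<Rightarrow> real) set" where
  "unit_tuples n j = {..<j} \<rightarrow>\<^sub>E {u \<in> Rn n. enorm n u \<le> 1}"

text \<open>\<open>A j p\<close> is the \<open>j\<close>-th Frechet derivative of \<open>x\<close> at \<open>p\<close>, a \<open>j\<close>-linear map on \<open>\<real>\<^sup>n\<close>. The last two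
  conditions say that \<open>A j\<close> is continuous, and that \<open>A (Suc j) p\<close> is the Frechet derivative of \<open>A j\<close>
  at \<open>p\<close>, for the operator norm on \<open>j\<close>-linear maps.\<close>

definition Ck_Frechet ::
    "('e \<Rightarrow> real) \<Rightarrow> nat \<Rightarrow> (nat \<Rightarrow> real) set \<Rightarrow> enat \<Rightarrow> ((nat \<Rightarrow> real) \<Rightarrow> 'e::real_vector) \<Rightarrow> bool" where
  "Ck_Frechet N n D k x \<longleftrightarrow>
     (\<exists>A :: nat \<Rightarrow> (nat \<Rightarrow> real) \<Rightarrow> (nat \<Rightarrow> nat \<Rightarrow> real) \<Rightarrow> 'e.
        (\<forall>p\<in>D. \<forall>v\<in>{..<0} \<rightarrow>\<^sub>E Rn n. A 0 p v = x p) \<and>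
        (\<forall>j. enat j \<le> k \<longrightarrow> (\<forall>p\<in>D. multilinear_Rn n j (A j p))) \<and>
        (\<forall>j. enat j \<le> k \<longrightarrow> (\<forall>p\<in>D. \<forall>e>0. \<exists>d>0. \<forall>q\<in>D. enorm n (lincomb n 1 q (-1) p) < d \<longrightarrow>
           (\<forall>v\<in>unit_tuples n j. N (A j q v - A j p v) \<le> e))) \<and>
        (\<forall>j. enat j < k \<longrightarrow> (\<forall>p\<in>D. \<forall>e>0. \<exists>d>0. \<forall>q\<in>D. enorm n (lincomb n 1 q (-1) p) < d \<longrightarrow>
           (\<forall>v\<in>unit_tuples n j.
              N (A j q v - A j p v - A (Suc j) p (v(j := lincomb n 1 q (-1) p)))
                \<le> e * enorm n (lincomb n 1 q (-1) p)))))"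

subsection \<open>Hoelder\<close>

definition Ck_Hoelder ::
    "('e \<Rightarrow> real) \<Rightarrow> nat \<Rightarrow> (nat \<Rightarrow> real) set \<Rightarrow> nat \<Rightarrow> real \<Rightarrow>
      ((nat \<Rightarrow> real) \<Rightarrow> 'e::{real_vector,t2_space}) \<Rightarrow> bool" where
  "Ck_Hoelder N n D k \<alpha> x \<longleftrightarrow>
     Ck_MB n D (enat k) x \<and>
     (\<forall>v\<in>{..<k} \<rightarrow>\<^sub>E Rn n. \<forall>p\<in>D. \<exists>W C. openin (top_of_set D) W \<and> p \<in> W \<and>
        (\<forall>q\<in>W. \<forall>r\<in>W. N (iter_deriv n D x k v q - iter_deriv n D x k v r)
           \<le> C * enorm n (lincomb n 1 q (-1) r) powr \<alpha>))"

subsection \<open>Sobolev\<close>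

abbreviation leb :: "nat \<Rightarrow> (nat \<Rightarrow> real) measure" where
  "leb n \<equiv> PiM {..<n} (\<lambda>_. lborel)"

definition test_functions :: "nat \<Rightarrow> (nat \<Rightarrow> real) set \<Rightarrow> ((nat \<Rightarrow> real) \<Rightarrow> real) set" where
  "test_functions n D =
     {\<psi>. Ck_MB n (Rn n) \<infinity> \<psi> \<and>
         (\<exists>K. compact K \<and> K \<subseteq> top_of_set (Rn n) interior_of D \<and> (\<forall>p\<in>Rn n - K. \<psi> p = 0))}"

definition partial_deriv ::
    "nat \<Rightarrow> nat \<Rightarrow> (nat \<Rightarrow> nat) \<Rightarrow> ((nat \<Rightarrow> real) \<Rightarrow> real) \<Rightarrow> (nat \<Rightarrow> real) \<Rightarrow> real" where
  "partial_deriv n j a \<psi> = iter_deriv n (Rn n) \<psi> j (\<lambda>i. unit_vec n (a i))"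

definition Lp_loc :: "nat \<Rightarrow> (nat \<Rightarrow> real) set \<Rightarrow> real \<Rightarrow> ((nat \<Rightarrow> real) \<Rightarrow> real) \<Rightarrow> bool" where
  "Lp_loc n D p g \<longleftrightarrow>
     g \<in> borel_measurable (leb n) \<and>
     (\<forall>K. compact K \<and> K \<subseteq> D \<longrightarrow> set_integrable (leb n) K (\<lambda>z. \<bar>g z\<bar> powr p))"

text \<open>In the range of exponents considered, every locally \<open>W\<^sup>k\<^sup>,\<^sup>p\<close> function has a unique continuous
  representative. As point values are needed, the elements of the class are these representatives.
  The compact sets in \<^const>\<open>Lp_loc\<close> may meet the boundary of the half space.\<close>

definition Sobolev_real ::
    "nat \<Rightarrow> (nat \<Rightarrow> real) set \<Rightarrow> nat \<Rightarrow> real \<Rightarrow> ((nat \<Rightarrow> real) \<Rightarrow> real) \<Rightarrow> bool" where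
  "Sobolev_real n D k p u \<longleftrightarrow>
     continuous_on D u \<and>
     (\<forall>j\<le>k. \<forall>a\<in>{..<j} \<rightarrow>\<^sub>E {..<n}. \<exists>g. Lp_loc n D p g \<and>
        (\<forall>\<psi>\<in>test_functions n D.
           set_lebesgue_integral (leb n) D (\<lambda>z. u z * partial_deriv n j a \<psi> z)
             = (-1) ^ j * set_lebesgue_integral (leb n) D (\<lambda>z. g z * \<psi> z)))"

text \<open>For finite dimensional \<open>'e\<close>: all components (linear functionals) of \<open>x\<close> are of class \<open>W\<^sup>k\<^sup>,\<^sup>p\<close>.\<close>

definition Sobolev ::
    "nat \<Rightarrow> (nat \<Rightarrow> real) set \<Rightarrow> nat \<Rightarrow> real \<Rightarrow> ((nat \<Rightarrow> real) \<Rightarrow> 'e::real_vector) \<Rightarrow> bool" where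
  "Sobolev n D k p x \<longleftrightarrow> (\<forall>l :: 'e \<Rightarrow> real. linear l \<longrightarrow> Sobolev_real n D k p (\<lambda>z. l (x z)))"

subsection \<open>The admissible classes\<close>

text \<open>The Frechet and Hoelder classes carry a norm of the target space as a parameter.\<close>

datatype 'e smoothness =
    MB enat
  | Frechet "'e \<Rightarrow> real" enat
  | Hoelder "'e \<Rightarrow> real" nat real
  | SobolevW nat real

text \<open>A space of class \<^class>\<open>seq_complete_lcs\<close> whose topology is given by a norm is a Banach space:
  that norm is complete because the class requires sequential completeness.\<close>

primrec admissible :: "nat \<Rightarrow> 'e::seq_complete_lcs smoothness \<Rightarrow> bool" where
  "admissible n (MB k) \<longleftrightarrow> True"
| "admissible n (Frechet N k) \<longleftrightarrow> defining_norm N"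
| "admissible n (Hoelder N k \<alpha>) \<longleftrightarrow>
     finite_dim TYPE('e) \<and> defining_norm N \<and> 0 \<le> \<alpha> \<and> \<alpha> \<le> 1"
| "admissible n (SobolevW k p) \<longleftrightarrow>
     finite_dim TYPE('e) \<and> 1 \<le> k \<and> 1 \<le> p \<and> (real k * p > real n \<or> k = n \<and> p = 1)"

primrec of_class ::
    "'e smoothness \<Rightarrow> nat \<Rightarrow> (nat \<Rightarrow> real) set \<Rightarrow> ((nat \<Rightarrow> real) \<Rightarrow> 'e::seq_complete_lcs) \<Rightarrow> bool" where
  "of_class (MB k) n D x \<longleftrightarrow> Ck_MB n D k x"
| "of_class (Frechet N k) n D x \<longleftrightarrow> Ck_Frechet N n D k x"
| "of_class (Hoelder N k \<alpha>) n D x \<longleftrightarrow> Ck_Hoelder N n D k \<alpha> x"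
| "of_class (SobolevW k p) n D x \<longleftrightarrow> Sobolev n D k p x"

section \<open>Manifolds with boundary and the mapping groups\<close>

type_synonym 'v chart = "'v set \<times> ('v \<Rightarrow> nat \<Rightarrow> real)"

definition is_chart :: "nat \<Rightarrow> 'v::topological_space chart \<Rightarrow> bool" where
  "is_chart n c \<longleftrightarrow> (case c of (U, \<phi>) \<Rightarrow>
     open U \<and> model_open n (\<phi> ` U) \<and> homeomorphism U (\<phi> ` U) \<phi> (inv_into U \<phi>))"

text \<open>The whole type \<open>'v\<close>, with atlas \<open>\<A>\<close>, is a smooth \<open>n\<close>-dimensional manifold, possibly with
  boundary. The transition maps are smooth up to the boundary.\<close>

definition smooth_manifold :: "nat \<Rightarrow> 'v::t2_space chart set \<Rightarrow> bool" where
  "smooth_manifold n \<A> \<longleftrightarrow>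
     (\<forall>c\<in>\<A>. is_chart n c) \<and> (\<Union>c\<in>\<A>. fst c) = UNIV \<and>
     (\<forall>(U, \<phi>)\<in>\<A>. \<forall>(W, \<psi>)\<in>\<A>. \<forall>i<n.
        Ck_MB n (\<phi> ` (U \<inter> W)) \<infinity> (\<lambda>p. \<psi> (inv_into U \<phi> p) i))"

definition maps_of_class ::
    "'e::seq_complete_lcs smoothness \<Rightarrow> nat \<Rightarrow> 'v::t2_space chart set \<Rightarrow> ('v \<Rightarrow> 'e) set" where
  "maps_of_class S n \<A> =
     {x. \<forall>(U, \<phi>)\<in>\<A>. of_class S n (\<phi> ` U) (\<lambda>p. x (inv_into U \<phi> p))}"

definition maps_of_class_c ::
    "'e::seq_complete_lcs smoothness \<Rightarrow> nat \<Rightarrow> 'v::t2_space chart set \<Rightarrow> ('v \<Rightarrow> 'e) set" where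
  "maps_of_class_c S n \<A> = {x \<in> maps_of_class S n \<A>. compact (closure {v. x v \<noteq> 0})}"

definition range_decreasing :: "('v \<Rightarrow> 'e) set \<Rightarrow> (('v \<Rightarrow> 'e) \<Rightarrow> 'e) \<Rightarrow> bool" where
  "range_decreasing X f \<longleftrightarrow> (\<forall>x\<in>X. f x \<in> range x)"

definition additive_hom_on :: "('v \<Rightarrow> 'e::plus) set \<Rightarrow> (('v \<Rightarrow> 'e) \<Rightarrow> 'e) \<Rightarrow> bool" where
  "additive_hom_on X f \<longleftrightarrow> (\<forall>x\<in>X. \<forall>y\<in>X. f (\<lambda>v. x v + y v) = f x + f y)"

end

theory Submission
  imports Defs
begin

text \<open>For a scalar function \<open>\<phi>\<close> of the given class and a vector \<open>c\<close>, the value \<open>f (\<phi> c)\<close> is a multiple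
  \<open>L \<phi> c\<close> of \<open>c\<close>. Applying the range condition to \<open>\<phi> a + \<psi> b\<close> with independent \<open>a\<close>, \<open>b\<close> shows that \<open>L\<close>
  does not depend on \<open>c\<close> and that any two scalar functions take their values \<open>L \<phi>\<close>, \<open>L \<psi>\<close> at a
  common point. If every point \<open>v\<close> had a function with \<open>\<phi> v \<noteq> L \<phi>\<close>, then \<open>L\<close> would vanish on bump functions
  supported near \<open>v\<close>; finitely many of them have a positive sum on the support of some \<open>\<rho>\<close> with \<open>L \<rho> \<noteq> 0\<close>,
  and the sum and \<open>\<rho>\<close> violate the common point property. So \<open>L\<close> is the evaluation at a point, and since
  \<open>l (f x) = L (l \<circ> x)\<close> for continuous linear functionals \<open>l\<close>, the Hahn-Banach theorem gives the claim.
  The analytic part is that smooth bump functions belong to each of the classes, in every chart.\<close>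

subsection \<open>Continuous linear functionals separate points\<close>

text \<open>Only additivity of \<open>f\<close> is given: no homogeneity, no continuity, and a
  target of infinite dimension cannot be split into finitely many coordinates. Hence
  \<open>f x\<close> is studied through functionals l. Writing x = T x + (l x) c with l c = 1 and l
  T = 0, the range condition puts f (T x) into the kernel of l, so l (f x) depends on l x alone.
  Dimension at least 2 matters because independence of \<open>a\<close> and \<open>b\<close> makes a
  single point of V serve two scalar functions at once. The class enters only through sums,
  composition with continuous linear maps, continuity of l x, and bump functions times vectors.
  Products inside the class are avoided, since they would need a separate argument for each kind of
  smoothness. The calculus is done on relatively open subsets of \<open>Rn n\<close> or
  \<open>half_space n\<close> alike, so that charts at the boundary are covered by the same
  lemmas.\<close>

definition sublinear :: "('e::real_vector \<Rightarrow> real) \<Rightarrow> bool" where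
  "sublinear p \<longleftrightarrow> (\<forall>x y. p (x + y) \<le> p x + p y) \<and> (\<forall>a x. a \<ge> 0 \<longrightarrow> p (a *\<^sub>R x) = a * p x)"

lemma sublinear_add: "sublinear p \<Longrightarrow> p (x + y) \<le> p x + p y"
  and sublinear_scale: "sublinear p \<Longrightarrow> a \<ge> 0 \<Longrightarrow> p (a *\<^sub>R x) = a * p x"
  by (auto simp: sublinear_def)

lemma sublinear_zero: "sublinear p \<Longrightarrow> p 0 = 0"
  using sublinear_scale[of p 0 0] by simp

lemma sublinear_minus_ge: "sublinear p \<Longrightarrow> - p (- x) \<le> p x"
  using sublinear_add[of p x "- x"] sublinear_zero[of p] by simp

text \<open>The one-step lowering in the proof of the Hahn-Banach theorem: among sublinear q \<le> p
  with q (- e) \<le> - p e this is the largest, because q x \<le> q (x + t e) + t q (- e) for t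
  \<ge> 0.\<close>

definition lower_along :: "('e::real_vector \<Rightarrow> real) \<Rightarrow> 'e \<Rightarrow> 'e \<Rightarrow> real" where
  "lower_along p e x = (INF t\<in>{0..}. p (x + t *\<^sub>R e) - t * p e)"

context
  fixes p :: "'e::real_vector \<Rightarrow> real" and e :: 'e
  assumes p: "sublinear p"
begin

text \<open>Subadditivity at x + t e and - x gives a bound independent of t, so the infimum is
  meaningful.\<close>

lemma lower_along_bdd: "bdd_below ((\<lambda>t. p (x + t *\<^sub>R e) - t * p e) ` {0..})"
proof (rule bdd_belowI2)
  fix t :: real assume "t \<in> {0..}"
  then have "t * p e = p ((x + t *\<^sub>R e) + (- x))"
    by (simp add: sublinear_scale[OF p])
  also have "\<dots> \<le> p (x + t *\<^sub>R e) + p (- x)"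
    by (rule sublinear_add[OF p])
  finally show "- p (- x) \<le> p (x + t *\<^sub>R e) - t * p e" by simp
qed

lemma lower_along_le: "t \<ge> 0 \<Longrightarrow> lower_along p e x \<le> p (x + t *\<^sub>R e) - t * p e"
  unfolding lower_along_def by (rule cINF_lower[OF lower_along_bdd]) simp

lemma lower_along_ge:
  "(\<And>t. t \<ge> 0 \<Longrightarrow> c \<le> p (x + t *\<^sub>R e) - t * p e) \<Longrightarrow> c \<le> lower_along p e x"
  unfolding lower_along_def by (rule cINF_greatest) auto

lemma sublinear_lower_along: "sublinear (lower_along p e)"
proof -
  have add: "lower_along p e (x + y) \<le> lower_along p e x + lower_along p e y" for x y
  proof -
    have "lower_along p e (x + y) - lower_along p e y \<le> lower_along p e x"
    proof (rule lower_along_ge)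
      fix s :: real assume s: "s \<ge> 0"
      have "lower_along p e (x + y) - (p (x + s *\<^sub>R e) - s * p e) \<le> lower_along p e y"
      proof (rule lower_along_ge)
        fix t :: real assume t: "t \<ge> 0"
        have "lower_along p e (x + y) \<le> p ((x + y) + (s + t) *\<^sub>R e) - (s + t) * p e"
          using s t by (intro lower_along_le) auto
        also have "(x + y) + (s + t) *\<^sub>R e = (x + s *\<^sub>R e) + (y + t *\<^sub>R e)"
          by (simp add: algebra_simps)
        finally show "lower_along p e (x + y) - (p (x + s *\<^sub>R e) - s * p e) \<le> p (y + t *\<^sub>R e) - t * p e"
          using sublinear_add[OF p, of "x + s *\<^sub>R e" "y + t *\<^sub>R e"] by (simp add: algebra_simps)
      qed
      then show "lower_along p e (x + y) - lower_along p e y \<le> p (x + s *\<^sub>R e) - s * p e" by simp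
    qed
    then show ?thesis by simp
  qed
  have pos: "lower_along p e (a *\<^sub>R x) \<le> a * lower_along p e x" if a: "a > 0" for a x
  proof -
    have "lower_along p e (a *\<^sub>R x) / a \<le> lower_along p e x"
    proof (rule lower_along_ge)
      fix t :: real assume t: "t \<ge> 0"
      have "lower_along p e (a *\<^sub>R x) \<le> p (a *\<^sub>R x + (a * t) *\<^sub>R e) - (a * t) * p e"
        using a t by (intro lower_along_le) auto
      also have "a *\<^sub>R x + (a * t) *\<^sub>R e = a *\<^sub>R (x + t *\<^sub>R e)"
        by (simp add: algebra_simps)
      finally show "lower_along p e (a *\<^sub>R x) / a \<le> p (x + t *\<^sub>R e) - t * p e"
        using a sublinear_scale[OF p, of a "x + t *\<^sub>R e"] by (simp add: field_simps)
    qed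
    then show ?thesis using a by (simp add: field_simps)
  qed
  have zero: "lower_along p e 0 = 0"
  proof (rule antisym)
    show "lower_along p e 0 \<le> 0" using lower_along_le[of 0 0] sublinear_zero[OF p] by simp
    show "0 \<le> lower_along p e 0" by (rule lower_along_ge) (simp add: sublinear_scale[OF p])
  qed
  have "lower_along p e (a *\<^sub>R x) = a * lower_along p e x" if "a \<ge> 0" for a x
  proof (cases "a = 0")
    case False
    then have a: "a > 0" using that by simp
    \<comment> \<open>Applying the one-sided scaling to a x with factor 1 / a gives the reverse
      inequality.\<close>
    have "lower_along p e (inverse a *\<^sub>R (a *\<^sub>R x)) \<le> inverse a * lower_along p e (a *\<^sub>R x)"
      using a by (intro pos) simp
    then show ?thesis using pos[OF a, of x] a by (simp add: field_simps)
  qed (simp add: zero)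
  then show ?thesis using add by (auto simp: sublinear_def)
qed

lemma lower_along_le_self: "lower_along p e \<le> p"
  using lower_along_le[of 0] by (auto simp: le_fun_def)

text \<open>The value t = 1 in the infimum gives p 0 - p e. This is what makes a minimal sublinear
  functional odd.\<close>

lemma lower_along_minus: "lower_along p e (- e) \<le> - p e"
  using lower_along_le[of 1 "- e"] sublinear_zero[OF p] by simp

end

text \<open>Minimal sublinear functionals are linear, because \<^const>\<open>lower_along\<close> cannot lower them.\<close>

lemma ex_linear_le_sublinear:
  assumes p: "sublinear (p :: 'e::real_vector \<Rightarrow> real)"
  shows "\<exists>l. linear l \<and> l \<le> p"
proof -
  define A where "A = {q. sublinear q \<and> q \<le> p}"
  have "\<exists>m\<in>A. \<forall>a\<in>A. a \<le> m \<longrightarrow> a = m"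
  \<comment> \<open>Zorn's lemma is applied to the reversed order, so that a maximal element is a
    minimal sublinear functional below p.\<close>
  proof (rule predicate_Zorn)
    show "partial_order_on A (relation_of (\<lambda>x y. y \<le> x) A)"
      by (rule partial_order_on_relation_ofI) auto
    fix C assume C: "C \<in> Chains (relation_of (\<lambda>x y. y \<le> x) A)"
    then have CA: "C \<subseteq> A" and tot: "\<And>q r. q \<in> C \<Longrightarrow> r \<in> C \<Longrightarrow> q \<le> r \<or> r \<le> q"
      by (auto simp: Chains_def relation_of_def)
    show "\<exists>u\<in>A. \<forall>a\<in>C. u \<le> a"
    proof (cases "C = {}")
      case True
      then show ?thesis using p by (auto simp: A_def)
    next
      case False
      define u where "u x = (INF q\<in>C. q x)" for x
      have bdd: "bdd_below ((\<lambda>q. q x) ` C)" for x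
      \<comment> \<open>All members of the chain lie below p, so - p (- x) bounds their values at x
        from below.\<close>
      proof (rule bdd_belowI2)
        fix q assume "q \<in> C"
        then have q: "sublinear q" "q \<le> p" using CA by (auto simp: A_def)
        then have "q (- x) \<le> p (- x)" by (auto simp: le_fun_def)
        then show "- p (- x) \<le> q x" using sublinear_minus_ge[OF q(1), of x] by linarith
      qed
      have le: "u x \<le> q x" if "q \<in> C" for q x
        unfolding u_def by (rule cINF_lower[OF bdd that])
      have ge: "c \<le> u x" if "\<And>q. q \<in> C \<Longrightarrow> c \<le> q x" for c x
        unfolding u_def by (rule cINF_greatest[OF False that])
      have subl: "sublinear q" if "q \<in> C" for q using that CA by (auto simp: A_def)
      have add: "u (x + y) \<le> u x + u y" for x y
      proof -
        have "u (x + y) - u y \<le> u x"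
        proof (rule ge)
          fix q assume q: "q \<in> C"
          have "u (x + y) - q x \<le> u y"
          proof (rule ge)
            fix r assume r: "r \<in> C"
            \<comment> \<open>The smaller of q and r bounds u and lies below both, so its
              subadditivity alone suffices; this is where the chain property is used.\<close>
            consider "q \<le> r" | "r \<le> q" using tot[OF q r] by blast
            then show "u (x + y) - q x \<le> r y"
            proof cases
              case 1
              then have "q y \<le> r y" by (auto simp: le_fun_def)
              then show ?thesis using le[OF q, of "x + y"] sublinear_add[OF subl[OF q], of x y] by linarith
            next
              case 2
              then have "r x \<le> q x" by (auto simp: le_fun_def)
              then show ?thesis using le[OF r, of "x + y"] sublinear_add[OF subl[OF r], of x y] by linarith
            qed
          qed
          then show "u (x + y) - u y \<le> q x" by simp
        qed
        then show ?thesis by simp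
      qed
      have scale: "u (a *\<^sub>R x) = a * u x" if a: "a \<ge> 0" for a x
      proof (cases "a = 0")
        case True
        have "(\<lambda>q. q 0) ` C = {0 :: real}" using False subl sublinear_zero by (auto simp: image_iff)
        then show ?thesis using True by (simp add: u_def)
      next
        case a0: False
        have "a * u x \<le> u (a *\<^sub>R x)"
          by (rule ge) (use a le in \<open>simp add: sublinear_scale[OF subl] mult_left_mono\<close>)
        moreover have "u (a *\<^sub>R x) / a \<le> u x"
        proof (rule ge)
          fix q assume q: "q \<in> C"
          then show "u (a *\<^sub>R x) / a \<le> q x"
            using a a0 le[OF q, of "a *\<^sub>R x"] by (simp add: sublinear_scale[OF subl] field_simps)
        qed
        ultimately show ?thesis using a a0 by (simp add: field_simps)
      qed
      obtain q0 where q0: "q0 \<in> C" using False by auto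
      then have "u \<le> q0" "q0 \<le> p" using CA le by (auto simp: A_def le_fun_def)
      then have "u \<le> p" by (rule order_trans)
      then have "u \<in> A" using add scale by (auto simp: A_def sublinear_def)
      then show ?thesis using le by (auto simp: le_fun_def)
    qed
  qed
  then obtain m where mA: "m \<in> A" and min_A: "\<forall>a\<in>A. a \<le> m \<longrightarrow> a = m" by blast
  have m: "sublinear m" "m \<le> p" using mA by (auto simp: A_def)
  have min: "q = m" if "sublinear q" "q \<le> m" for q
    using min_A that order_trans[OF that(2) m(2)] by (simp add: A_def)
  \<comment> \<open>Minimality forces \<open>lower_along m e = m\<close>, hence m (- e) \<le> - m e;
    the other inequality is subadditivity.\<close>
  have neg: "m (- e) = - m e" for e
  proof -
    have "lower_along m e = m"
      by (intro min sublinear_lower_along lower_along_le_self m)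
    then show ?thesis
      using lower_along_minus[OF m(1), of e] sublinear_minus_ge[OF m(1), of e] by simp
  qed
  have "linear m"
  proof (rule linearI)
    fix x y
    show "m (x + y) = m x + m y"
      \<comment> \<open>As m is odd, subadditivity at x, y and at - x, - y gives opposite
        inequalities.\<close>
      using sublinear_add[OF m(1), of x y] sublinear_add[OF m(1), of "- x" "- y"] neg[of "x + y"]
      by (simp add: neg)
  next
    fix a x
    show "m (a *\<^sub>R x) = a *\<^sub>R m x"
      using sublinear_scale[OF m(1), of a x] sublinear_scale[OF m(1), of "- a" x] neg[of "a *\<^sub>R x"]
      by (cases "a \<ge> 0") auto
  qed
  then show ?thesis using m(2) by blast
qed

section \<open>Scalar multiplication, Minkowski gauges and continuous functionals\<close>

lemma tendsto_scaleR_lcs: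
  fixes x :: "'a \<Rightarrow> 'e::seq_complete_lcs"
  assumes r: "(r \<longlongrightarrow> a) F" and x: "(x \<longlongrightarrow> l) F"
  shows "((\<lambda>z. r z *\<^sub>R x z) \<longlongrightarrow> a *\<^sub>R l) F"
proof (rule topological_tendstoI)
  fix U assume "open U" "a *\<^sub>R l \<in> U"
  then obtain e W where e: "e > 0" "open W" "l \<in> W"
    and U: "\<And>b y. \<bar>b - a\<bar> < e \<Longrightarrow> y \<in> W \<Longrightarrow> b *\<^sub>R y \<in> U"
    using scaleR_continuous[of U a l] by auto
  have "\<forall>\<^sub>F z in F. \<bar>r z - a\<bar> < e" using tendstoD[OF r e(1)] by (simp add: dist_real_def)
  moreover have "\<forall>\<^sub>F z in F. x z \<in> W" using x e by (simp add: topological_tendstoD)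
  ultimately show "\<forall>\<^sub>F z in F. r z *\<^sub>R x z \<in> U" by eventually_elim (rule U)
qed

lemma continuous_on_scaleR_lcs:
  fixes x :: "'a::topological_space \<Rightarrow> 'e::seq_complete_lcs"
  shows "continuous_on A r \<Longrightarrow> continuous_on A x \<Longrightarrow> continuous_on A (\<lambda>z. r z *\<^sub>R x z)"
  by (auto simp: continuous_on_def intro: tendsto_scaleR_lcs)

text \<open>A convex neighbourhood C of 0 that misses e has a sublinear Minkowski gauge q with q e
  \<ge> 1. A linear l below \<open>lower_along q e\<close> satisfies l (- e) \<le> - q e, hence l e
  \<ge> 1, and l \<le> q \<le> 1 on C gives continuity.\<close>

lemma ex_continuous_linear_functional:
  fixes e :: "'e::seq_complete_lcs"
  assumes "e \<noteq> 0"
  shows "\<exists>l. linear l \<and> continuous_on UNIV l \<and> l e \<noteq> (0::real)"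
proof -
  obtain U where U: "open U" "0 \<in> U" "e \<notin> U"
    using separation_t1[of 0 e] assms by auto
  obtain C :: "'e set" where C: "open C" "0 \<in> C" "C \<subseteq> U"
    and conv: "\<And>x y s t. x \<in> C \<Longrightarrow> y \<in> C \<Longrightarrow> s \<ge> 0 \<Longrightarrow> t \<ge> 0 \<Longrightarrow> s + t = 1 \<Longrightarrow> s *\<^sub>R x + t *\<^sub>R y \<in> C"
    using ex_convex_nhd_0[OF U(1,2)] by metis
  have eC: "e \<notin> C" using U C by auto
  define G where "G x = {t::real. t > 0 \<and> (1 / t) *\<^sub>R x \<in> C}" for x
  define q where "q x = Inf (G x)" for x
  have bdd: "bdd_below (G x)" for x by (rule bdd_belowI[of _ 0]) (auto simp: G_def)
  \<comment> \<open>C is absorbing: s x tends to 0 as s decreases to 0.\<close>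
  have ne: "G x \<noteq> {}" for x
  proof -
    have "((\<lambda>s. s *\<^sub>R x) \<longlongrightarrow> 0 *\<^sub>R x) (at_right 0)"
      by (intro tendsto_scaleR_lcs tendsto_intros)
    then have "\<forall>\<^sub>F s in at_right 0. s *\<^sub>R x \<in> C" using C by (intro topological_tendstoD) auto
    then have "\<forall>\<^sub>F s in at_right 0. s *\<^sub>R x \<in> C \<and> s > 0"
      by (intro eventually_conj eventually_at_right_less)
    then obtain s where "s *\<^sub>R x \<in> C" "s > 0"
      using eventually_happens[of _ "at_right (0::real)"] by force
    then have "1 / s \<in> G x" by (auto simp: G_def)
    then show ?thesis by blast
  qed
  have q_le: "q x \<le> t" if "t \<in> G x" for x t
    unfolding q_def by (rule cInf_lower[OF that bdd])
  have q_ge: "c \<le> q x" if "\<And>t. t \<in> G x \<Longrightarrow> c \<le> t" for x c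
    unfolding q_def by (rule cInf_greatest[OF ne that])
  have G_add: "s + t \<in> G (x + y)" if "s \<in> G x" "t \<in> G y" for s t x y
  proof -
    have st: "s > 0" "t > 0" using that by (auto simp: G_def)
    \<comment> \<open>Convex weights chosen so that the combination of x / s and y / t is (x + y) /
      (s + t).\<close>
    have "(s / (s + t)) *\<^sub>R ((1 / s) *\<^sub>R x) + (t / (s + t)) *\<^sub>R ((1 / t) *\<^sub>R y) \<in> C"
      using that st by (intro conv) (auto simp: G_def add_divide_distrib[symmetric])
    also have "(s / (s + t)) *\<^sub>R ((1 / s) *\<^sub>R x) + (t / (s + t)) *\<^sub>R ((1 / t) *\<^sub>R y) = (1 / (s + t)) *\<^sub>R (x + y)"
      using st by (simp add: scaleR_add_right)
    finally show ?thesis using st by (simp add: G_def)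
  qed
  have q_add: "q (x + y) \<le> q x + q y" for x y
  proof -
    have "q (x + y) - q y \<le> q x"
    proof (rule q_ge)
      fix s assume s: "s \<in> G x"
      have "q (x + y) - s \<le> q y"
      proof (rule q_ge)
        fix t assume "t \<in> G y"
        then show "q (x + y) - s \<le> t" using q_le[OF G_add[OF s]] by fastforce
      qed
      then show "q (x + y) - q y \<le> s" by simp
    qed
    then show ?thesis by simp
  qed
  have q_pos: "q (a *\<^sub>R x) \<le> a * q x" if a: "a > 0" for a x
  proof -
    have "q (a *\<^sub>R x) / a \<le> q x"
    proof (rule q_ge)
      fix t assume "t \<in> G x"
      then have "a * t \<in> G (a *\<^sub>R x)" using a by (auto simp: G_def)
      then show "q (a *\<^sub>R x) / a \<le> t" using q_le a by (simp add: field_simps)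
    qed
    then show ?thesis using a by (simp add: field_simps)
  qed
  have q_scale: "q (a *\<^sub>R x) = a * q x" if "a \<ge> 0" for a x
  proof (cases "a = 0")
    case True
    have "0 \<le> q 0" by (rule q_ge) (auto simp: G_def)
    moreover have "q 0 \<le> 0"
    proof (rule field_le_epsilon)
      fix d :: real assume "d > 0"
      then show "q 0 \<le> 0 + d" using q_le[of d 0] C by (simp add: G_def)
    qed
    ultimately show ?thesis using True by simp
  next
    case False
    then have a: "a > 0" using that by simp
    have "q (inverse a *\<^sub>R (a *\<^sub>R x)) \<le> inverse a * q (a *\<^sub>R x)" using a by (intro q_pos) simp
    then show ?thesis using q_pos[OF a, of x] a by (simp add: field_simps)
  qed
  have q: "sublinear q" using q_add q_scale by (auto simp: sublinear_def)
  have qe: "q e \<ge> 1"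
  proof (rule q_ge, rule ccontr)
    fix t assume t: "t \<in> G e" "\<not> 1 \<le> t"
    \<comment> \<open>For t < 1 the point e would be a convex combination of e / t, which lies in C,
      and 0.\<close>
    then have "t *\<^sub>R ((1 / t) *\<^sub>R e) + (1 - t) *\<^sub>R 0 \<in> C" using C by (intro conv) (auto simp: G_def)
    then show False using eC t by (simp add: G_def)
  qed
  \<comment> \<open>A linear l \<le> q alone could vanish at e; lowering q along e first prescribes
    the value there.\<close>
  obtain l where l: "linear l" "l \<le> lower_along q e"
    using ex_linear_le_sublinear[OF sublinear_lower_along[OF q]] by blast
  have "l (- e) \<le> - q e" using l(2) lower_along_minus[OF q, of e] by (auto simp: le_fun_def intro: order_trans)
  then have le: "l e \<noteq> 0" using qe linear_neg[OF l(1), of e] by simp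
  have lq: "l x \<le> q x" for x
    using l(2) lower_along_le_self[OF q] by (auto simp: le_fun_def intro: order_trans)
  have qC: "q x \<le> 1" if "x \<in> C" for x using q_le[of 1 x] that by (simp add: G_def)
  have "continuous_on UNIV l"
    unfolding continuous_on_def
  proof (intro ballI tendstoI)
    fix x :: 'e and d :: real assume d: "d > 0"
    \<comment> \<open>C need not be symmetric, so y - x and x - y are both needed; the factor 2 / d
      bounds the difference by d / 2, strictly below d.\<close>
    have "((\<lambda>y. (2 / d) *\<^sub>R (y - x)) \<longlongrightarrow> (2 / d) *\<^sub>R (x - x)) (at x)"
      by (intro tendsto_scaleR_lcs tendsto_intros)
    then have 1: "\<forall>\<^sub>F y in at x. (2 / d) *\<^sub>R (y - x) \<in> C" using C by (intro topological_tendstoD) auto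
    have "((\<lambda>y. (2 / d) *\<^sub>R (x - y)) \<longlongrightarrow> (2 / d) *\<^sub>R (x - x)) (at x)"
      by (intro tendsto_scaleR_lcs tendsto_intros)
    then have 2: "\<forall>\<^sub>F y in at x. (2 / d) *\<^sub>R (x - y) \<in> C" using C by (intro topological_tendstoD) auto
    show "\<forall>\<^sub>F y in at x. dist (l y) (l x) < d" using 1 2
    proof eventually_elim
      case (elim y)
      have "(2 / d) * (l y - l x) \<le> 1" "(2 / d) * (l x - l y) \<le> 1"
        using order_trans[OF lq qC[OF elim(1)]] order_trans[OF lq qC[OF elim(2)]] l(1)
        by (simp_all add: linear_cmul linear_diff diff_divide_distrib right_diff_distrib)
      then show ?case using d by (simp add: dist_real_def field_simps abs_if)
    qed
  qed
  then show ?thesis using l le by blast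
qed

subsection \<open>Differential calculus on open subsets of the model spaces\<close>

lemma lincomb_in_Rn [simp]: "lincomb n a u b w \<in> Rn n"
  by (simp add: lincomb_def)

lemma lincomb_apply [simp]: "i < n \<Longrightarrow> lincomb n a u b w i = a * u i + b * w i"
  by (simp add: lincomb_def)

lemma unit_vec_in_Rn [simp]: "unit_vec n i \<in> Rn n"
  by (simp add: unit_vec_def)

lemma unit_vec_apply [simp]: "m < n \<Longrightarrow> unit_vec n i m = (if m = i then 1 else 0)"
  by (simp add: unit_vec_def)

lemma Rn_eqI: "p \<in> Rn n \<Longrightarrow> q \<in> Rn n \<Longrightarrow> (\<And>i. i < n \<Longrightarrow> p i = q i) \<Longrightarrow> p = q"
  by (rule PiE_ext) auto

lemma lincomb_1_0 [simp]: "p \<in> Rn n \<Longrightarrow> lincomb n 1 p 0 w = p"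
  by (rule Rn_eqI[of _ n]) auto

lemma continuous_on_lincomb [continuous_intros]:
  assumes "continuous_on A a" "continuous_on A u" "continuous_on A b" "continuous_on A w"
  shows "continuous_on A (\<lambda>z. lincomb n (a z) (u z) (b z) (w z))"
proof (rule continuous_on_coordinatewise_then_product)
  fix i
  show "continuous_on A (\<lambda>z. lincomb n (a z) (u z) (b z) (w z) i)"
    using assms continuous_on_product_then_coordinatewise[OF assms(2)]
      continuous_on_product_then_coordinatewise[OF assms(4)]
    by (cases "i < n") (auto simp: lincomb_def intro!: continuous_intros)
qed

definition model_space :: "nat \<Rightarrow> (nat \<Rightarrow> real) set \<Rightarrow> bool" where
  "model_space n H \<longleftrightarrow> H = Rn n \<or> H = half_space n"

lemma model_open_iff: "model_open n D \<longleftrightarrow> (\<exists>H. model_space n H \<and> openin (top_of_set H) D)"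
  by (auto simp: model_open_def model_space_def)

lemma model_space_subset: "model_space n H \<Longrightarrow> H \<subseteq> Rn n"
  by (auto simp: model_space_def half_space_def)

text \<open>The half space restricts one coordinate, and from below only. Hence a point whose
  coordinates lie between those of p and q stays inside, as needed for moving in one coordinate at a
  time.\<close>

lemma model_space_mixture:
  assumes "model_space n H" "p \<in> H" "q \<in> H" "z \<in> Rn n"
    "\<And>i. i < n \<Longrightarrow> p i \<le> z i \<or> q i \<le> z i"
  shows "z \<in> H"
proof -
  have "0 \<le> z 0" if "0 \<le> p 0" "0 \<le> q 0" "n > 0" using assms(5)[OF that(3)] that by auto
  then show ?thesis using assms(1-4) by (auto simp: model_space_def half_space_def)
qed

lemma model_open_subset: "model_open n D \<Longrightarrow> D \<subseteq> Rn n"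
  by (metis model_open_iff model_space_subset openin_imp_subset order_trans)

lemma model_open_openin: "model_open n D \<Longrightarrow> openin (top_of_set D) D' \<Longrightarrow> model_open n D'"
  by (metis model_open_def openin_subtopology_self openin_trans)

lemma model_open_Rn [simp]: "model_open n (Rn n)"
  by (simp add: model_open_def)

text \<open>A basic open set of the product topology may restrict coordinates from n on, but these
  are fixed at \<open>undefined\<close> on \<open>Rn n\<close>; a cube in the first n coordinates
  remains.\<close>

lemma open_contains_box:
  assumes "open W" "p \<in> W" "p \<in> Rn n"
  shows "\<exists>\<delta>>0. \<forall>q\<in>Rn n. (\<forall>i<n. \<bar>q i - p i\<bar> < \<delta>) \<longrightarrow> q \<in> W"
proof -
  have "openin (product_topology (\<lambda>i. euclidean) UNIV) W"
    using assms(1) by (simp add: euclidean_product_topology)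
  from product_topology_open_contains_basis[OF this assms(2)]
  obtain X where X: "p \<in> (\<Pi>\<^sub>E i\<in>UNIV. X i)" "\<And>i. open (X i)" "(\<Pi>\<^sub>E i\<in>UNIV. X i) \<subseteq> W"
    by auto
  have pX: "p i \<in> X i" for i using X(1) by auto
  have "\<exists>\<delta>>0. \<forall>y. \<bar>y - p i\<bar> < \<delta> \<longrightarrow> y \<in> X i" for i
    using X(2)[of i] pX[of i] by (auto simp: open_dist dist_real_def)
  then obtain d where d: "\<And>i. d i > 0" "\<And>i y. \<bar>y - p i\<bar> < d i \<Longrightarrow> y \<in> X i" by metis
  \<comment> \<open>Inserting 1 keeps the minimum meaningful for n = 0.\<close>
  define \<delta> where "\<delta> = Min (insert 1 (d ` {..<n}))"
  have "\<delta> > 0" using d(1) by (auto simp: \<delta>_def)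
  moreover have "q \<in> W" if q: "q \<in> Rn n" "\<forall>i<n. \<bar>q i - p i\<bar> < \<delta>" for q
  proof -
    have "q i \<in> X i" for i
    proof (cases "i < n")
      case True
      then have "\<delta> \<le> d i" by (auto simp: \<delta>_def)
      then show ?thesis using q True by (intro d(2)) fastforce
    next
      case False
      then have "q i = p i" using q(1) assms(3) by (auto simp: PiE_def extensional_def)
      then show ?thesis using pX by simp
    qed
    then show ?thesis using X(3) by auto
  qed
  ultimately show ?thesis by blast
qed

lemma openin_contains_box:
  assumes "openin (top_of_set H) D" "p \<in> D" "H \<subseteq> Rn n"
  shows "\<exists>\<delta>>0. \<forall>q\<in>H. (\<forall>i<n. \<bar>q i - p i\<bar> < \<delta>) \<longrightarrow> q \<in> D"
proof -
  obtain W where W: "open W" "D = H \<inter> W" using assms(1) by (auto simp: openin_open)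
  obtain \<delta> where "\<delta> > 0" "\<forall>q\<in>Rn n. (\<forall>i<n. \<bar>q i - p i\<bar> < \<delta>) \<longrightarrow> q \<in> W"
    using open_contains_box[OF W(1), of p n] assms W(2) by blast
  then show ?thesis using W(2) assms(3) by blast
qed

lemma continuous_on_contains_box:
  fixes u :: "(nat \<Rightarrow> real) \<Rightarrow> real"
  assumes "continuous_on D u" "p \<in> D" "D \<subseteq> Rn n" "e > 0"
  shows "\<exists>\<delta>>0. \<forall>q\<in>D. (\<forall>i<n. \<bar>q i - p i\<bar> < \<delta>) \<longrightarrow> \<bar>u q - u p\<bar> < e"
proof -
  have "openin (top_of_set D) (D \<inter> u -` ball (u p) e)"
    using assms(1) continuous_on_open_gen[of u D UNIV] by (simp add: continuous_openin_preimage_gen)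
  from openin_contains_box[OF this _ assms(3), of p]
  show ?thesis using assms by (auto simp: dist_real_def abs_minus_commute)
qed

text \<open>Derivatives along a line are unique only if 0 is an accumulation point of the admissible
  parameters. At a boundary point at least one of the directions w, - w does not leave the half
  space.\<close>

lemma line_at_within_nontrivial:
  assumes D: "model_open n D" and p: "p \<in> D" and w: "w \<in> Rn n"
  shows "at 0 within {t. lincomb n 1 p t w \<in> D} \<noteq> bot"
proof -
  obtain H where H: "model_space n H" "openin (top_of_set H) D" using D by (auto simp: model_open_iff)
  obtain \<delta> where \<delta>: "\<delta> > 0" "\<forall>q\<in>H. (\<forall>i<n. \<bar>q i - p i\<bar> < \<delta>) \<longrightarrow> q \<in> D"
    using openin_contains_box[OF H(2) p model_space_subset[OF H(1)]] by blast
  have pH: "p \<in> H" using H(2) p openin_imp_subset by blast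
  \<comment> \<open>The sign for which \<open>s * w 0\<close> is nonnegative, so that moving along s
    w does not leave the half space.\<close>
  define s :: real where "s = (if w 0 \<ge> 0 then 1 else - 1)"
  define M where "M = 1 + (\<Sum>i<n. \<bar>w i\<bar>)"
  have M: "M > 0" "\<And>i. i < n \<Longrightarrow> \<bar>w i\<bar> < M"
  proof -
    have "0 \<le> (\<Sum>i<n. \<bar>w i\<bar>)" by (simp add: sum_nonneg)
    then show "M > 0" unfolding M_def by linarith
    fix i assume "i < n"
    then have "\<bar>w i\<bar> \<le> (\<Sum>i<n. \<bar>w i\<bar>)" by (intro member_le_sum) auto
    then show "\<bar>w i\<bar> < M" by (simp add: M_def)
  qed
  have in_D: "lincomb n 1 p (s * t) w \<in> D" if t: "0 < t" "t < \<delta> / M" for t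
  proof -
    have "lincomb n 1 p (s * t) w \<in> H"
    proof -
      have "s * t * w 0 = t * \<bar>w 0\<bar>" by (auto simp: s_def)
      then have "0 \<le> s * t * w 0" using t by (metis abs_ge_zero less_imp_le mult_nonneg_nonneg)
      then have "lincomb n 1 p (s * t) w \<in> half_space n" if "p \<in> half_space n"
        using that by (simp add: half_space_def)
      then show ?thesis using H(1) pH lincomb_in_Rn unfolding model_space_def by metis
    qed
    moreover have "\<bar>lincomb n 1 p (s * t) w i - p i\<bar> < \<delta>" if i: "i < n" for i
    proof -
      have "t * \<bar>w i\<bar> \<le> t * M" using M(2)[OF i] t by simp
      also have "t * M < \<delta>" using t M(1) by (simp add: field_simps)
      finally show ?thesis using i t by (simp add: abs_mult s_def)
    qed
    ultimately show ?thesis using \<delta>(2) by blast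
  qed
  have "0 islimpt {t. lincomb n 1 p t w \<in> D}"
    unfolding islimpt_approachable
  proof (intro allI impI)
    fix e :: real assume e: "e > 0"
    define t where "t = min (e / 2) (\<delta> / M / 2)"
    have "t > 0" "t < \<delta> / M" "t < e" using e \<delta>(1) M(1) by (auto simp: t_def min_def field_simps)
    then show "\<exists>x'\<in>{t. lincomb n 1 p t w \<in> D}. x' \<noteq> 0 \<and> dist x' 0 < e"
      using in_D by (intro bexI[of _ "s * t"]) (auto simp: s_def)
  qed
  then show ?thesis by (simp add: trivial_limit_within)
qed

lemma dir_deriv_eq:
  assumes "model_open n D" "p \<in> D" "w \<in> Rn n" "has_dir_deriv n D x w p l"
  shows "dir_deriv n D x w p = l"
  unfolding dir_deriv_def
  using tendsto_unique[OF line_at_within_nontrivial[OF assms(1-3)]] assms(4)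
  by (auto simp: has_dir_deriv_def intro!: the_equality)

lemma has_dir_deriv_cong:
  assumes "p \<in> D" "\<And>q. q \<in> D \<Longrightarrow> x q = y q"
  shows "has_dir_deriv n D x w p l \<longleftrightarrow> has_dir_deriv n D y w p l"
  unfolding has_dir_deriv_def using assms by (intro Lim_cong_within) auto

lemma dir_deriv_cong:
  assumes "p \<in> D" "\<And>q. q \<in> D \<Longrightarrow> x q = y q"
  shows "dir_deriv n D x w p = dir_deriv n D y w p"
  using has_dir_deriv_cong[of p D x y, OF assms] by (simp add: dir_deriv_def)

text \<open>Only parameters near 0 matter, and those for which the line stays in the open set W form
  a neighbourhood of 0.\<close>

lemma has_dir_deriv_open_subset:
  assumes "openin (top_of_set D) D'" "p \<in> D'" "D \<subseteq> Rn n"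
  shows "has_dir_deriv n D' x w p l \<longleftrightarrow> has_dir_deriv n D x w p l"
proof -
  obtain W where W: "open W" "D' = D \<inter> W" using assms(1) by (auto simp: openin_open)
  define S where "S = {t. lincomb n 1 p t w \<in> W}"
  have "open S"
    unfolding S_def using W(1)
    by (intro open_vimage[of W "\<lambda>t. lincomb n 1 p t w", unfolded vimage_def] continuous_intros) auto
  moreover have "0 \<in> S" using assms W by (auto simp: S_def)
  ultimately have "at 0 within {t. lincomb n 1 p t w \<in> D'} = at 0 within {t. lincomb n 1 p t w \<in> D}"
    by (intro at_within_nhd[of 0 S]) (auto simp: W S_def)
  then show ?thesis by (simp add: has_dir_deriv_def)
qed

lemma dir_deriv_open_subset:
  assumes "openin (top_of_set D) D'" "p \<in> D'" "D \<subseteq> Rn n"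
  shows "dir_deriv n D' x w p = dir_deriv n D x w p"
  by (simp add: dir_deriv_def has_dir_deriv_open_subset[OF assms])

text \<open>Gives access to the product, chain and mean value rules of one variable. That p lies in
  \<open>Rn n\<close> ensures that the line passes through p at t = 0.\<close>

lemma has_dir_deriv_real_iff:
  fixes u :: "(nat \<Rightarrow> real) \<Rightarrow> real"
  assumes "p \<in> Rn n"
  shows "has_dir_deriv n D u w p l \<longleftrightarrow>
    ((\<lambda>t. u (lincomb n 1 p t w)) has_real_derivative l) (at 0 within {t. lincomb n 1 p t w \<in> D})"
  using assms by (simp add: has_dir_deriv_def has_field_derivative_iff)

subsection \<open>Real functions with iterated partial derivatives\<close>

abbreviation pd :: "nat \<Rightarrow> (nat \<Rightarrow> real) set \<Rightarrow> nat \<Rightarrow> ((nat \<Rightarrow> real) \<Rightarrow> real) \<Rightarrow> (nat \<Rightarrow> real) \<Rightarrow> real" where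
  "pd n D i u \<equiv> dir_deriv n D u (unit_vec n i)"

text \<open>Only coordinate derivatives, taken one at a time: this recursion passes directly to
  sums, products and compositions. All directions and the joint continuity demanded by
  \<open>Ck_MB\<close> are recovered later from the coordinate formula
  \<open>jet_form\<close>.\<close>

primrec Ck_real :: "nat \<Rightarrow> (nat \<Rightarrow> real) set \<Rightarrow> nat \<Rightarrow> ((nat \<Rightarrow> real) \<Rightarrow> real) \<Rightarrow> bool" where
  "Ck_real n D 0 u \<longleftrightarrow> continuous_on D u"
| "Ck_real n D (Suc k) u \<longleftrightarrow> continuous_on D u \<and>
     (\<forall>i<n. (\<forall>p\<in>D. \<exists>l. has_dir_deriv n D u (unit_vec n i) p l) \<and> Ck_real n D k (pd n D i u))"

lemma Ck_real_continuous_on: "Ck_real n D k u \<Longrightarrow> continuous_on D u"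
  by (cases k) auto

lemma Ck_real_Suc_D: "Ck_real n D (Suc k) u \<Longrightarrow> Ck_real n D k u"
proof (induction k arbitrary: u)
  case (Suc k)
  then show ?case by (metis Ck_real.simps(2))
qed auto

lemma Ck_real_cong:
  assumes "\<And>q. q \<in> D \<Longrightarrow> u q = w q"
  shows "Ck_real n D k u \<longleftrightarrow> Ck_real n D k w"
  using assms
proof (induction k arbitrary: u w)
  case 0
  then show ?case by (simp cong: continuous_on_cong)
next
  case (Suc k)
  have "Ck_real n D k (pd n D i u) \<longleftrightarrow> Ck_real n D k (pd n D i w)" for i
    by (rule Suc.IH) (rule dir_deriv_cong[OF _ Suc.prems])
  moreover have "continuous_on D u \<longleftrightarrow> continuous_on D w"
    using Suc.prems by (rule continuous_on_cong[OF refl])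
  moreover have "(\<forall>p\<in>D. \<exists>l. has_dir_deriv n D u (unit_vec n i) p l) \<longleftrightarrow>
      (\<forall>p\<in>D. \<exists>l. has_dir_deriv n D w (unit_vec n i) p l)" for i
    using has_dir_deriv_cong[of _ D u w, OF _ Suc.prems] by blast
  ultimately show ?case by simp
qed

context
  fixes n :: nat and D :: "(nat \<Rightarrow> real) set"
  assumes D: "model_open n D"
begin

lemma model_open_memD: "p \<in> D \<Longrightarrow> p \<in> Rn n"
  using model_open_subset[OF D] by blast

text \<open>Explicit candidates \<open>g\<close> replace the definite description in
  \<open>pd\<close>, so that closure proofs can exhibit their derivatives.\<close>

lemma Ck_real_SucI:
  assumes "continuous_on D u"
    and "\<And>i p. i < n \<Longrightarrow> p \<in> D \<Longrightarrow> has_dir_deriv n D u (unit_vec n i) p (g i p)"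
    and "\<And>i. i < n \<Longrightarrow> Ck_real n D k (g i)"
  shows "Ck_real n D (Suc k) u"
proof -
  have "Ck_real n D k (pd n D i u)" if i: "i < n" for i
    using assms(3)[OF i] Ck_real_cong[of D "pd n D i u" "g i" n k] dir_deriv_eq[OF D _ unit_vec_in_Rn assms(2)[OF i]]
    by blast
  then show ?thesis using assms by auto
qed

lemma Ck_real_Suc_has_pd:
  assumes "Ck_real n D (Suc k) u" "i < n" "p \<in> D"
  shows "has_dir_deriv n D u (unit_vec n i) p (pd n D i u p)"
proof -
  obtain l where l: "has_dir_deriv n D u (unit_vec n i) p l" using assms by auto
  then show ?thesis using dir_deriv_eq[OF D assms(3) unit_vec_in_Rn l] by simp
qed

lemma Ck_real_const: "Ck_real n D k (\<lambda>_. c)"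
proof (induction k arbitrary: c)
  case (Suc k)
  show ?case
    by (rule Ck_real_SucI[where g = "\<lambda>_ _. 0"]) (auto simp: has_dir_deriv_def Suc)
qed auto

lemma has_dir_deriv_add_real:
  fixes u w :: "(nat \<Rightarrow> real) \<Rightarrow> real"
  assumes "p \<in> D" "has_dir_deriv n D u z p a" "has_dir_deriv n D w z p b"
  shows "has_dir_deriv n D (\<lambda>q. u q + w q) z p (a + b)"
  using assms model_open_memD by (auto simp: has_dir_deriv_real_iff intro!: derivative_intros)

lemma has_dir_deriv_mult_real:
  fixes u w :: "(nat \<Rightarrow> real) \<Rightarrow> real"
  assumes "p \<in> D" "has_dir_deriv n D u z p a" "has_dir_deriv n D w z p b"
  shows "has_dir_deriv n D (\<lambda>q. u q * w q) z p (a * w p + b * u p)"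
proof -
  have p: "p \<in> Rn n" using assms model_open_memD by auto
  show ?thesis
    using assms(2,3) DERIV_mult[of "\<lambda>t. u (lincomb n 1 p t z)" a 0 _ "\<lambda>t. w (lincomb n 1 p t z)" b] p
    by (simp add: has_dir_deriv_real_iff)
qed

lemma Ck_real_add: "Ck_real n D k u \<Longrightarrow> Ck_real n D k w \<Longrightarrow> Ck_real n D k (\<lambda>p. u p + w p)"
proof (induction k arbitrary: u w)
  case 0
  then show ?case by (auto intro: continuous_intros)
next
  case (Suc k)
  show ?case
    by (rule Ck_real_SucI[where g = "\<lambda>i p. pd n D i u p + pd n D i w p"])
      (use Suc in \<open>auto intro!: continuous_intros Suc.IH has_dir_deriv_add_real Ck_real_Suc_has_pd\<close>)
qed

lemma Ck_real_sum: "(\<And>a. a \<in> A \<Longrightarrow> Ck_real n D k (u a)) \<Longrightarrow> Ck_real n D k (\<lambda>p. \<Sum>a\<in>A. u a p)"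
  by (induction A rule: infinite_finite_induct) (auto intro: Ck_real_const Ck_real_add)

lemma Ck_real_mult: "Ck_real n D k u \<Longrightarrow> Ck_real n D k w \<Longrightarrow> Ck_real n D k (\<lambda>p. u p * w p)"
proof (induction k arbitrary: u w)
  case 0
  then show ?case by (auto intro: continuous_intros)
next
  case (Suc k)
  have k: "Ck_real n D k u" "Ck_real n D k w" using Suc.prems Ck_real_Suc_D by blast+
  show ?case
    by (rule Ck_real_SucI[where g = "\<lambda>i p. pd n D i u p * w p + pd n D i w p * u p"])
      (use Suc k in \<open>auto intro!: continuous_intros Ck_real_add Suc.IH has_dir_deriv_mult_real Ck_real_Suc_has_pd\<close>)
qed

text \<open>The hypothesis says that the span of the family \<open>h\<close> is closed under differentiation.\<close>

lemma Ck_real_compose: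
  fixes h :: "nat \<Rightarrow> real \<Rightarrow> real"
  assumes h: "\<And>m t. (h m has_real_derivative (\<Sum>j<c m. a m j * h (b m j) t)) (at t)"
  shows "Ck_real n D k u \<Longrightarrow> Ck_real n D k (\<lambda>p. h m (u p))"
proof (induction k arbitrary: m)
  case 0
  then show ?case using DERIV_isCont[OF h]
    by (auto intro!: continuous_on_compose2[of UNIV "h m" D u] simp: continuous_at_imp_continuous_on)
next
  case (Suc k)
  have cont: "continuous_on D (\<lambda>p. h m (u p))"
    using DERIV_isCont[OF h] Suc.prems
    by (auto intro!: continuous_on_compose2[of UNIV "h m" D u] simp: continuous_at_imp_continuous_on)
  have k: "Ck_real n D k u" using Suc.prems Ck_real_Suc_D by blast
  show ?case
  proof (rule Ck_real_SucI[where g = "\<lambda>i p. (\<Sum>j<c m. a m j * h (b m j) (u p)) * pd n D i u p", OF cont])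
    fix i p assume i: "i < n" "p \<in> D"
    then have p: "p \<in> Rn n" using model_open_memD by auto
    then show "has_dir_deriv n D (\<lambda>p. h m (u p)) (unit_vec n i) p
        ((\<Sum>j<c m. a m j * h (b m j) (u p)) * pd n D i u p)"
      using Ck_real_Suc_has_pd[OF Suc.prems i] h[of m "u p"] DERIV_chain2[of "h m" _ "\<lambda>t. u (lincomb n 1 p t (unit_vec n i))" 0]
      by (simp add: has_dir_deriv_real_iff)
  next
    fix i assume i: "i < n"
    show "Ck_real n D k (\<lambda>p. (\<Sum>j<c m. a m j * h (b m j) (u p)) * pd n D i u p)"
      using Suc.prems i by (intro Ck_real_mult Ck_real_sum Ck_real_const Suc.IH k) auto
  qed
qed

lemma Ck_real_pd_open_subset:
  assumes "openin (top_of_set D) D'"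
  shows "Ck_real n D' k (pd n D' i u) \<longleftrightarrow> Ck_real n D' k (pd n D i u)"
  by (rule Ck_real_cong) (rule dir_deriv_open_subset[OF assms _ model_open_subset[OF D]])

text \<open>Continuity and directional derivatives are local, so the two pieces determine every
  \<open>pd\<close>. Used to glue a bump function to its extension by zero.\<close>

lemma Ck_real_locally:
  assumes "openin (top_of_set D) D1" "openin (top_of_set D) D2" "D = D1 \<union> D2"
  shows "Ck_real n D1 k u \<Longrightarrow> Ck_real n D2 k u \<Longrightarrow> Ck_real n D k u"
proof (induction k arbitrary: u)
  case 0
  then show ?case using assms continuous_on_Un_local_open[of D1 D2 u] by simp
next
  case (Suc k)
  note sub = has_dir_deriv_open_subset[OF assms(1) _ model_open_subset[OF D]]
    has_dir_deriv_open_subset[OF assms(2) _ model_open_subset[OF D]]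
  have "Ck_real n D k (pd n D i u)" if i: "i < n" for i
  proof (rule Suc.IH)
    show "Ck_real n D1 k (pd n D i u)"
      using Suc.prems i by (simp flip: Ck_real_pd_open_subset[OF assms(1)])
    show "Ck_real n D2 k (pd n D i u)"
      using Suc.prems i by (simp flip: Ck_real_pd_open_subset[OF assms(2)])
  qed
  moreover have "continuous_on D u" using Ck_real_continuous_on[OF Suc.prems(1)] Ck_real_continuous_on[OF Suc.prems(2)]
    using assms continuous_on_Un_local_open[of D1 D2 u] by simp
  moreover have "\<exists>l. has_dir_deriv n D u (unit_vec n i) p l" if "i < n" "p \<in> D" for i p
  proof -
    have "p \<in> D1 \<or> p \<in> D2" using that(2) assms(3) by blast
    then show ?thesis
    proof
      assume p: "p \<in> D1"
      then have "\<exists>l. has_dir_deriv n D1 u (unit_vec n i) p l" using Suc.prems(1) that(1) by simp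
      then show ?thesis using sub(1)[OF p] by blast
    next
      assume p: "p \<in> D2"
      then have "\<exists>l. has_dir_deriv n D2 u (unit_vec n i) p l" using Suc.prems(2) that(1) by simp
      then show ?thesis using sub(2)[OF p] by blast
    qed
  qed
  ultimately show ?case by simp
qed

end

text \<open>\<open>has_dir_deriv\<close> looks at a line at parameter 0 only. Shifting the base
  point gives a derivative at any parameter t, the form that the mean value inequality
  takes.\<close>

lemma has_dir_deriv_line:
  fixes u :: "(nat \<Rightarrow> real) \<Rightarrow> real"
  assumes "has_dir_deriv n D u w (lincomb n 1 p t w) l" "\<And>s. s \<in> S \<Longrightarrow> lincomb n 1 p s w \<in> D"
  shows "((\<lambda>s. u (lincomb n 1 p s w)) has_real_derivative l) (at t within S)"
proof -
  let ?f = "\<lambda>s. u (lincomb n 1 (lincomb n 1 p t w) s w)"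
  have shift: "lincomb n 1 (lincomb n 1 p t w) (s - t) w = lincomb n 1 p s w" for s
    by (rule Rn_eqI[of _ n]) (auto simp: algebra_simps)
  have "(?f has_real_derivative l) (at 0 within {s. lincomb n 1 (lincomb n 1 p t w) s w \<in> D})"
    using assms(1) by (simp add: has_dir_deriv_real_iff)
  then have "(?f has_real_derivative l) (at (t - t) within (\<lambda>s. s - t) ` S)"
    by (simp, rule DERIV_subset) (use assms(2) in \<open>auto simp: shift\<close>)
  moreover have "((\<lambda>s. s - t) has_real_derivative 1) (at t within S)"
    by (auto intro!: derivative_eq_intros)
  ultimately have "(?f \<circ> (\<lambda>s. s - t) has_real_derivative l * 1) (at t within S)"
    by (rule DERIV_image_chain)
  then show ?thesis by (simp add: o_def shift)
qed

text \<open>Strict differentiability: one passes from \<open>r\<close> to \<open>q\<close> by changing one coordinate at a time,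
  which does not leave the half space.\<close>

lemma increment_estimate:
  fixes u :: "(nat \<Rightarrow> real) \<Rightarrow> real"
  assumes D: "model_open n D"
    and g: "\<And>i p. i < n \<Longrightarrow> p \<in> D \<Longrightarrow> has_dir_deriv n D u (unit_vec n i) p (g i p)"
    and cont: "\<And>i. i < n \<Longrightarrow> continuous_on D (g i)"
    and p: "p \<in> D" and e: "e > 0"
  shows "\<exists>\<delta>>0. \<forall>q\<in>D. \<forall>r\<in>D. (\<forall>i<n. \<bar>q i - p i\<bar> < \<delta>) \<longrightarrow> (\<forall>i<n. \<bar>r i - p i\<bar> < \<delta>) \<longrightarrow>
    \<bar>u q - u r - (\<Sum>i<n. g i p * (q i - r i))\<bar> \<le> e * (\<Sum>i<n. \<bar>q i - r i\<bar>)"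
proof -
  obtain H where H: "model_space n H" "openin (top_of_set H) D" using D by (auto simp: model_open_iff)
  obtain d0 where d0: "d0 > 0" "\<And>q. q \<in> H \<Longrightarrow> (\<forall>i<n. \<bar>q i - p i\<bar> < d0) \<Longrightarrow> q \<in> D"
    using openin_contains_box[OF H(2) p model_space_subset[OF H(1)]] by blast
  have DH: "D \<subseteq> H" using H(2) by (rule openin_imp_subset)
  have "\<exists>\<delta>>0. i < n \<longrightarrow> (\<forall>q\<in>D. (\<forall>i<n. \<bar>q i - p i\<bar> < \<delta>) \<longrightarrow> \<bar>g i q - g i p\<bar> < e)" for i
    using continuous_on_contains_box[OF cont p model_open_subset[OF D] e]
    by (cases "i < n") (auto intro: exI[of _ 1])
  then obtain d where d: "\<And>i. d i > 0"
    "\<And>i q. i < n \<Longrightarrow> q \<in> D \<Longrightarrow> (\<forall>j<n. \<bar>q j - p j\<bar> < d i) \<Longrightarrow> \<bar>g i q - g i p\<bar> < e"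
    by metis
  define \<delta> where "\<delta> = Min (insert d0 (d ` {..<n}))"
  have \<delta>: "\<delta> > 0" "\<delta> \<le> d0" "\<And>i. i < n \<Longrightarrow> \<delta> \<le> d i" using d(1) d0(1) by (auto simp: \<delta>_def)
  show ?thesis
  proof (rule exI[of _ \<delta>], intro conjI ballI impI)
    fix q r assume q: "q \<in> D" "\<forall>i<n. \<bar>q i - p i\<bar> < \<delta>" and r: "r \<in> D" "\<forall>i<n. \<bar>r i - p i\<bar> < \<delta>"
    define z where "z m = (\<lambda>i\<in>{..<n}. if i < m then q i else r i)" for m
    have qr: "q \<in> Rn n" "r \<in> Rn n" using model_open_subset[OF D] q(1) r(1) by blast+
    have z: "z n = q" "z 0 = r"
      by (rule Rn_eqI[of _ n]; use qr in \<open>simp add: z_def\<close>)+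
    have step: "\<bar>u (z (Suc m)) - u (z m) - g m p * (q m - r m)\<bar> \<le> e * \<bar>q m - r m\<bar>" if m: "m < n" for m
    proof -
      define y where "y t = lincomb n 1 (z m) t (unit_vec n m)" for t
      define S where "S = closed_segment 0 (q m - r m)"
      have y_apply: "y t i = (if i = m then r m + t else if i < m then q i else r i)" if "i < n" for t i
        using that by (simp add: y_def z_def)
      have y0: "y 0 = z m" by (simp add: y_def z_def)
      have y1: "y (q m - r m) = z (Suc m)"
        by (rule Rn_eqI[of _ n]) (use m in \<open>auto simp: y_def z_def less_Suc_eq\<close>)
      have y_D: "y t \<in> D" and y_near: "\<forall>i<n. \<bar>y t i - p i\<bar> < \<delta>" if t: "t \<in> S" for t
      proof -
        have tm: "min (q m) (r m) \<le> r m + t" "r m + t \<le> max (q m) (r m)"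
          using t by (auto simp: S_def closed_segment_eq_real_ivl split: if_splits)
        show near: "\<forall>i<n. \<bar>y t i - p i\<bar> < \<delta>"
        proof (intro allI impI)
          fix i assume i: "i < n"
          have "\<bar>r m + t - p m\<bar> < \<delta>" using tm q(2) r(2) m by (smt (verit, best))
          then show "\<bar>y t i - p i\<bar> < \<delta>" using i q(2) r(2) by (simp add: y_apply)
        qed
        have "y t \<in> H"
        proof (rule model_space_mixture[OF H(1)])
          show "q \<in> H" "r \<in> H" using q r DH by auto
          show "y t \<in> Rn n" by (simp add: y_def)
          show "q i \<le> y t i \<or> r i \<le> y t i" if "i < n" for i
            using tm y_apply[OF that] by auto
        qed
        then show "y t \<in> D" by (rule d0(2)) (use near \<delta>(2) less_le_trans in blast)
      qed
      \<comment> \<open>Mean value inequality for u (y t) - g m p * t, whose derivative is at most e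
        in absolute value near p.\<close>
      have "norm ((u (y (q m - r m)) - g m p * (q m - r m)) - (u (y 0) - g m p * 0)) \<le> e * norm (q m - r m - 0)"
      proof (rule field_differentiable_bound[where S = S and f' = "\<lambda>t. g m (y t) - g m p"])
        show "convex S" "q m - r m \<in> S" "0 \<in> S" by (auto simp: S_def)
        fix t assume t: "t \<in> S"
        have "((\<lambda>t. u (y t)) has_real_derivative g m (y t)) (at t within S)"
          unfolding y_def
          by (rule has_dir_deriv_line) (use g[OF m] y_D t in \<open>auto simp: y_def\<close>)
        then show "((\<lambda>t. u (y t) - g m p * t) has_field_derivative g m (y t) - g m p) (at t within S)"
          by (auto intro!: derivative_eq_intros)
        have "\<forall>i<n. \<bar>y t i - p i\<bar> < d m" using y_near[OF t] \<delta>(3)[OF m] less_le_trans by blast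
        then show "norm (g m (y t) - g m p) \<le> e" using d(2)[OF m y_D[OF t]] by simp
      qed
      then show ?thesis by (simp add: y0 y1)
    qed
    have "u q - u r - (\<Sum>i<n. g i p * (q i - r i)) =
        (\<Sum>m<n. u (z (Suc m)) - u (z m) - g m p * (q m - r m))"
      using sum_lessThan_telescope[of "\<lambda>m. u (z m)" n] by (simp add: z sum_subtractf)
    also have "\<bar>\<dots>\<bar> \<le> (\<Sum>m<n. \<bar>u (z (Suc m)) - u (z m) - g m p * (q m - r m)\<bar>)"
      by (rule sum_abs)
    also have "\<dots> \<le> (\<Sum>m<n. e * \<bar>q m - r m\<bar>)"
      by (rule sum_mono) (use step in auto)
    finally show "\<bar>u q - u r - (\<Sum>i<n. g i p * (q i - r i))\<bar> \<le> e * (\<Sum>i<n. \<bar>q i - r i\<bar>)"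
      by (simp add: sum_distrib_left)
  qed (use \<delta> in auto)
qed

text \<open>The increment estimate with r = p and q = p + t w shows that the remainder is
  o(t).\<close>

lemma has_dir_deriv_partials:
  fixes u :: "(nat \<Rightarrow> real) \<Rightarrow> real"
  assumes D: "model_open n D"
    and g: "\<And>i p. i < n \<Longrightarrow> p \<in> D \<Longrightarrow> has_dir_deriv n D u (unit_vec n i) p (g i p)"
    and cont: "\<And>i. i < n \<Longrightarrow> continuous_on D (g i)"
    and p: "p \<in> D"
  shows "has_dir_deriv n D u w p (\<Sum>i<n. w i * g i p)"
  unfolding has_dir_deriv_def
proof (rule tendstoI)
  fix e :: real assume e: "e > 0"
  define M where "M = 1 + (\<Sum>i<n. \<bar>w i\<bar>)"
  have "0 \<le> (\<Sum>i<n. \<bar>w i\<bar>)" by (simp add: sum_nonneg)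
  then have M: "M > 0" unfolding M_def by linarith
  have wM: "\<bar>w i\<bar> \<le> M" if "i < n" for i
  proof -
    have "\<bar>w i\<bar> \<le> (\<Sum>i<n. \<bar>w i\<bar>)" using that by (intro member_le_sum) auto
    then show ?thesis by (simp add: M_def)
  qed
  \<comment> \<open>The absolute coordinates of t w add up to |t| (M - 1), so the constant e / (2 M)
    keeps the remainder below e |t|.\<close>
  obtain \<delta> where \<delta>: "\<delta> > 0" and est: "\<And>q r. q \<in> D \<Longrightarrow> r \<in> D \<Longrightarrow>
      (\<forall>i<n. \<bar>q i - p i\<bar> < \<delta>) \<Longrightarrow> (\<forall>i<n. \<bar>r i - p i\<bar> < \<delta>) \<Longrightarrow>
      \<bar>u q - u r - (\<Sum>i<n. g i p * (q i - r i))\<bar> \<le> e / (2 * M) * (\<Sum>i<n. \<bar>q i - r i\<bar>)"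
    using increment_estimate[OF D g cont p, of "e / (2 * M)"] e M by auto
  show "\<forall>\<^sub>F t in at 0 within {t. lincomb n 1 p t w \<in> D}.
      dist ((1 / t) *\<^sub>R (u (lincomb n 1 p t w) - u p)) (\<Sum>i<n. w i * g i p) < e"
    unfolding eventually_at
  proof (intro exI[of _ "\<delta> / M"] conjI ballI impI)
    show "0 < \<delta> / M" using \<delta> M by simp
    fix t assume tD: "t \<in> {t. lincomb n 1 p t w \<in> D}" and t: "t \<noteq> 0 \<and> dist t 0 < \<delta> / M"
    let ?q = "lincomb n 1 p t w"
    have near: "\<forall>i<n. \<bar>?q i - p i\<bar> < \<delta>"
    proof (intro allI impI)
      fix i assume i: "i < n"
      have "\<bar>t * w i\<bar> \<le> \<bar>t\<bar> * M" using wM[OF i] by (simp add: abs_mult mult_left_mono)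
      also have "\<dots> < \<delta>" using t M by (simp add: field_simps dist_real_def)
      finally show "\<bar>?q i - p i\<bar> < \<delta>" using i by simp
    qed
    have "\<bar>u ?q - u p - (\<Sum>i<n. g i p * (?q i - p i))\<bar> \<le> e / (2 * M) * (\<Sum>i<n. \<bar>?q i - p i\<bar>)"
      using est[of ?q p] tD p near \<delta> by simp
    also have "(\<Sum>i<n. g i p * (?q i - p i)) = t * (\<Sum>i<n. w i * g i p)"
      by (simp add: sum_distrib_left mult_ac)
    also have "(\<Sum>i<n. \<bar>?q i - p i\<bar>) = \<bar>t\<bar> * (M - 1)"
      by (simp add: M_def sum_distrib_left abs_mult)
    also have "e / (2 * M) * (\<bar>t\<bar> * (M - 1)) \<le> e / (2 * M) * (\<bar>t\<bar> * M)"
      using e M by (intro mult_left_mono) auto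
    also have "\<dots> < e * \<bar>t\<bar>" using e M t by (simp add: field_simps)
    finally have "\<bar>u ?q - u p - t * (\<Sum>i<n. w i * g i p)\<bar> / \<bar>t\<bar> < e"
      using t by (simp add: field_simps)
    also have "\<bar>u ?q - u p - t * (\<Sum>i<n. w i * g i p)\<bar> / \<bar>t\<bar> = \<bar>(u ?q - u p) / t - (\<Sum>i<n. w i * g i p)\<bar>"
      using t by (simp flip: abs_divide add: diff_divide_distrib)
    finally show "dist ((1 / t) *\<^sub>R (u ?q - u p)) (\<Sum>i<n. w i * g i p) < e"
      by (simp add: dist_real_def)
  qed
qed

lemma has_dir_deriv_Ck_real:
  assumes "model_open n D" "Ck_real n D (Suc k) u" "p \<in> D"
  shows "has_dir_deriv n D u w p (\<Sum>i<n. w i * pd n D i u p)"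
  by (rule has_dir_deriv_partials[OF assms(1) Ck_real_Suc_has_pd[OF assms(1,2)] _ assms(3)])
    (use assms(2) Ck_real_continuous_on in auto)

lemma dir_deriv_Ck_real:
  assumes "model_open n D" "Ck_real n D (Suc k) u" "p \<in> D" "w \<in> Rn n"
  shows "dir_deriv n D u w p = (\<Sum>i<n. w i * pd n D i u p)"
  by (rule dir_deriv_eq[OF assms(1,3,4) has_dir_deriv_Ck_real[OF assms(1-3)]])

subsection \<open>Iterated directional derivatives\<close>

lemma iter_deriv_cong_directions:
  "(\<And>i. i < j \<Longrightarrow> v i = v' i) \<Longrightarrow> iter_deriv n D x j v = iter_deriv n D x j v'"
  by (induction j) auto

text \<open>The recursion of \<open>iter_deriv\<close> adds derivatives on the outside. Taking the
  first one off on the inside allows a derivative of x to be treated as a new function.\<close>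

lemma iter_deriv_Suc_shift:
  "iter_deriv n D x (Suc j) v = iter_deriv n D (dir_deriv n D x (v 0)) j (\<lambda>i. v (Suc i))"
  by (induction j) auto

lemma Ck_MB_has_dir_deriv:
  assumes "model_open n D" "Ck_MB n D k x" "enat j < k" "\<And>i. i \<le> j \<Longrightarrow> v i \<in> Rn n" "p \<in> D"
  shows "has_dir_deriv n D (iter_deriv n D x j v) (v j) p (iter_deriv n D x (Suc j) v p)"
proof -
  \<comment> \<open>\<open>Ck_MB\<close> quantifies over extensional tuples, so v is cut to its
    first j + 1 directions.\<close>
  define v' where "v' = restrict v {..<Suc j}"
  have "v' \<in> {..<Suc j} \<rightarrow>\<^sub>E Rn n" using assms(4) by (auto simp: v'_def)
  then obtain l where l: "has_dir_deriv n D (iter_deriv n D x j v') (v' j) p l"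
    using assms(2,3,5) unfolding Ck_MB_def by blast
  have "iter_deriv n D x j v' = iter_deriv n D x j v"
    by (rule iter_deriv_cong_directions) (simp add: v'_def)
  then have "has_dir_deriv n D (iter_deriv n D x j v) (v j) p l"
    using l by (simp add: v'_def)
  then show ?thesis using dir_deriv_eq[OF assms(1,5) assms(4)[OF order.refl]] by (metis iter_deriv.simps(2))
qed

lemma Ck_MB_continuous_on:
  assumes "Ck_MB n D k x"
  shows "continuous_on D x"
proof -
  have "continuous_on (D \<times> ({..<0} \<rightarrow>\<^sub>E Rn n)) (\<lambda>(p, v). iter_deriv n D x 0 v p)"
    using assms unfolding Ck_MB_def by (metis zero_enat_def zero_le)
  then have "continuous_on D ((\<lambda>(p, v). iter_deriv n D x 0 v p) \<circ> (\<lambda>p. (p, \<lambda>_. undefined)))"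
    by (intro continuous_on_compose continuous_intros) (auto elim: continuous_on_subset)
  then show ?thesis by (simp add: o_def)
qed

lemma Ck_MB_infinity_dir_deriv:
  assumes x: "Ck_MB n D \<infinity> x" and w: "w \<in> Rn n"
  shows "Ck_MB n D \<infinity> (dir_deriv n D x w)"
proof -
  \<comment> \<open>c prepends the direction w: j derivatives of the derivative along w are j + 1
    derivatives of x. Prepending is continuous, and order \<infinity> leaves room for the extra
    derivative.\<close>
  define c where "c v = (\<lambda>i. if i = 0 then w else v (i - 1))" for v :: "nat \<Rightarrow> nat \<Rightarrow> real"
  have c: "c v \<in> {..<Suc j} \<rightarrow>\<^sub>E Rn n" if "v \<in> {..<j} \<rightarrow>\<^sub>E Rn n" for v j
    using that w by (auto simp: c_def PiE_def extensional_def Pi_def)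
  have iter: "iter_deriv n D (dir_deriv n D x w) j v = iter_deriv n D x (Suc j) (c v)" for j v
    by (subst iter_deriv_Suc_shift) (simp add: c_def)
  have cont_c: "continuous_on A (\<lambda>z. (fst z, c (snd z)))" for A :: "((nat \<Rightarrow> real) \<times> (nat \<Rightarrow> nat \<Rightarrow> real)) set"
  proof (rule continuous_on_Pair)
    show "continuous_on A fst" by (rule continuous_on_fst[OF continuous_on_id])
    show "continuous_on A (\<lambda>z. c (snd z))"
    proof (rule continuous_on_coordinatewise_then_product)
      fix i
      have "continuous_on A (\<lambda>z. snd z j)" for j
        by (rule continuous_on_product_then_coordinatewise[OF continuous_on_snd[OF continuous_on_id]])
      then show "continuous_on A (\<lambda>z. c (snd z) i)" by (cases i) (simp_all add: c_def)
    qed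
  qed
  show ?thesis
    unfolding Ck_MB_def
  proof (intro conjI allI impI ballI)
    fix j p v assume "p \<in> D" and v: "v \<in> {..<Suc j} \<rightarrow>\<^sub>E Rn n"
    then have "\<exists>l. has_dir_deriv n D (iter_deriv n D x (Suc j) (c v)) (c v (Suc j)) p l"
      using x c[OF v] unfolding Ck_MB_def by (metis enat_ord_code(4))
    then show "\<exists>l. has_dir_deriv n D (iter_deriv n D (dir_deriv n D x w) j v) (v j) p l"
      by (simp only: iter) (simp add: c_def)
  next
    fix j
    have "continuous_on (D \<times> ({..<Suc j} \<rightarrow>\<^sub>E Rn n)) (\<lambda>(p, v). iter_deriv n D x (Suc j) v p)"
      using x unfolding Ck_MB_def by (metis enat_ord_code(3))
    then have "continuous_on (D \<times> ({..<j} \<rightarrow>\<^sub>E Rn n))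
        ((\<lambda>(p, v). iter_deriv n D x (Suc j) v p) \<circ> (\<lambda>z. (fst z, c (snd z))))"
    proof (intro continuous_on_compose cont_c, rule continuous_on_subset)
      show "(\<lambda>z. (fst z, c (snd z))) ` (D \<times> ({..<j} \<rightarrow>\<^sub>E Rn n)) \<subseteq> D \<times> ({..<Suc j} \<rightarrow>\<^sub>E Rn n)"
        by (rule image_subsetI) (metis SigmaE SigmaI c fst_conv snd_conv)
    qed
    then show "continuous_on (D \<times> ({..<j} \<rightarrow>\<^sub>E Rn n)) (\<lambda>(p, v). iter_deriv n D (dir_deriv n D x w) j v p)"
      by (simp only: iter o_def case_prod_unfold fst_conv snd_conv)
  qed
qed

lemma Ck_MB_infinity_imp_Ck_real:
  assumes D: "model_open n D"
  shows "Ck_MB n D \<infinity> u \<Longrightarrow> Ck_real n D k u"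
proof (induction k arbitrary: u)
  case 0
  then show ?case using Ck_MB_continuous_on by auto
next
  case (Suc k)
  have "has_dir_deriv n D u (unit_vec n i) p (pd n D i u p)" if "p \<in> D" for i p
    using Ck_MB_has_dir_deriv[OF D Suc.prems, of 0 "\<lambda>_. unit_vec n i" p] that by (simp add: enat_0)
  moreover have "Ck_real n D k (pd n D i u)" for i
    by (intro Suc.IH Ck_MB_infinity_dir_deriv Suc.prems) simp
  moreover have "continuous_on D u" using Suc.prems by (rule Ck_MB_continuous_on)
  ultimately show ?case by auto
qed

section \<open>Smooth real functions and the coordinate form of their derivatives\<close>

definition smooth :: "nat \<Rightarrow> (nat \<Rightarrow> real) set \<Rightarrow> ((nat \<Rightarrow> real) \<Rightarrow> real) \<Rightarrow> bool" where
  "smooth n D u \<longleftrightarrow> (\<forall>k. Ck_real n D k u)"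

lemma smoothD: "smooth n D u \<Longrightarrow> Ck_real n D k u"
  by (simp add: smooth_def)

lemma smooth_continuous_on: "smooth n D u \<Longrightarrow> continuous_on D u"
  using smoothD Ck_real_continuous_on by blast

lemma smooth_pd:
  assumes "smooth n D u" "i < n"
  shows "smooth n D (pd n D i u)"
  using assms Ck_real.simps(2) unfolding smooth_def by blast

lemma smooth_cong: "(\<And>q. q \<in> D \<Longrightarrow> u q = w q) \<Longrightarrow> smooth n D u \<longleftrightarrow> smooth n D w"
  using Ck_real_cong[of D u w] by (simp add: smooth_def)

lemma smooth_dir_deriv:
  assumes "model_open n D" "smooth n D u" "w \<in> Rn n"
  shows "smooth n D (dir_deriv n D u w)"
proof -
  have "Ck_real n D k (\<lambda>p. \<Sum>i<n. w i * pd n D i u p)" for k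
    using smooth_pd[OF assms(2)] smoothD by (intro Ck_real_sum Ck_real_mult Ck_real_const assms(1)) auto
  then have "smooth n D (\<lambda>p. \<Sum>i<n. w i * pd n D i u p)" by (simp add: smooth_def)
  moreover have "dir_deriv n D u w q = (\<Sum>i<n. w i * pd n D i u q)" if "q \<in> D" for q
    by (rule dir_deriv_Ck_real[OF assms(1) smoothD[OF assms(2)] that assms(3)])
  ultimately show ?thesis using smooth_cong[of D "dir_deriv n D u w"] by simp
qed

lemma smooth_iter_deriv:
  assumes "model_open n D" "smooth n D u" "\<And>i. i < j \<Longrightarrow> v i \<in> Rn n"
  shows "smooth n D (iter_deriv n D u j v)"
  using assms(3) by (induction j) (simp_all add: assms(2) smooth_dir_deriv[OF assms(1)])

text \<open>Splits off the last index of a tuple, matching \<open>iter_deriv\<close>, which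
  differentiates last along the direction with index j.\<close>

lemma sum_PiE_Suc:
  fixes g :: "(nat \<Rightarrow> 'a) \<Rightarrow> 'b::comm_monoid_add"
  shows "(\<Sum>a\<in>{..<Suc j} \<rightarrow>\<^sub>E S. g a) = (\<Sum>a\<in>{..<j} \<rightarrow>\<^sub>E S. \<Sum>k\<in>S. g (a(j := k)))"
proof -
  have "(\<Sum>a\<in>{..<Suc j} \<rightarrow>\<^sub>E S. g a) = (\<Sum>z\<in>S \<times> ({..<j} \<rightarrow>\<^sub>E S). g ((\<lambda>(y, a). a(j := y)) z))"
    unfolding lessThan_Suc PiE_insert_eq
    by (rule sum.reindex[unfolded o_def]) (rule inj_combinator, simp)
  also have "\<dots> = (\<Sum>k\<in>S. \<Sum>a\<in>{..<j} \<rightarrow>\<^sub>E S. g (a(j := k)))"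
    by (simp add: sum.cartesian_product case_prod_unfold)
  finally show ?thesis by (simp add: sum.swap[of _ S])
qed

lemma has_dir_deriv_sum_real:
  fixes F :: "'a \<Rightarrow> (nat \<Rightarrow> real) \<Rightarrow> real"
  assumes "model_open n D" "p \<in> D"
    and "\<And>a. a \<in> A \<Longrightarrow> has_dir_deriv n D (F a) w p (l a)"
  shows "has_dir_deriv n D (\<lambda>q. \<Sum>a\<in>A. c a * F a q) w p (\<Sum>a\<in>A. c a * l a)"
proof -
  have p: "p \<in> Rn n" using assms model_open_subset by blast
  show ?thesis
    unfolding has_dir_deriv_real_iff[OF p]
    by (intro DERIV_sum DERIV_cmult) (use assms(3) in \<open>simp add: has_dir_deriv_real_iff[OF p]\<close>)
qed

abbreviation mixed :: "nat \<Rightarrow> (nat \<Rightarrow> real) set \<Rightarrow> ((nat \<Rightarrow> real) \<Rightarrow> real) \<Rightarrow> nat \<Rightarrow> (nat \<Rightarrow> nat) \<Rightarrow> (nat \<Rightarrow> real) \<Rightarrow> real" where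
  "mixed n D u j a \<equiv> iter_deriv n D u j (\<lambda>i. unit_vec n (a i))"

lemma mixed_Suc: "mixed n D u (Suc j) (a(j := k)) = pd n D k (mixed n D u j a)"
proof -
  have "mixed n D u j (a(j := k)) = mixed n D u j a"
    by (rule iter_deriv_cong_directions) simp
  then show ?thesis by simp
qed

text \<open>The j-th derivative as a j-linear form written out in coordinates. It is polynomial in v
  and depends on p through finitely many mixed partials, so continuity and differentiability
  estimates reduce to these coefficients.\<close>

definition jet_form :: "nat \<Rightarrow> (nat \<Rightarrow> real) set \<Rightarrow> ((nat \<Rightarrow> real) \<Rightarrow> real) \<Rightarrow> nat \<Rightarrow> (nat \<Rightarrow> real) \<Rightarrow> (nat \<Rightarrow> nat \<Rightarrow> real) \<Rightarrow> real" where
  "jet_form n D u j p v = (\<Sum>a\<in>{..<j} \<rightarrow>\<^sub>E {..<n}. (\<Prod>i<j. v i (a i)) * mixed n D u j a p)"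

lemma jet_form_Suc:
  "jet_form n D u (Suc j) p v =
     (\<Sum>a\<in>{..<j} \<rightarrow>\<^sub>E {..<n}. (\<Prod>i<j. v i (a i)) * (\<Sum>k<n. v j k * pd n D k (mixed n D u j a) p))"
proof -
  have "(\<Prod>i<Suc j. v i ((a(j := k)) i)) = (\<Prod>i<j. v i (a i)) * v j k" for a k
    by simp
  then show ?thesis
    unfolding jet_form_def sum_PiE_Suc mixed_Suc sum_distrib_left by (simp add: mult.assoc)
qed

context
  fixes n :: nat and D :: "(nat \<Rightarrow> real) set" and u :: "(nat \<Rightarrow> real) \<Rightarrow> real"
  assumes D: "model_open n D" and u: "smooth n D u"
begin

lemma smooth_mixed: "smooth n D (mixed n D u j a)"
  by (rule smooth_iter_deriv[OF D u]) simp

lemma iter_deriv_eq_jet_form: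
  assumes "\<And>i. i < j \<Longrightarrow> v i \<in> Rn n" "p \<in> D"
  shows "iter_deriv n D u j v p = jet_form n D u j p v"
  using assms
proof (induction j arbitrary: p)
  case 0
  then show ?case by (simp add: jet_form_def)
next
  case (Suc j)
  have v: "\<And>i. i < j \<Longrightarrow> v i \<in> Rn n" "v j \<in> Rn n" using Suc.prems by auto
  \<comment> \<open>The induction hypothesis replaces the function by its coordinate sum, which is
    then differentiated in p with v fixed.\<close>
  have "dir_deriv n D (iter_deriv n D u j v) (v j) p = dir_deriv n D (\<lambda>p. jet_form n D u j p v) (v j) p"
    by (rule dir_deriv_cong[OF Suc.prems(2) Suc.IH[OF v(1)]])
  also have "\<dots> = jet_form n D u (Suc j) p v"
    unfolding jet_form_Suc
    using has_dir_deriv_sum_real[OF D Suc.prems(2) has_dir_deriv_Ck_real[OF D smoothD[OF smooth_mixed] Suc.prems(2)]]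
    by (intro dir_deriv_eq[OF D Suc.prems(2) v(2)]) (simp add: jet_form_def)
  finally show ?case by simp
qed

text \<open>Joint continuity in point and directions is visible from \<open>jet_form\<close>, a
  finite sum of products of coordinates of v with continuous mixed partials.\<close>

lemma smooth_imp_Ck_MB: "Ck_MB n D k u"
  unfolding Ck_MB_def
proof (intro conjI allI impI ballI)
  fix j p and v :: "nat \<Rightarrow> nat \<Rightarrow> real" assume p: "p \<in> D" and v: "v \<in> {..<Suc j} \<rightarrow>\<^sub>E Rn n"
  have "v i \<in> Rn n" if "i < j" for i using v that by (intro PiE_mem[OF v]) simp
  then have "smooth n D (iter_deriv n D u j v)" by (rule smooth_iter_deriv[OF D u])
  then show "\<exists>l. has_dir_deriv n D (iter_deriv n D u j v) (v j) p l"
    using has_dir_deriv_Ck_real[OF D smoothD p] by blast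
next
  fix j
  have cont: "continuous_on A (\<lambda>z. snd z i m)" for A :: "((nat \<Rightarrow> real) \<times> (nat \<Rightarrow> nat \<Rightarrow> real)) set" and i m
    by (rule continuous_on_product_then_coordinatewise[OF
          continuous_on_product_then_coordinatewise[OF continuous_on_snd[OF continuous_on_id]]])
  have "continuous_on (D \<times> ({..<j} \<rightarrow>\<^sub>E Rn n)) (\<lambda>z. jet_form n D u j (fst z) (snd z))"
    unfolding jet_form_def
    by (intro continuous_on_sum continuous_on_mult continuous_on_prod cont
        continuous_on_compose2[OF smooth_continuous_on[OF smooth_mixed]] continuous_on_fst continuous_on_id) auto
  moreover have "jet_form n D u j (fst z) (snd z) = (\<lambda>(p, v). iter_deriv n D u j v p) z"
    if "z \<in> D \<times> ({..<j} \<rightarrow>\<^sub>E Rn n)" for z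
  proof -
    have "snd z i \<in> Rn n" if "i < j" for i
      by (rule PiE_mem[of _ "{..<j}"]) (use \<open>z \<in> _\<close> that in \<open>simp_all add: mem_Times_iff\<close>)
    then show ?thesis using that by (simp add: iter_deriv_eq_jet_form case_prod_unfold mem_Times_iff)
  qed
  ultimately show "continuous_on (D \<times> ({..<j} \<rightarrow>\<^sub>E Rn n)) (\<lambda>(p, v). iter_deriv n D u j v p)"
    by (simp cong: continuous_on_cong)
qed

end

subsection \<open>Sums and composition with linear maps: the Michal--Bastiani classes\<close>

lemma has_dir_deriv_linear:
  assumes T: "linear T" "continuous_on UNIV T" and x: "has_dir_deriv n D x w p l"
  shows "has_dir_deriv n D (\<lambda>p. T (x p)) w p (T l)"
proof -
  have "((\<lambda>t. T ((1 / t) *\<^sub>R (x (lincomb n 1 p t w) - x p))) \<longlongrightarrow> T l) (at 0 within {t. lincomb n 1 p t w \<in> D})"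
    using x unfolding has_dir_deriv_def by (rule continuous_on_tendsto_compose[OF T(2)]) auto
  then show ?thesis by (simp add: has_dir_deriv_def linear_cmul[OF T(1)] linear_diff[OF T(1)])
qed

text \<open>Iterated derivatives are definite descriptions; the \<open>Ck_MB\<close> hypothesis
  supplies the derivatives of x whose images under T identify those of T x one order at a
  time.\<close>

lemma iter_deriv_linear:
  assumes D: "model_open n D" and x: "Ck_MB n D k x" and T: "linear T" "continuous_on UNIV T"
    and j: "enat j \<le> k" and v: "\<And>i. i < j \<Longrightarrow> v i \<in> Rn n" and p: "p \<in> D"
  shows "iter_deriv n D (\<lambda>p. T (x p)) j v p = T (iter_deriv n D x j v p)"
  using j v p
proof (induction j arbitrary: p)
  case (Suc j)
  have j: "enat j < k" using Suc.prems(1) by (simp add: Suc_ile_eq)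
  have v: "\<And>i. i \<le> j \<Longrightarrow> v i \<in> Rn n" using Suc.prems by auto
  have "dir_deriv n D (iter_deriv n D (\<lambda>p. T (x p)) j v) (v j) p =
      dir_deriv n D (\<lambda>p. T (iter_deriv n D x j v p)) (v j) p"
    using j v by (intro dir_deriv_cong[OF Suc.prems(3)] Suc.IH) auto
  also have "\<dots> = T (iter_deriv n D x (Suc j) v p)"
    by (rule dir_deriv_eq[OF D Suc.prems(3) v[OF order.refl]
          has_dir_deriv_linear[OF T Ck_MB_has_dir_deriv[OF D x j, where v = v, OF v Suc.prems(3)]]])
  finally show ?case by simp
qed simp

lemma Ck_MB_linear:
  assumes D: "model_open n D" and x: "Ck_MB n D k x" and T: "linear T" "continuous_on UNIV T"
  shows "Ck_MB n D k (\<lambda>p. T (x p))"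
  unfolding Ck_MB_def
proof (intro conjI allI impI ballI)
  fix j p v assume j: "enat j < k" and p: "p \<in> D" and v: "v \<in> {..<Suc j} \<rightarrow>\<^sub>E Rn n"
  have vi: "v i \<in> Rn n" if "i \<le> j" for i using that by (intro PiE_mem[OF v]) simp
  have "has_dir_deriv n D (\<lambda>p. T (iter_deriv n D x j v p)) (v j) p (T (iter_deriv n D x (Suc j) v p))"
    by (rule has_dir_deriv_linear[OF T Ck_MB_has_dir_deriv[OF D x j, where v = v, OF vi p]])
  moreover have "iter_deriv n D (\<lambda>p. T (x p)) j v q = T (iter_deriv n D x j v q)" if "q \<in> D" for q
    using j vi that by (intro iter_deriv_linear[OF D x T]) auto
  ultimately show "\<exists>l. has_dir_deriv n D (iter_deriv n D (\<lambda>p. T (x p)) j v) (v j) p l"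
    using has_dir_deriv_cong[OF p, of "iter_deriv n D (\<lambda>p. T (x p)) j v"
        "\<lambda>p. T (iter_deriv n D x j v p)"] by blast
next
  fix j assume j: "enat j \<le> k"
  have "continuous_on (D \<times> ({..<j} \<rightarrow>\<^sub>E Rn n)) (\<lambda>z. T ((\<lambda>(p, v). iter_deriv n D x j v p) z))"
    using x j unfolding Ck_MB_def by (intro continuous_on_compose2[OF T(2)]) auto
  moreover have "T ((\<lambda>(p, v). iter_deriv n D x j v p) z) = (\<lambda>(p, v). iter_deriv n D (\<lambda>p. T (x p)) j v p) z"
    if "z \<in> D \<times> ({..<j} \<rightarrow>\<^sub>E Rn n)" for z
  proof -
    have "snd z i \<in> Rn n" if "i < j" for i
      by (rule PiE_mem[of _ "{..<j}"]) (use \<open>z \<in> _\<close> that in \<open>simp_all add: mem_Times_iff\<close>)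
    then show ?thesis
      using that j by (simp add: iter_deriv_linear[OF D x T] case_prod_unfold mem_Times_iff)
  qed
  ultimately show "continuous_on (D \<times> ({..<j} \<rightarrow>\<^sub>E Rn n)) (\<lambda>(p, v). iter_deriv n D (\<lambda>p. T (x p)) j v p)"
    by (simp cong: continuous_on_cong)
qed

lemma has_dir_deriv_add:
  fixes x y :: "(nat \<Rightarrow> real) \<Rightarrow> 'e::{real_vector,t2_space,topological_ab_group_add}"
  shows "has_dir_deriv n D x w p l \<Longrightarrow> has_dir_deriv n D y w p l' \<Longrightarrow>
    has_dir_deriv n D (\<lambda>p. x p + y p) w p (l + l')"
  unfolding has_dir_deriv_def by (drule (1) tendsto_add) (simp add: algebra_simps)

context
  fixes n :: nat and D :: "(nat \<Rightarrow> real) set" and k :: enat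
    and x y :: "(nat \<Rightarrow> real) \<Rightarrow> 'e::{real_vector,t2_space,topological_ab_group_add}"
  assumes D: "model_open n D" and x: "Ck_MB n D k x" and y: "Ck_MB n D k y"
begin

lemma iter_deriv_add:
  assumes j: "enat j \<le> k" and v: "\<And>i. i < j \<Longrightarrow> v i \<in> Rn n" and p: "p \<in> D"
  shows "iter_deriv n D (\<lambda>p. x p + y p) j v p = iter_deriv n D x j v p + iter_deriv n D y j v p"
  using j v p
proof (induction j arbitrary: p)
  case (Suc j)
  have j: "enat j < k" using Suc.prems(1) by (simp add: Suc_ile_eq)
  have v: "\<And>i. i \<le> j \<Longrightarrow> v i \<in> Rn n" using Suc.prems by auto
  have "dir_deriv n D (iter_deriv n D (\<lambda>p. x p + y p) j v) (v j) p =
      dir_deriv n D (\<lambda>p. iter_deriv n D x j v p + iter_deriv n D y j v p) (v j) p"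
    using j v by (intro dir_deriv_cong[OF Suc.prems(3)] Suc.IH) auto
  also have "\<dots> = iter_deriv n D x (Suc j) v p + iter_deriv n D y (Suc j) v p"
    by (rule dir_deriv_eq[OF D Suc.prems(3) v[OF order.refl] has_dir_deriv_add[OF
          Ck_MB_has_dir_deriv[OF D x j, where v = v, OF v Suc.prems(3)] Ck_MB_has_dir_deriv[OF D y j, where v = v, OF v Suc.prems(3)]]])
  finally show ?case by simp
qed simp

lemma Ck_MB_add: "Ck_MB n D k (\<lambda>p. x p + y p)"
  unfolding Ck_MB_def
proof (intro conjI allI impI ballI)
  fix j p v assume j: "enat j < k" and p: "p \<in> D" and v: "v \<in> {..<Suc j} \<rightarrow>\<^sub>E Rn n"
  have vi: "v i \<in> Rn n" if "i \<le> j" for i using that by (intro PiE_mem[OF v]) simp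
  have "has_dir_deriv n D (\<lambda>p. iter_deriv n D x j v p + iter_deriv n D y j v p) (v j) p
      (iter_deriv n D x (Suc j) v p + iter_deriv n D y (Suc j) v p)"
    by (rule has_dir_deriv_add[OF Ck_MB_has_dir_deriv[OF D x j, where v = v, OF vi p] Ck_MB_has_dir_deriv[OF D y j, where v = v, OF vi p]])
  moreover have "iter_deriv n D (\<lambda>p. x p + y p) j v q = iter_deriv n D x j v q + iter_deriv n D y j v q"
    if "q \<in> D" for q
    using j vi that by (intro iter_deriv_add) auto
  ultimately show "\<exists>l. has_dir_deriv n D (iter_deriv n D (\<lambda>p. x p + y p) j v) (v j) p l"
    using has_dir_deriv_cong[OF p, of "iter_deriv n D (\<lambda>p. x p + y p) j v"
        "\<lambda>p. iter_deriv n D x j v p + iter_deriv n D y j v p"] by blast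
next
  fix j assume j: "enat j \<le> k"
  have "continuous_on (D \<times> ({..<j} \<rightarrow>\<^sub>E Rn n))
      (\<lambda>z. (\<lambda>(p, v). iter_deriv n D x j v p) z + (\<lambda>(p, v). iter_deriv n D y j v p) z)"
    using x y j unfolding Ck_MB_def by (intro continuous_on_add) auto
  moreover have "(\<lambda>(p, v). iter_deriv n D x j v p) z + (\<lambda>(p, v). iter_deriv n D y j v p) z =
      (\<lambda>(p, v). iter_deriv n D (\<lambda>p. x p + y p) j v p) z"
    if "z \<in> D \<times> ({..<j} \<rightarrow>\<^sub>E Rn n)" for z
  proof -
    have "snd z i \<in> Rn n" if "i < j" for i
      by (rule PiE_mem[of _ "{..<j}"]) (use \<open>z \<in> _\<close> that in \<open>simp_all add: mem_Times_iff\<close>)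
    then show ?thesis
      using that j by (simp add: iter_deriv_add case_prod_unfold mem_Times_iff)
  qed
  ultimately show "continuous_on (D \<times> ({..<j} \<rightarrow>\<^sub>E Rn n)) (\<lambda>(p, v). iter_deriv n D (\<lambda>p. x p + y p) j v p)"
    by (simp cong: continuous_on_cong)
qed

end

subsection \<open>Norms\<close>

lemma abs_le_enorm: "i < n \<Longrightarrow> \<bar>u i\<bar> \<le> enorm n u"
  using member_le_L2_set[of "{..<n}" i "\<lambda>i. \<bar>u i\<bar>"] by (simp add: enorm_def L2_set_def)

lemma enorm_nonneg [simp]: "0 \<le> enorm n u"
  by (simp add: enorm_def L2_set_nonneg)

lemma enorm_le_sum: "enorm n u \<le> (\<Sum>i<n. \<bar>u i\<bar>)"
  by (simp add: enorm_def L2_set_le_sum_abs)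

lemma sum_diff_le_enorm: "(\<Sum>i<n. \<bar>q i - r i\<bar>) \<le> real n * enorm n (lincomb n 1 q (- 1) r)"
proof -
  have "(\<Sum>i<n. \<bar>q i - r i\<bar>) \<le> (\<Sum>i<n. enorm n (lincomb n 1 q (- 1) r))"
    using abs_le_enorm[of _ n "lincomb n 1 q (- 1) r"] by (intro sum_mono) simp
  then show ?thesis by simp
qed

lemma defining_norm_properties:
  assumes "defining_norm N"
  shows "N x \<ge> 0" "N x = 0 \<longleftrightarrow> x = 0" "N (a *\<^sub>R x) = \<bar>a\<bar> * N x" "N (x + y) \<le> N x + N y"
    "open U \<longleftrightarrow> (\<forall>x\<in>U. \<exists>e>0. \<forall>y. N (y - x) < e \<longrightarrow> y \<in> U)"
  using assms unfolding defining_norm_def by simp_all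

lemma defining_norm_zero: "defining_norm N \<Longrightarrow> N 0 = 0"
  using defining_norm_properties(2) by blast

lemma open_norm_less:
  assumes N: "defining_norm (N :: 'e::{real_vector,topological_space} \<Rightarrow> real)"
  shows "open {x. N x < c}"
  unfolding defining_norm_properties(5)[OF N, of "{x. N x < c}"]
proof (intro ballI)
  fix x assume "x \<in> {x. N x < c}"
  then show "\<exists>e>0. \<forall>y. N (y - x) < e \<longrightarrow> y \<in> {x. N x < c}"
    using defining_norm_properties(4)[OF N, of _ x]
    by (intro exI[of _ "c - N x"]) (smt (verit) diff_add_cancel mem_Collect_eq)
qed

text \<open>Openness of the preimage gives a ball of radius e on which M (T x) < 1, and homogeneity
  spreads the bound to all x. A general M covers both maps into the space itself and real
  functionals.\<close>

lemma linear_bounded_by_norm: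
  fixes T :: "'e::{real_vector,topological_space} \<Rightarrow> 'f::real_vector"
  assumes N: "defining_norm N" and T: "linear T" "open (T -` {y. M y < 1})"
    and M: "\<And>a y. M (a *\<^sub>R y) = \<bar>a\<bar> * M y"
  shows "\<exists>B\<ge>0. \<forall>x. M (T x) \<le> B * N x"
proof -
  have M0: "M 0 = 0" using M[of 0] by simp
  then have "0 \<in> T -` {y. M y < 1}" using linear_0[OF T(1)] by simp
  then obtain e where e: "e > 0" "\<And>y. N (y - 0) < e \<Longrightarrow> y \<in> T -` {y. M y < 1}"
    using T(2) unfolding defining_norm_properties(5)[OF N, of "T -` {y. M y < 1}"] by blast
  have "M (T x) \<le> 2 / e * N x" for x
  proof (cases "x = 0")
    case True
    then show ?thesis using M0 linear_0[OF T(1)] defining_norm_zero[OF N] by simp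
  next
    case False
    then have Nx: "N x > 0" using defining_norm_properties(1,2)[OF N, of x] by simp
    \<comment> \<open>x is rescaled to norm e / 2, strictly inside the ball.\<close>
    have "N ((e / (2 * N x)) *\<^sub>R x) < e"
      using Nx e(1) by (simp add: defining_norm_properties(3)[OF N])
    then have "M (T ((e / (2 * N x)) *\<^sub>R x)) < 1" using e(2) by simp
    then have "e / (2 * N x) * M (T x) < 1"
      using Nx e(1) by (simp add: linear_cmul[OF T(1)] M)
    then show ?thesis using Nx e(1) by (simp add: field_simps)
  qed
  then show ?thesis using e(1) by (intro exI[of _ "2 / e"]) auto
qed

lemma continuous_linear_bounded:
  assumes "defining_norm N" "linear T" "continuous_on UNIV T"
  shows "\<exists>B\<ge>0. \<forall>x. N (T x) \<le> B * N x"
  by (rule linear_bounded_by_norm[OF assms(1,2) open_vimage[OF open_norm_less[OF assms(1)] assms(3)]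
        defining_norm_properties(3)[OF assms(1)]])

lemma continuous_functional_bounded:
  fixes l :: "'e::{real_vector,topological_space} \<Rightarrow> real"
  assumes "defining_norm N" "linear l" "continuous_on UNIV l"
  shows "\<exists>B\<ge>0. \<forall>x. \<bar>l x\<bar> \<le> B * N x"
  by (rule linear_bounded_by_norm[OF assms(1,2) open_vimage[OF _ assms(3)]])
    (auto intro!: open_Collect_less continuous_intros simp: abs_mult)

subsection \<open>Frechet classes\<close>

lemma multilinear_jet_form: "multilinear_Rn n j (jet_form n D u j p)"
  unfolding multilinear_Rn_def
proof (intro ballI allI impI)
  fix v :: "nat \<Rightarrow> nat \<Rightarrow> real" and i a b w z assume i: "i < j"
  \<comment> \<open>Isolates the only factor that depends on slot i; it is a coordinate of y, hence
    linear in y.\<close>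
  have prod: "(\<Prod>m<j. (v(i := y)) m (c m)) = y (c i) * (\<Prod>m\<in>{..<j} - {i}. v m (c m))" for y c
  proof -
    have "(\<Prod>m<j. (v(i := y)) m (c m)) = (v(i := y)) i (c i) * (\<Prod>m\<in>{..<j} - {i}. (v(i := y)) m (c m))"
      using i by (intro prod.remove) auto
    also have "(\<Prod>m\<in>{..<j} - {i}. (v(i := y)) m (c m)) = (\<Prod>m\<in>{..<j} - {i}. v m (c m))"
      by (rule prod.cong) auto
    finally show ?thesis by simp
  qed
  have "lincomb n a w b z (c i) = a * w (c i) + b * z (c i)" if "c \<in> {..<j} \<rightarrow>\<^sub>E {..<n}" for c
    using PiE_mem[OF that, of i] i by simp
  then show "jet_form n D u j p (v(i := lincomb n a w b z)) =
      a *\<^sub>R jet_form n D u j p (v(i := w)) + b *\<^sub>R jet_form n D u j p (v(i := z))"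
    unfolding jet_form_def prod
    by (simp add: sum_distrib_left sum.distrib[symmetric] algebra_simps cong: sum.cong)
qed

text \<open>Bounds the monomials of \<open>jet_form\<close>, so that the operator norm of a
  difference of forms is at most the sum of the coefficient differences.\<close>

lemma unit_tuples_abs_le_1:
  assumes "v \<in> unit_tuples n j" "a \<in> {..<j} \<rightarrow>\<^sub>E {..<n}"
  shows "\<bar>\<Prod>i<j. v i (a i)\<bar> \<le> 1"
  unfolding abs_prod
proof (rule prod_le_1, intro conjI)
  fix i assume "i \<in> {..<j}"
  then have "v i \<in> {u \<in> Rn n. enorm n u \<le> 1}" "a i < n"
    using PiE_mem[OF assms(1)[unfolded unit_tuples_def]] PiE_mem[OF assms(2)] by auto
  then show "\<bar>v i (a i)\<bar> \<le> 1" using abs_le_enorm[of "a i" n "v i"] by simp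
qed simp

lemma finite_uniform_radius:
  fixes P :: "'a \<Rightarrow> real \<Rightarrow> bool"
  assumes "finite A" "\<And>a. a \<in> A \<Longrightarrow> \<exists>\<delta>>0. P a \<delta>" "\<And>a \<delta> \<delta>'. P a \<delta> \<Longrightarrow> 0 < \<delta>' \<Longrightarrow> \<delta>' \<le> \<delta> \<Longrightarrow> P a \<delta>'"
  shows "\<exists>\<delta>>0. \<forall>a\<in>A. P a \<delta>"
proof -
  obtain d where d: "\<And>a. a \<in> A \<Longrightarrow> d a > 0 \<and> P a (d a)" using assms(2) by metis
  define \<delta> where "\<delta> = Min (insert 1 (d ` A))"
  have "\<delta> > 0" "\<And>a. a \<in> A \<Longrightarrow> \<delta> \<le> d a" using assms(1) d by (auto simp: \<delta>_def)
  then show ?thesis using d assms(3) by blast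
qed

section \<open>Jets of a smooth function in the operator norm\<close>

context
  fixes n :: nat and D :: "(nat \<Rightarrow> real) set" and u :: "(nat \<Rightarrow> real) \<Rightarrow> real"
  assumes D: "model_open n D" and u: "smooth n D u"
begin

lemma jet_form_continuous:
  assumes p: "p \<in> D" and e: "e > 0"
  shows "\<exists>d>0. \<forall>q\<in>D. enorm n (lincomb n 1 q (- 1) p) < d \<longrightarrow>
    (\<forall>v\<in>unit_tuples n j. \<bar>jet_form n D u j q v - jet_form n D u j p v\<bar> \<le> e)"
proof -
  define A where "A = {..<j} \<rightarrow>\<^sub>E {..<n}"
  \<comment> \<open>Total deviation of the coefficients from their values at p. It vanishes at p, so
    its continuity gives the claim.\<close>
  define G where "G q = (\<Sum>a\<in>A. \<bar>mixed n D u j a q - mixed n D u j a p\<bar>)" for q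
  have "continuous_on D G"
    unfolding G_def by (intro continuous_intros smooth_continuous_on[OF smooth_mixed[OF D u]])
  then obtain d where d: "d > 0" "\<And>q. q \<in> D \<Longrightarrow> (\<forall>i<n. \<bar>q i - p i\<bar> < d) \<Longrightarrow> \<bar>G q - G p\<bar> < e"
    using continuous_on_contains_box[OF _ p model_open_subset[OF D] e] by meson
  show ?thesis
  proof (intro exI[of _ d] conjI ballI impI d(1))
    fix q v assume q: "q \<in> D" "enorm n (lincomb n 1 q (- 1) p) < d" and v: "v \<in> unit_tuples n j"
    have "\<forall>i<n. \<bar>q i - p i\<bar> < d"
      using abs_le_enorm[of _ n "lincomb n 1 q (- 1) p"] q(2) by fastforce
    then have "G q < e" using d(2)[OF q(1)] by (simp add: G_def)
    have "\<bar>jet_form n D u j q v - jet_form n D u j p v\<bar> =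
        \<bar>\<Sum>a\<in>A. (\<Prod>i<j. v i (a i)) * (mixed n D u j a q - mixed n D u j a p)\<bar>"
      by (simp add: jet_form_def A_def sum_subtractf right_diff_distrib)
    also have "\<dots> \<le> (\<Sum>a\<in>A. \<bar>(\<Prod>i<j. v i (a i)) * (mixed n D u j a q - mixed n D u j a p)\<bar>)"
      by (rule sum_abs)
    also have "\<dots> \<le> G q"
      unfolding G_def abs_mult
      by (intro sum_mono mult_left_le_one_le) (auto simp: A_def unit_tuples_abs_le_1[OF v])
    finally show "\<bar>jet_form n D u j q v - jet_form n D u j p v\<bar> \<le> e" using \<open>G q < e\<close> by simp
  qed
qed

lemma smooth_increment_estimate:
  assumes p: "p \<in> D" and e: "e > 0"
  shows "\<exists>d>0. \<forall>a\<in>{..<j} \<rightarrow>\<^sub>E {..<n}. \<forall>q\<in>D. enorm n (lincomb n 1 q (- 1) p) < d \<longrightarrow>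
    \<bar>mixed n D u j a q - mixed n D u j a p - (\<Sum>k<n. (q k - p k) * pd n D k (mixed n D u j a) p)\<bar>
      \<le> e * enorm n (lincomb n 1 q (- 1) p)"
proof (rule finite_uniform_radius)
  show "finite ({..<j} \<rightarrow>\<^sub>E {..<n})" by (intro finite_PiE) auto
  fix a
  let ?F = "mixed n D u j a"
  have F: "smooth n D ?F" by (rule smooth_mixed[OF D u])
  obtain d where d: "d > 0" and est: "\<And>q r. q \<in> D \<Longrightarrow> r \<in> D \<Longrightarrow>
      (\<forall>i<n. \<bar>q i - p i\<bar> < d) \<Longrightarrow> (\<forall>i<n. \<bar>r i - p i\<bar> < d) \<Longrightarrow>
      \<bar>?F q - ?F r - (\<Sum>i<n. pd n D i ?F p * (q i - r i))\<bar> \<le> e / (real n + 1) * (\<Sum>i<n. \<bar>q i - r i\<bar>)"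
    \<comment> \<open>The denominator n + 1 absorbs the factor n from comparing the coordinate sum
      with the Euclidean norm, and it is nonzero for n = 0.\<close>
    using increment_estimate[OF D Ck_real_Suc_has_pd[OF D smoothD[OF F]] smooth_continuous_on[OF smooth_pd[OF F]] p, of "e / (real n + 1)"] e
    by auto
  show "\<exists>d>0. \<forall>q\<in>D. enorm n (lincomb n 1 q (- 1) p) < d \<longrightarrow>
      \<bar>?F q - ?F p - (\<Sum>k<n. (q k - p k) * pd n D k ?F p)\<bar> \<le> e * enorm n (lincomb n 1 q (- 1) p)"
  proof (intro exI[of _ d] conjI ballI impI d(1))
    fix q assume q: "q \<in> D" "enorm n (lincomb n 1 q (- 1) p) < d"
    have near: "\<forall>i<n. \<bar>q i - p i\<bar> < d"
      using abs_le_enorm[of _ n "lincomb n 1 q (- 1) p"] q(2) by fastforce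
    have "\<bar>?F q - ?F p - (\<Sum>k<n. (q k - p k) * pd n D k ?F p)\<bar> \<le> e / (real n + 1) * (\<Sum>i<n. \<bar>q i - p i\<bar>)"
      using est[OF q(1) p near] d by (simp add: mult.commute)
    also have "\<dots> \<le> e / (real n + 1) * (real n * enorm n (lincomb n 1 q (- 1) p))"
      using e by (intro mult_left_mono sum_diff_le_enorm) auto
    also have "\<dots> = e * (real n / (real n + 1)) * enorm n (lincomb n 1 q (- 1) p)" by simp
    also have "\<dots> \<le> e * 1 * enorm n (lincomb n 1 q (- 1) p)"
      using e by (intro mult_right_mono mult_left_mono) auto
    finally show "\<bar>?F q - ?F p - (\<Sum>k<n. (q k - p k) * pd n D k ?F p)\<bar> \<le> e * enorm n (lincomb n 1 q (- 1) p)"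
      by simp
  qed
qed auto

lemma jet_form_differentiable:
  assumes p: "p \<in> D" and e: "e > 0"
  shows "\<exists>d>0. \<forall>q\<in>D. enorm n (lincomb n 1 q (- 1) p) < d \<longrightarrow>
    (\<forall>v\<in>unit_tuples n j. \<bar>jet_form n D u j q v - jet_form n D u j p v -
        jet_form n D u (Suc j) p (v(j := lincomb n 1 q (- 1) p))\<bar> \<le> e * enorm n (lincomb n 1 q (- 1) p))"
proof -
  define A where "A = {..<j} \<rightarrow>\<^sub>E {..<n}"
  \<comment> \<open>First-order remainders of the coefficients. The remainder of the form is a sum
    of them weighted by monomials bounded by 1, whence the number of index tuples in the constant
    c.\<close>
  define R where "R q a = mixed n D u j a q - mixed n D u j a p -
      (\<Sum>k<n. (q k - p k) * pd n D k (mixed n D u j a) p)" for q a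
  define c where "c = e / (real (card A) + 1)"
  have c: "c > 0" using e by (simp add: c_def)
  obtain d where d: "d > 0" and est: "\<And>a q. a \<in> A \<Longrightarrow> q \<in> D \<Longrightarrow> enorm n (lincomb n 1 q (- 1) p) < d \<Longrightarrow>
      \<bar>R q a\<bar> \<le> c * enorm n (lincomb n 1 q (- 1) p)"
    using smooth_increment_estimate[OF p c, of j] unfolding A_def R_def by blast
  show ?thesis
  proof (intro exI[of _ d] conjI ballI impI d(1))
    fix q v assume q: "q \<in> D" "enorm n (lincomb n 1 q (- 1) p) < d" and v: "v \<in> unit_tuples n j"
    let ?h = "lincomb n 1 q (- 1) p"
    \<comment> \<open>Slot j is not among the first j slots, so inserting the increment there leaves
      the monomials of order j unchanged.\<close>
    have "(\<Prod>i<j. (v(j := ?h)) i (a i)) = (\<Prod>i<j. v i (a i))" for a by (rule prod.cong) auto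
    then have "jet_form n D u j q v - jet_form n D u j p v - jet_form n D u (Suc j) p (v(j := ?h)) =
        (\<Sum>a\<in>A. (\<Prod>i<j. v i (a i)) * R q a)"
      unfolding jet_form_Suc jet_form_def[of n D u j]
      by (simp add: A_def R_def sum_subtractf right_diff_distrib)
    also have "\<bar>\<dots>\<bar> \<le> (\<Sum>a\<in>A. \<bar>(\<Prod>i<j. v i (a i)) * R q a\<bar>)" by (rule sum_abs)
    also have "\<dots> \<le> (\<Sum>a\<in>A. c * enorm n ?h)"
    proof (rule sum_mono)
      fix a assume a: "a \<in> A"
      have "\<bar>(\<Prod>i<j. v i (a i)) * R q a\<bar> \<le> \<bar>R q a\<bar>"
        unfolding abs_mult using a by (intro mult_left_le_one_le) (auto simp: A_def unit_tuples_abs_le_1[OF v])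
      then show "\<bar>(\<Prod>i<j. v i (a i)) * R q a\<bar> \<le> c * enorm n ?h" using est[OF a q] by simp
    qed
    also have "\<dots> = (real (card A) / (real (card A) + 1)) * (e * enorm n ?h)" by (simp add: c_def)
    also have "\<dots> \<le> 1 * (e * enorm n ?h)"
      using e by (intro mult_right_mono) auto
    finally show "\<bar>jet_form n D u j q v - jet_form n D u j p v - jet_form n D u (Suc j) p (v(j := ?h))\<bar>
        \<le> e * enorm n ?h" by simp
  qed
qed

lemma smooth_imp_Ck_Frechet:
  assumes N: "defining_norm N"
  shows "Ck_Frechet N n D k (\<lambda>p. u p *\<^sub>R c)"
proof -
  define A where "A j p v = jet_form n D u j p v *\<^sub>R c" for j p v
  \<comment> \<open>Adding 1 keeps the divisor positive when c = 0.\<close>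
  have N1: "N c + 1 > 0" using defining_norm_properties(1)[OF N, of c] by simp
  have Nle: "N (r *\<^sub>R c) \<le> e * b" if "\<bar>r\<bar> \<le> e / (N c + 1) * b" "b \<ge> 0" "e > 0" for r e b
  proof -
    have "N (r *\<^sub>R c) \<le> e / (N c + 1) * b * N c"
      unfolding defining_norm_properties(3)[OF N]
      by (rule mult_right_mono[OF that(1) defining_norm_properties(1)[OF N]])
    also have "\<dots> \<le> e / (N c + 1) * b * (N c + 1)" using that N1 by (intro mult_left_mono) auto
    also have "\<dots> = e * b" using N1 by simp
    finally show ?thesis .
  qed
  show ?thesis
    unfolding Ck_Frechet_def
  proof (intro exI[of _ A] conjI allI impI ballI)
    fix p and v :: "nat \<Rightarrow> nat \<Rightarrow> real" 
    show "A 0 p v = u p *\<^sub>R c" by (simp add: A_def jet_form_def)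
  next
    fix j p
    show "multilinear_Rn n j (A j p)"
      using multilinear_jet_form[of n j D u p]
      unfolding multilinear_Rn_def A_def by (simp add: scaleR_left_distrib)
  next
    fix j p and e :: real assume p: "p \<in> D" and e: "e > 0"
    obtain d where d: "d > 0" "\<forall>q\<in>D. enorm n (lincomb n 1 q (- 1) p) < d \<longrightarrow>
        (\<forall>v\<in>unit_tuples n j. \<bar>jet_form n D u j q v - jet_form n D u j p v\<bar> \<le> e / (N c + 1))"
      using jet_form_continuous[OF p, of "e / (N c + 1)" j] e N1 by auto
    show "\<exists>d>0. \<forall>q\<in>D. enorm n (lincomb n 1 q (- 1) p) < d \<longrightarrow>
        (\<forall>v\<in>unit_tuples n j. N (A j q v - A j p v) \<le> e)"
      using d Nle[of _ e 1] e by (intro exI[of _ d]) (simp add: A_def flip: scaleR_left_diff_distrib)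
  next
    fix j p and e :: real assume p: "p \<in> D" and e: "e > 0"
    obtain d where d: "d > 0" "\<forall>q\<in>D. enorm n (lincomb n 1 q (- 1) p) < d \<longrightarrow>
        (\<forall>v\<in>unit_tuples n j. \<bar>jet_form n D u j q v - jet_form n D u j p v -
          jet_form n D u (Suc j) p (v(j := lincomb n 1 q (- 1) p))\<bar> \<le> e / (N c + 1) * enorm n (lincomb n 1 q (- 1) p))"
      using jet_form_differentiable[OF p, of "e / (N c + 1)" j] e N1 by auto
    show "\<exists>d>0. \<forall>q\<in>D. enorm n (lincomb n 1 q (- 1) p) < d \<longrightarrow>
        (\<forall>v\<in>unit_tuples n j. N (A j q v - A j p v - A (Suc j) p (v(j := lincomb n 1 q (- 1) p)))
          \<le> e * enorm n (lincomb n 1 q (- 1) p))"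
      using d Nle[of _ e] e by (intro exI[of _ d]) (simp add: A_def flip: scaleR_left_diff_distrib)
  qed
qed

text \<open>The increment estimate with e = 1 leaves the linear part at p, so n plus the sum of the
  absolute partials at p is a Lipschitz constant.\<close>

lemma smooth_locally_Lipschitz:
  assumes p: "p \<in> D"
  shows "\<exists>\<delta>>0. \<exists>M\<ge>0. \<forall>q\<in>D. \<forall>r\<in>D. (\<forall>i<n. \<bar>q i - p i\<bar> < \<delta>) \<longrightarrow> (\<forall>i<n. \<bar>r i - p i\<bar> < \<delta>) \<longrightarrow>
    \<bar>u q - u r\<bar> \<le> M * enorm n (lincomb n 1 q (- 1) r)"
proof -
  obtain d where d: "d > 0" and est: "\<And>q r. q \<in> D \<Longrightarrow> r \<in> D \<Longrightarrow>
      (\<forall>i<n. \<bar>q i - p i\<bar> < d) \<Longrightarrow> (\<forall>i<n. \<bar>r i - p i\<bar> < d) \<Longrightarrow>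
      \<bar>u q - u r - (\<Sum>i<n. pd n D i u p * (q i - r i))\<bar> \<le> 1 * (\<Sum>i<n. \<bar>q i - r i\<bar>)"
    using increment_estimate[OF D Ck_real_Suc_has_pd[OF D smoothD[OF u]] smooth_continuous_on[OF smooth_pd[OF u]] p, of 1]
    by auto
  define M where "M = real n + (\<Sum>i<n. \<bar>pd n D i u p\<bar>)"
  show ?thesis
  proof (rule exI[of _ d], intro conjI d(1), rule exI[of _ M], intro conjI ballI impI)
    show "M \<ge> 0" by (simp add: M_def sum_nonneg)
    fix q r assume qr: "q \<in> D" "r \<in> D" "\<forall>i<n. \<bar>q i - p i\<bar> < d" "\<forall>i<n. \<bar>r i - p i\<bar> < d"
    let ?h = "enorm n (lincomb n 1 q (- 1) r)"
    have "\<bar>\<Sum>i<n. pd n D i u p * (q i - r i)\<bar> \<le> (\<Sum>i<n. \<bar>pd n D i u p\<bar> * ?h)"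
    proof (rule order_trans[OF sum_abs sum_mono])
      fix i assume "i \<in> {..<n}"
      then have "\<bar>q i - r i\<bar> \<le> ?h" using abs_le_enorm[of i n "lincomb n 1 q (- 1) r"] by simp
      then show "\<bar>pd n D i u p * (q i - r i)\<bar> \<le> \<bar>pd n D i u p\<bar> * ?h"
        by (simp add: abs_mult mult_left_mono)
    qed
    then have "\<bar>u q - u r\<bar> \<le> real n * ?h + (\<Sum>i<n. \<bar>pd n D i u p\<bar>) * ?h"
      using est[OF qr] sum_diff_le_enorm[where q = q and r = r and n = n] by (simp add: sum_distrib_right)
    then show "\<bar>u q - u r\<bar> \<le> M * ?h" by (simp add: M_def distrib_right)
  qed
qed

end

text \<open>The body of the existential in \<open>Ck_Frechet\<close>, named so that one family of
  derivatives can be fixed and its four properties addressed separately.\<close>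

definition frechet_jet ::
    "('e \<Rightarrow> real) \<Rightarrow> nat \<Rightarrow> (nat \<Rightarrow> real) set \<Rightarrow> enat \<Rightarrow> ((nat \<Rightarrow> real) \<Rightarrow> 'e::real_vector) \<Rightarrow>
      (nat \<Rightarrow> (nat \<Rightarrow> real) \<Rightarrow> (nat \<Rightarrow> nat \<Rightarrow> real) \<Rightarrow> 'e) \<Rightarrow> bool" where
  "frechet_jet N n D k x A \<longleftrightarrow>
     (\<forall>p\<in>D. \<forall>v\<in>{..<0} \<rightarrow>\<^sub>E Rn n. A 0 p v = x p) \<and>
     (\<forall>j. enat j \<le> k \<longrightarrow> (\<forall>p\<in>D. multilinear_Rn n j (A j p))) \<and>
     (\<forall>j. enat j \<le> k \<longrightarrow> (\<forall>p\<in>D. \<forall>e>0. \<exists>d>0. \<forall>q\<in>D. enorm n (lincomb n 1 q (-1) p) < d \<longrightarrow>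
        (\<forall>v\<in>unit_tuples n j. N (A j q v - A j p v) \<le> e))) \<and>
     (\<forall>j. enat j < k \<longrightarrow> (\<forall>p\<in>D. \<forall>e>0. \<exists>d>0. \<forall>q\<in>D. enorm n (lincomb n 1 q (-1) p) < d \<longrightarrow>
        (\<forall>v\<in>unit_tuples n j. N (A j q v - A j p v - A (Suc j) p (v(j := lincomb n 1 q (-1) p)))
           \<le> e * enorm n (lincomb n 1 q (-1) p))))"

lemma Ck_Frechet_iff: "Ck_Frechet N n D k x \<longleftrightarrow> (\<exists>A. frechet_jet N n D k x A)"
  by (simp add: Ck_Frechet_def frechet_jet_def)

text \<open>T is bounded for N, so each estimate for the family A passes to T A. The constant B + 1
  avoids division by zero.\<close>

lemma Ck_Frechet_linear:
  assumes N: "defining_norm N" and x: "Ck_Frechet N n D k x" and T: "linear T" "continuous_on UNIV T"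
  shows "Ck_Frechet N n D k (\<lambda>p. T (x p))"
proof -
  obtain B where B: "B \<ge> 0" "\<And>y. N (T y) \<le> B * N y"
    using continuous_linear_bounded[OF N T] by blast
  have le: "N (T y) \<le> e" if "N y \<le> e / (B + 1)" for y e
  proof -
    have "N (T y) \<le> (B + 1) * N y" using B(2)[of y] defining_norm_properties(1)[OF N, of y] by (simp add: distrib_right)
    also have "\<dots> \<le> e" using that B(1) by (simp add: field_simps)
    finally show ?thesis .
  qed
  have TT: "T y - T z = T (y - z)" for y z by (simp add: linear_diff[OF T(1)])
  obtain A where A: "frechet_jet N n D k x A" using x by (auto simp: Ck_Frechet_iff)
  note A0 = A[unfolded frechet_jet_def, THEN conjunct1, rule_format]
    and A1 = A[unfolded frechet_jet_def, THEN conjunct2, THEN conjunct1, rule_format]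
    and A2 = A[unfolded frechet_jet_def, THEN conjunct2, THEN conjunct2, THEN conjunct1, rule_format]
    and A3 = A[unfolded frechet_jet_def, THEN conjunct2, THEN conjunct2, THEN conjunct2, rule_format]
  show ?thesis
    unfolding Ck_Frechet_def
  proof (intro exI[of _ "\<lambda>j p v. T (A j p v)"] conjI allI impI ballI)
    fix p and v :: "nat \<Rightarrow> nat \<Rightarrow> real" assume "p \<in> D" "v \<in> {..<0} \<rightarrow>\<^sub>E Rn n"
    then show "T (A 0 p v) = T (x p)" using A0 by simp
  next
    fix j p assume "enat j \<le> k" "p \<in> D"
    then show "multilinear_Rn n j (\<lambda>v. T (A j p v))"
      using A1 unfolding multilinear_Rn_def by (simp add: linear_add[OF T(1)] linear_cmul[OF T(1)])
  next
    fix j p and e :: real assume *: "enat j \<le> k" "p \<in> D" "e > 0"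
    have "e / (B + 1) > 0" using * B(1) by simp
    from A2[OF *(1,2) this] show "\<exists>d>0. \<forall>q\<in>D. enorm n (lincomb n 1 q (-1) p) < d \<longrightarrow>
           (\<forall>v\<in>unit_tuples n j. N (T (A j q v) - T (A j p v)) \<le> e)"
      unfolding TT using le by meson
  next
    fix j p and e :: real assume *: "enat j < k" "p \<in> D" "e > 0"
    have "e / (B + 1) > 0" using * B(1) by simp
    from A3[OF *(1,2) this] show "\<exists>d>0. \<forall>q\<in>D. enorm n (lincomb n 1 q (-1) p) < d \<longrightarrow>
           (\<forall>v\<in>unit_tuples n j. N (T (A j q v) - T (A j p v) - T (A (Suc j) p (v(j := lincomb n 1 q (-1) p))))
                \<le> e * enorm n (lincomb n 1 q (-1) p))"
      unfolding TT times_divide_eq_left[symmetric] using le by (metis (no_types, lifting) times_divide_eq_left)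
  qed
qed

lemma Ck_Frechet_add:
  assumes N: "defining_norm N" and x: "Ck_Frechet N n D k x" and y: "Ck_Frechet N n D k y"
  shows "Ck_Frechet N n D k (\<lambda>p. x p + y p)"
proof -
  have le: "N (a + b) \<le> e" if "N a \<le> e / 2" "N b \<le> e / 2" for a b e
    using defining_norm_properties(4)[OF N, of a b] that by simp
  obtain A where A: "frechet_jet N n D k x A" using x by (auto simp: Ck_Frechet_iff)
  note A0 = A[unfolded frechet_jet_def, THEN conjunct1, rule_format]
    and A1 = A[unfolded frechet_jet_def, THEN conjunct2, THEN conjunct1, rule_format]
    and A2 = A[unfolded frechet_jet_def, THEN conjunct2, THEN conjunct2, THEN conjunct1, rule_format]
    and A3 = A[unfolded frechet_jet_def, THEN conjunct2, THEN conjunct2, THEN conjunct2, rule_format]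
  obtain A' where B: "frechet_jet N n D k y A'" using y by (auto simp: Ck_Frechet_iff)
  note B0 = B[unfolded frechet_jet_def, THEN conjunct1, rule_format]
    and B1 = B[unfolded frechet_jet_def, THEN conjunct2, THEN conjunct1, rule_format]
    and B2 = B[unfolded frechet_jet_def, THEN conjunct2, THEN conjunct2, THEN conjunct1, rule_format]
    and B3 = B[unfolded frechet_jet_def, THEN conjunct2, THEN conjunct2, THEN conjunct2, rule_format]
  show ?thesis
    unfolding Ck_Frechet_def
  proof (intro exI[of _ "\<lambda>j p v. A j p v + A' j p v"] conjI allI impI ballI)
    fix p and v :: "nat \<Rightarrow> nat \<Rightarrow> real" assume "p \<in> D" "v \<in> {..<0} \<rightarrow>\<^sub>E Rn n"
    then show "A 0 p v + A' 0 p v = x p + y p" using A0 B0 by simp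
  next
    fix j p assume "enat j \<le> k" "p \<in> D"
    then show "multilinear_Rn n j (\<lambda>v. A j p v + A' j p v)"
      using A1 B1 unfolding multilinear_Rn_def by (simp add: algebra_simps)
  next
    fix j p and e :: real assume *: "enat j \<le> k" "p \<in> D" "e > 0"
    then have e2: "e / 2 > 0" by simp
    obtain d where d: "d > 0" "\<forall>q\<in>D. enorm n (lincomb n 1 q (-1) p) < d \<longrightarrow>
           (\<forall>v\<in>unit_tuples n j. N (A j q v - A j p v) \<le> e / 2)" using A2[OF *(1,2) e2] by blast
    obtain d' where d': "d' > 0" "\<forall>q\<in>D. enorm n (lincomb n 1 q (-1) p) < d' \<longrightarrow>
           (\<forall>v\<in>unit_tuples n j. N (A' j q v - A' j p v) \<le> e / 2)" using B2[OF *(1,2) e2] by blast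
    show "\<exists>d>0. \<forall>q\<in>D. enorm n (lincomb n 1 q (-1) p) < d \<longrightarrow>
           (\<forall>v\<in>unit_tuples n j. N (A j q v + A' j q v - (A j p v + A' j p v)) \<le> e)"
      unfolding add_diff_add
      by (rule exI[of _ "min d d'"]) (use d d' le in simp)
  next
    fix j p and e :: real assume *: "enat j < k" "p \<in> D" "e > 0"
    then have e2: "e / 2 > 0" by simp
    obtain d where d: "d > 0" "\<forall>q\<in>D. enorm n (lincomb n 1 q (-1) p) < d \<longrightarrow>
           (\<forall>v\<in>unit_tuples n j. N (A j q v - A j p v - A (Suc j) p (v(j := lincomb n 1 q (-1) p)))
                \<le> e / 2 * enorm n (lincomb n 1 q (-1) p))" using A3[OF *(1,2) e2] by blast
    obtain d' where d': "d' > 0" "\<forall>q\<in>D. enorm n (lincomb n 1 q (-1) p) < d' \<longrightarrow>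
           (\<forall>v\<in>unit_tuples n j. N (A' j q v - A' j p v - A' (Suc j) p (v(j := lincomb n 1 q (-1) p)))
                \<le> e / 2 * enorm n (lincomb n 1 q (-1) p))" using B3[OF *(1,2) e2] by blast
    show "\<exists>d>0. \<forall>q\<in>D. enorm n (lincomb n 1 q (-1) p) < d \<longrightarrow>
           (\<forall>v\<in>unit_tuples n j. N (A j q v + A' j q v - (A j p v + A' j p v) -
               (A (Suc j) p (v(j := lincomb n 1 q (-1) p)) + A' (Suc j) p (v(j := lincomb n 1 q (-1) p))))
                \<le> e * enorm n (lincomb n 1 q (-1) p))"
      unfolding add_diff_add
      by (rule exI[of _ "min d d'"]) (use d d' le in simp)
  qed
qed

subsection \<open>Hoelder classes\<close>

lemma Ck_Hoelder_linear:
  assumes D: "model_open n D" and N: "defining_norm N" and x: "Ck_Hoelder N n D k \<alpha> x"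
    and T: "linear T" "continuous_on UNIV T"
  shows "Ck_Hoelder N n D k \<alpha> (\<lambda>p. T (x p))"
  unfolding Ck_Hoelder_def
proof (intro conjI ballI)
  have MB: "Ck_MB n D (enat k) x" using x by (simp add: Ck_Hoelder_def)
  show "Ck_MB n D (enat k) (\<lambda>p. T (x p))" by (rule Ck_MB_linear[OF D MB T])
  obtain B where B: "B \<ge> 0" "\<And>y. N (T y) \<le> B * N y" using continuous_linear_bounded[OF N T] by blast
  fix v p assume v: "v \<in> {..<k} \<rightarrow>\<^sub>E Rn n" and p: "p \<in> D"
  obtain W C where W: "openin (top_of_set D) W" "p \<in> W" and C: "\<And>q r. q \<in> W \<Longrightarrow> r \<in> W \<Longrightarrow>
      N (iter_deriv n D x k v q - iter_deriv n D x k v r) \<le> C * enorm n (lincomb n 1 q (-1) r) powr \<alpha>"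
    using x v p unfolding Ck_Hoelder_def by metis
  have "N (iter_deriv n D (\<lambda>p. T (x p)) k v q - iter_deriv n D (\<lambda>p. T (x p)) k v r)
      \<le> B * C * enorm n (lincomb n 1 q (-1) r) powr \<alpha>" if qr: "q \<in> W" "r \<in> W" for q r
  proof -
    have D': "q \<in> D" "r \<in> D" using qr openin_imp_subset[OF W(1)] by auto
    have vi: "v i \<in> Rn n" if "i < k" for i using that by (intro PiE_mem[OF v]) simp
    have "iter_deriv n D (\<lambda>p. T (x p)) k v q - iter_deriv n D (\<lambda>p. T (x p)) k v r =
        T (iter_deriv n D x k v q - iter_deriv n D x k v r)"
      using iter_deriv_linear[OF D MB T _ vi D'(1)] iter_deriv_linear[OF D MB T _ vi D'(2)]
      by (simp add: linear_diff[OF T(1)])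
    then show ?thesis using order_trans[OF B(2) mult_left_mono[OF C[OF qr] B(1)]] by (simp add: mult.assoc)
  qed
  then show "\<exists>W C. openin (top_of_set D) W \<and> p \<in> W \<and> (\<forall>q\<in>W. \<forall>r\<in>W.
      N (iter_deriv n D (\<lambda>p. T (x p)) k v q - iter_deriv n D (\<lambda>p. T (x p)) k v r)
      \<le> C * enorm n (lincomb n 1 q (-1) r) powr \<alpha>)" using W by blast
qed

lemma Ck_Hoelder_add:
  fixes x y :: "(nat \<Rightarrow> real) \<Rightarrow> 'e::{real_vector,t2_space,topological_ab_group_add}"
  assumes D: "model_open n D" and N: "defining_norm N"
    and x: "Ck_Hoelder N n D k \<alpha> x" and y: "Ck_Hoelder N n D k \<alpha> y"
  shows "Ck_Hoelder N n D k \<alpha> (\<lambda>p. x p + y p)"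
  unfolding Ck_Hoelder_def
proof (intro conjI ballI)
  have MB: "Ck_MB n D (enat k) x" "Ck_MB n D (enat k) y" using x y by (simp_all add: Ck_Hoelder_def)
  show "Ck_MB n D (enat k) (\<lambda>p. x p + y p)" by (rule Ck_MB_add[OF D MB])
  fix v p assume v: "v \<in> {..<k} \<rightarrow>\<^sub>E Rn n" and p: "p \<in> D"
  obtain W C where W: "openin (top_of_set D) W" "p \<in> W" and C: "\<And>q r. q \<in> W \<Longrightarrow> r \<in> W \<Longrightarrow>
      N (iter_deriv n D x k v q - iter_deriv n D x k v r) \<le> C * enorm n (lincomb n 1 q (-1) r) powr \<alpha>"
    using x v p unfolding Ck_Hoelder_def by metis
  obtain W' C' where W': "openin (top_of_set D) W'" "p \<in> W'" and C': "\<And>q r. q \<in> W' \<Longrightarrow> r \<in> W' \<Longrightarrow>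
      N (iter_deriv n D y k v q - iter_deriv n D y k v r) \<le> C' * enorm n (lincomb n 1 q (-1) r) powr \<alpha>"
    using y v p unfolding Ck_Hoelder_def by metis
  have "N (iter_deriv n D (\<lambda>p. x p + y p) k v q - iter_deriv n D (\<lambda>p. x p + y p) k v r)
      \<le> (C + C') * enorm n (lincomb n 1 q (-1) r) powr \<alpha>" if qr: "q \<in> W \<inter> W'" "r \<in> W \<inter> W'" for q r
  proof -
    have D': "q \<in> D" "r \<in> D" using qr openin_imp_subset[OF W(1)] by auto
    have vi: "v i \<in> Rn n" if "i < k" for i using that by (intro PiE_mem[OF v]) simp
    have "iter_deriv n D (\<lambda>p. x p + y p) k v q - iter_deriv n D (\<lambda>p. x p + y p) k v r =
        (iter_deriv n D x k v q - iter_deriv n D x k v r) + (iter_deriv n D y k v q - iter_deriv n D y k v r)"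
      using iter_deriv_add[OF D MB _ vi D'(1)] iter_deriv_add[OF D MB _ vi D'(2)] by simp
    then show ?thesis
      using defining_norm_properties(4)[OF N] C[of q r] C'[of q r] qr by (smt (verit) IntD1 IntD2 distrib_right)
  qed
  then show "\<exists>W C. openin (top_of_set D) W \<and> p \<in> W \<and> (\<forall>q\<in>W. \<forall>r\<in>W.
      N (iter_deriv n D (\<lambda>p. x p + y p) k v q - iter_deriv n D (\<lambda>p. x p + y p) k v r)
      \<le> C * enorm n (lincomb n 1 q (-1) r) powr \<alpha>)" 
    using W W' openin_Int[OF W(1) W'(1)] by (intro exI[of _ "W \<inter> W'"] exI[of _ "C + C'"]) blast
qed

lemma openin_box:
  fixes p :: "nat \<Rightarrow> real"
  shows "openin (top_of_set D) {q \<in> D. \<forall>i<n. \<bar>q i - p i\<bar> < \<delta>}"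
proof -
  have "open {q :: nat \<Rightarrow> real. \<bar>q i - p i\<bar> < \<delta>}" for i
    by (rule open_Collect_less) (rule continuous_intros continuous_on_product_coordinates)+
  then have "open (\<Inter>i<n. {q. \<bar>q i - p i\<bar> < \<delta>})" by (intro open_INT) auto
  then have "openin (top_of_set D) (D \<inter> (\<Inter>i<n. {q. \<bar>q i - p i\<bar> < \<delta>}))" by (rule openin_open_Int)
  also have "D \<inter> (\<Inter>i<n. {q. \<bar>q i - p i\<bar> < \<delta>}) = {q \<in> D. \<forall>i<n. \<bar>q i - p i\<bar> < \<delta>}" by auto
  finally show ?thesis .
qed

text \<open>Derivatives of a smooth function are locally Lipschitz, and h \<le> h powr \<alpha> as
  soon as h \<le> 1; so a neighbourhood of diameter at most 1 suffices.\<close>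

lemma smooth_imp_Ck_Hoelder:
  fixes c :: "'e::{real_vector,t2_space}"
  assumes D: "model_open n D" and N: "defining_norm N" and u: "smooth n D u"
    and c: "continuous_on UNIV (\<lambda>r. r *\<^sub>R c)" and \<alpha>: "0 \<le> \<alpha>" "\<alpha> \<le> 1"
  shows "Ck_Hoelder N n D k \<alpha> (\<lambda>p. u p *\<^sub>R c)"
  unfolding Ck_Hoelder_def
proof (intro conjI ballI)
  have lin: "linear (\<lambda>r. r *\<^sub>R c)" by (rule linearI) (auto simp: scaleR_left_distrib)
  have MB: "Ck_MB n D (enat k) u" by (rule smooth_imp_Ck_MB[OF D u])
  show "Ck_MB n D (enat k) (\<lambda>p. u p *\<^sub>R c)" by (rule Ck_MB_linear[OF D MB lin c])
  fix v p assume v: "v \<in> {..<k} \<rightarrow>\<^sub>E Rn n" and p: "p \<in> D"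
  have vi: "v i \<in> Rn n" if "i < k" for i using that by (intro PiE_mem[OF v]) simp
  have sm: "smooth n D (iter_deriv n D u k v)" by (rule smooth_iter_deriv[OF D u vi])
  obtain \<delta> M where \<delta>: "\<delta> > 0" "M \<ge> 0" and M: "\<And>q r. q \<in> D \<Longrightarrow> r \<in> D \<Longrightarrow>
      (\<forall>i<n. \<bar>q i - p i\<bar> < \<delta>) \<Longrightarrow> (\<forall>i<n. \<bar>r i - p i\<bar> < \<delta>) \<Longrightarrow>
      \<bar>iter_deriv n D u k v q - iter_deriv n D u k v r\<bar> \<le> M * enorm n (lincomb n 1 q (- 1) r)"
    using smooth_locally_Lipschitz[OF D sm p] by blast
  \<comment> \<open>Two points of the cube differ by at most 2 d in each coordinate, so n (2 d)
    \<le> 1 bounds their Euclidean distance by 1.\<close>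
  define d where "d = min \<delta> (1 / (2 * (real n + 1)))"
  have d: "d > 0" "d \<le> \<delta>" "real n * (2 * d) \<le> 1"
  proof -
    show "d > 0" "d \<le> \<delta>" using \<delta> by (auto simp: d_def)
    have "real n * (2 * d) \<le> real n * (2 * (1 / (2 * (real n + 1))))"
      by (intro mult_left_mono) (auto simp: d_def)
    also have "\<dots> \<le> 1" by simp
    finally show "real n * (2 * d) \<le> 1" .
  qed
  let ?W = "{q \<in> D. \<forall>i<n. \<bar>q i - p i\<bar> < d}"
  have "N (iter_deriv n D (\<lambda>p. u p *\<^sub>R c) k v q - iter_deriv n D (\<lambda>p. u p *\<^sub>R c) k v r)
      \<le> M * N c * enorm n (lincomb n 1 q (-1) r) powr \<alpha>" if qr: "q \<in> ?W" "r \<in> ?W" for q r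
  proof -
    let ?h = "enorm n (lincomb n 1 q (-1) r)"
    have D': "q \<in> D" "r \<in> D" using qr by auto
    have "?h \<le> (\<Sum>i<n. \<bar>lincomb n 1 q (-1) r i\<bar>)" by (rule enorm_le_sum)
    also have "\<dots> \<le> (\<Sum>i<n. 2 * d)"
    proof (rule sum_mono)
      fix i assume "i \<in> {..<n}"
      then have "\<bar>q i - p i\<bar> < d" "\<bar>r i - p i\<bar> < d" "i < n" using qr by auto
      then show "\<bar>lincomb n 1 q (-1) r i\<bar> \<le> 2 * d" by simp
    qed
    also have "\<dots> \<le> 1" using d(3) by simp
    finally have h1: "?h \<le> 1" .
    have "?h \<le> ?h powr \<alpha>"
    proof (cases "?h = 0")
      case False
      then have "?h > 0" using enorm_nonneg[of n "lincomb n 1 q (-1) r"] by linarith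
      then have "?h powr 1 \<le> ?h powr \<alpha>" using h1 \<alpha> by (intro powr_mono') auto
      then show ?thesis using \<open>?h > 0\<close> by simp
    qed simp
    then have 1: "M * ?h \<le> M * ?h powr \<alpha>" using \<delta>(2) by (rule mult_left_mono)
    have "\<bar>iter_deriv n D u k v q - iter_deriv n D u k v r\<bar> \<le> M * ?h"
      using qr d(2) by (intro M) force+
    then have "\<bar>iter_deriv n D u k v q - iter_deriv n D u k v r\<bar> * N c \<le> M * ?h powr \<alpha> * N c"
      using 1 defining_norm_properties(1)[OF N] by (intro mult_right_mono) auto
    moreover have "iter_deriv n D (\<lambda>p. u p *\<^sub>R c) k v q - iter_deriv n D (\<lambda>p. u p *\<^sub>R c) k v r =
        (iter_deriv n D u k v q - iter_deriv n D u k v r) *\<^sub>R c"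
      using iter_deriv_linear[OF D MB lin c _ vi D'(1)] iter_deriv_linear[OF D MB lin c _ vi D'(2)]
      by (simp add: scaleR_left_diff_distrib)
    ultimately show ?thesis by (simp add: defining_norm_properties(3)[OF N] mult_ac)
  qed
  moreover have "p \<in> ?W" using p d by simp
  moreover have "openin (top_of_set D) ?W" by (rule openin_box)
  ultimately show "\<exists>W C. openin (top_of_set D) W \<and> p \<in> W \<and> (\<forall>q\<in>W. \<forall>r\<in>W.
      N (iter_deriv n D (\<lambda>p. u p *\<^sub>R c) k v q - iter_deriv n D (\<lambda>p. u p *\<^sub>R c) k v r)
      \<le> C * enorm n (lincomb n 1 q (-1) r) powr \<alpha>)" by (intro exI[of _ ?W] exI[of _ "M * N c"]) blast
qed

subsection \<open>Lebesgue measure on the model spaces\<close>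

lemma space_leb [simp]: "space (leb n) = Rn n"
  by (simp add: space_PiM)

text \<open>Bridge from the Borel sets of \<open>nat => real\<close>, to which continuity refers, to
  the product sigma-algebra of \<open>leb n\<close>: coordinates from n on are constantly
  \<open>undefined\<close> on its space.\<close>

lemma measurable_ident_leb: "(\<lambda>z. z) \<in> borel_measurable (leb n)"
proof (rule measurable_coordinatewise_then_product)
  fix i
  show "(\<lambda>z. z i) \<in> borel_measurable (leb n)"
  proof (cases "i < n")
    case True
    have "(\<lambda>z. z i) \<in> measurable (leb n) lborel"
      by (rule measurable_component_singleton) (use True in simp)
    then show ?thesis by simp
  next
    case False
    have "z i = undefined" if "z \<in> space (leb n)" for z :: "nat \<Rightarrow> real"
      using that False by (simp add: PiE_def extensional_def)
    then show ?thesis by (rule measurable_cong[THEN iffD2, OF _ measurable_const]) simp_all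
  qed
qed

lemma borel_imp_sets_leb:
  assumes "A \<in> sets borel" "A \<subseteq> Rn n"
  shows "A \<in> sets (leb n)"
proof -
  have "(\<lambda>z. z) -` A \<inter> space (leb n) \<in> sets (leb n)"
    by (rule measurable_sets[OF measurable_ident_leb assms(1)])
  also have "(\<lambda>z. z) -` A \<inter> space (leb n) = A" using assms(2) by auto
  finally show ?thesis .
qed

lemma closed_coordinate: "closed {z :: nat \<Rightarrow> real. z i = c}"
  by (rule closed_Collect_eq) (rule continuous_on_product_coordinates continuous_on_const)+

lemma closed_Rn: "closed (Rn n)"
proof -
  have "Rn n = (\<Inter>i\<in>-{..<n}. {z. z i = undefined})" by (auto simp: PiE_def extensional_def)
  then show ?thesis using closed_coordinate by (simp add: closed_INT)
qed

lemma closed_half_space: "closed (half_space n)"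
proof -
  have "closed {z :: nat \<Rightarrow> real. 0 \<le> z 0}"
    by (rule closed_Collect_le) (rule continuous_on_product_coordinates continuous_on_const)+
  moreover have "half_space n = (if n > 0 then Rn n \<inter> {z. 0 \<le> z 0} else Rn n)"
    by (auto simp: half_space_def)
  ultimately show ?thesis using closed_Rn[of n] by (simp add: closed_Int)
qed

lemma model_open_borel:
  assumes "model_open n D"
  shows "D \<in> sets borel"
proof -
  obtain H where H: "model_space n H" "openin (top_of_set H) D" using assms by (auto simp: model_open_iff)
  then obtain W where W: "open W" "D = H \<inter> W" by (auto simp: openin_open)
  have "closed H" using H(1) closed_Rn closed_half_space unfolding model_space_def by metis
  then show ?thesis using W by auto
qed

lemma borel_measurable_indicator_leb:
  fixes f :: "(nat \<Rightarrow> real) \<Rightarrow> real"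
  assumes "A \<in> sets borel" "continuous_on A f"
  shows "(\<lambda>z. indicator A z * f z) \<in> borel_measurable (leb n)"
  using measurable_compose[OF measurable_ident_leb borel_measurable_continuous_on_indicator[OF assms]]
  by simp

lemma compact_coordinates_bounded:
  assumes "compact (K :: (nat \<Rightarrow> real) set)"
  shows "\<exists>B>0. \<forall>z\<in>K. \<forall>i<n. \<bar>z i\<bar> \<le> B"
proof -
  have "\<exists>B>0. \<forall>z\<in>K. \<bar>z i\<bar> \<le> B" for i
  proof -
    have "compact ((\<lambda>z. z i) ` K)"
      by (rule compact_continuous_image[OF continuous_on_subset[OF continuous_on_product_coordinates] assms]) simp
    then have "bounded ((\<lambda>z. z i) ` K)" by (rule compact_imp_bounded)
    then show ?thesis by (auto simp: bounded_pos)
  qed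
  then obtain b where b: "\<And>i. b i > 0" "\<And>i z. z \<in> K \<Longrightarrow> \<bar>z i\<bar> \<le> b i" by metis
  have "\<bar>z i\<bar> \<le> Max (insert 1 (b ` {..<n}))" if "z \<in> K" "i < n" for z i
    using b(2)[OF that(1), of i] that(2) by (meson Max_ge finite_imageI finite_insert finite_lessThan imageI insertI2 lessThan_iff order_trans)
  moreover have "Max (insert 1 (b ` {..<n})) > 0"
    by (rule less_le_trans[OF zero_less_one]) simp
  ultimately show ?thesis by blast
qed

lemma product_sigma_finite_lborel: "product_sigma_finite (\<lambda>_. lborel :: real measure)"
  by standard

lemma compact_borel: "compact (K :: (nat \<Rightarrow> real) set) \<Longrightarrow> K \<in> sets borel"
  by (simp add: compact_imp_closed)

lemma emeasure_compact_finite: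
  assumes K: "compact K" "K \<subseteq> Rn n"
  shows "emeasure (leb n) K < \<infinity>"
proof -
  obtain B where B: "B > 0" "\<forall>z\<in>K. \<forall>i<n. \<bar>z i\<bar> \<le> B" using compact_coordinates_bounded[OF K(1)] by blast
  have sub: "K \<subseteq> {..<n} \<rightarrow>\<^sub>E {-B..B}"
  proof
    fix z assume z: "z \<in> K"
    then have zn: "z \<in> Rn n" using K(2) by blast
    have "z i \<in> {-B..B}" if "i \<in> {..<n}" for i
    proof -
      have "\<bar>z i\<bar> \<le> B" using B(2) z that by simp
      then show ?thesis by (simp add: abs_le_iff)
    qed
    moreover have "z i = undefined" if "i \<notin> {..<n}" for i using PiE_arb[OF zn that] .
    ultimately show "z \<in> {..<n} \<rightarrow>\<^sub>E {-B..B}" by (rule PiE_I)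
  qed
  have "emeasure (leb n) K \<le> emeasure (leb n) ({..<n} \<rightarrow>\<^sub>E {-B..B})"
    by (rule emeasure_mono[OF sub]) (rule sets_PiM_I_finite; simp)
  also have "\<dots> = (\<Prod>i<n. emeasure lborel {-B..B})"
    by (rule product_sigma_finite.emeasure_PiM[OF product_sigma_finite_lborel]) auto
  also have "\<dots> = ennreal (2 * B) ^ n" using B(1) by simp
  also have "\<dots> < \<infinity>" by (simp add: power_less_top_ennreal ennreal_mult_less_top)
  finally show ?thesis .
qed

lemma set_integrable_continuous_compact:
  fixes h :: "(nat \<Rightarrow> real) \<Rightarrow> real"
  assumes K: "compact K" "K \<subseteq> Rn n" and h: "continuous_on K h"
  shows "set_integrable (leb n) K h"
proof -
  have "bounded (h ` K)" by (rule compact_imp_bounded[OF compact_continuous_image[OF h K(1)]])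
  then obtain B where B: "\<forall>z\<in>K. \<bar>h z\<bar> \<le> B" by (auto simp: bounded_iff)
  have "integrable (leb n) (\<lambda>z. indicator K z *\<^sub>R (indicator K z * h z))"
    using B by (intro integrableI_bounded_set_indicator[where B = B] borel_imp_sets_leb compact_borel
        borel_measurable_indicator_leb emeasure_compact_finite K h AE_I2) auto
  then show ?thesis by (simp add: set_integrable_def mult.assoc[symmetric] indicator_inter_arith[symmetric])
qed

text \<open>Both integrands, extended by zero, are the same function.\<close>

lemma set_integral_restrict:
  fixes h :: "(nat \<Rightarrow> real) \<Rightarrow> real"
  assumes "K \<subseteq> D" "\<And>z. z \<in> D - K \<Longrightarrow> h z = 0"
  shows "set_integrable (leb n) D h \<longleftrightarrow> set_integrable (leb n) K h"
    "set_lebesgue_integral (leb n) D h = set_lebesgue_integral (leb n) K h"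
proof -
  have "(\<lambda>z. indicator D z *\<^sub>R h z) = (\<lambda>z. indicator K z *\<^sub>R h z)"
    by (rule ext) (use assms in \<open>auto simp: indicator_def\<close>)
  then show "set_integrable (leb n) D h \<longleftrightarrow> set_integrable (leb n) K h"
    "set_lebesgue_integral (leb n) D h = set_lebesgue_integral (leb n) K h"
    by (simp_all only: set_integrable_def set_lebesgue_integral_def)
qed

text \<open>Fubini with the i-th variable innermost: along each line the fundamental theorem of
  calculus gives the difference of two values of h outside K, and these are 0.\<close>

lemma integral_partial_zero:
  fixes h :: "(nat \<Rightarrow> real) \<Rightarrow> real"
  assumes i: "i < n" and h: "\<And>z. z \<in> Rn n \<Longrightarrow> has_dir_deriv n (Rn n) h (unit_vec n i) z (h' z)"
    and cont: "continuous_on (Rn n) h'" and K: "compact K" "K \<subseteq> Rn n"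
    and zero: "\<And>z. z \<in> Rn n - K \<Longrightarrow> h z = 0" "\<And>z. z \<in> Rn n - K \<Longrightarrow> h' z = 0"
  shows "set_lebesgue_integral (leb n) (Rn n) h' = 0"
proof -
  have int: "set_integrable (leb n) (Rn n) h'"
    using set_integral_restrict(1)[OF K(2) zero(2)] set_integrable_continuous_compact[OF K continuous_on_subset[OF cont K(2)]]
    by simp
  have "integrable (leb n) (\<lambda>z. indicator (Rn n) z *\<^sub>R h' z) \<longleftrightarrow> integrable (leb n) h'"
    by (rule Bochner_Integration.integrable_cong) simp_all
  then have inth: "integrable (leb n) h'" using int by (simp only: set_integrable_def)
  define J where "J = {..<n} - {i}"
  have ins: "{..<n} = insert i J" and J: "finite J" "i \<notin> J" using i by (auto simp: J_def)
  have *: "integral\<^sup>L (leb n) h' = (\<integral>x. (\<integral>y. h' (x(i := y)) \<partial>lborel) \<partial>PiM J (\<lambda>_. lborel))"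
    unfolding ins
    by (rule product_sigma_finite.product_integral_insert[OF product_sigma_finite_lborel J inth[unfolded ins]])
  obtain B where B: "B > 0" "\<forall>z\<in>K. \<forall>i<n. \<bar>z i\<bar> \<le> B" using compact_coordinates_bounded[OF K(1)] by blast
  have inner: "(\<integral>y. h' (x(i := y)) \<partial>lborel) = 0" if x: "x \<in> space (PiM J (\<lambda>_. lborel :: real measure))" for x
  proof -
    have xR: "x(i := y) \<in> Rn n" for y
      using x unfolding ins space_PiM by (intro PiE_fun_upd) auto
    have line: "lincomb n 1 (x(i := 0)) y (unit_vec n i) = x(i := y)" for y
      by (rule Rn_eqI[OF lincomb_in_Rn xR]) auto
    have der: "((\<lambda>y. h (x(i := y))) has_real_derivative h' (x(i := y))) (at y)" for y
    proof -
      have "((\<lambda>y. h (lincomb n 1 (x(i := 0)) y (unit_vec n i))) has_real_derivative h' (x(i := y))) (at y within UNIV)"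
        by (rule has_dir_deriv_line[where D = "Rn n"]) (use h[OF xR] in \<open>simp_all only: line lincomb_in_Rn\<close>, rule xR)
      then show ?thesis by (simp only: line)
    qed
    have "continuous_on UNIV (\<lambda>y. x(i := y))"
      using continuous_on_lincomb[of UNIV "\<lambda>_. 1" "\<lambda>_. x(i := 0)" "\<lambda>y. y" "\<lambda>_. unit_vec n i" n]
      by (simp add: line continuous_on_const continuous_on_id)
    then have "continuous_on UNIV (\<lambda>y. h' (x(i := y)))"
      by (rule continuous_on_compose2[OF cont]) (use xR in blast)
    then have isc: "isCont (\<lambda>y. h' (x(i := y))) y" for y
      by (simp add: continuous_on_eq_continuous_at)
    \<comment> \<open>On K the i-th coordinate is at most B in absolute value, so the end points B +
      1 and - (B + 1) used below lie off K.\<close>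
    have out: "x(i := y) \<in> Rn n - K" if "\<bar>y\<bar> > B" for y
      using xR B(2) i that by fastforce
    have "(\<integral>y. h' (x(i := y)) * indicator {- (B + 1)..B + 1} y \<partial>lborel) =
        h (x(i := B + 1)) - h (x(i := - (B + 1)))"
      by (rule integral_FTC_Icc_real[OF _ der isc]) (use B(1) in simp)
    also have "\<dots> = 0" using zero(1)[OF out] B(1) by simp
    also have "(\<lambda>y. h' (x(i := y)) * indicator {- (B + 1)..B + 1} y) = (\<lambda>y. h' (x(i := y)))"
    proof
      fix y
      show "h' (x(i := y)) * indicator {- (B + 1)..B + 1} y = h' (x(i := y))"
        using zero(2)[OF out, of y] by (cases "\<bar>y\<bar> > B") (auto simp: indicator_def)
    qed
    finally show ?thesis .
  qed
  have "integral\<^sup>L (leb n) h' = (\<integral>x. 0 \<partial>PiM J (\<lambda>_. lborel :: real measure))"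
    unfolding * by (rule Bochner_Integration.integral_cong[OF refl inner])
  then have "integral\<^sup>L (leb n) h' = 0" by simp
  moreover have "set_lebesgue_integral (leb n) (Rn n) h' = integral\<^sup>L (leb n) h'"
    unfolding set_lebesgue_integral_def by (rule Bochner_Integration.integral_cong) auto
  ultimately show "set_lebesgue_integral (leb n) (Rn n) h' = 0" by simp
qed

subsection \<open>Test functions and integration by parts\<close>

lemma test_functionE:
  assumes "\<psi> \<in> test_functions n D"
  obtains K where "compact K" "K \<subseteq> top_of_set (Rn n) interior_of D" "\<And>z. z \<in> Rn n - K \<Longrightarrow> \<psi> z = 0"
  using assms by (auto simp: test_functions_def)

lemma test_function_smooth: "\<psi> \<in> test_functions n D \<Longrightarrow> smooth n (Rn n) \<psi>"
  by (simp add: test_functions_def smooth_def Ck_MB_infinity_imp_Ck_real[OF model_open_Rn])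

lemma openin_Rn_minus_compact: "compact K \<Longrightarrow> openin (top_of_set (Rn n)) (Rn n - K)"
  by (simp add: Diff_eq openin_open_Int open_Compl compact_imp_closed)

text \<open>K is closed, so near a point off K the function is zero, and derivatives are
  local.\<close>

lemma pd_zero_off_compact:
  fixes \<psi> :: "(nat \<Rightarrow> real) \<Rightarrow> real"
  assumes "compact K" "\<And>z. z \<in> Rn n - K \<Longrightarrow> \<psi> z = 0" "z \<in> Rn n - K"
  shows "pd n (Rn n) i \<psi> z = 0"
proof -
  note J = openin_Rn_minus_compact[OF assms(1), of n]
  have "has_dir_deriv n (Rn n - K) (\<lambda>_. 0) (unit_vec n i) z (0 :: real)"
    by (simp add: has_dir_deriv_def)
  then have "has_dir_deriv n (Rn n - K) \<psi> (unit_vec n i) z 0"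
    using has_dir_deriv_cong[OF assms(3), of \<psi> "\<lambda>_. 0"] assms(2) by simp
  then have "has_dir_deriv n (Rn n) \<psi> (unit_vec n i) z 0"
    by (rule has_dir_deriv_open_subset[OF J assms(3) order.refl, THEN iffD1])
  then show ?thesis using assms(3) by (intro dir_deriv_eq[OF model_open_Rn]) auto
qed

lemma pd_test_function:
  assumes "\<psi> \<in> test_functions n D"
  shows "pd n (Rn n) i \<psi> \<in> test_functions n D"
proof -
  obtain K where K: "compact K" "K \<subseteq> top_of_set (Rn n) interior_of D" "\<And>z. z \<in> Rn n - K \<Longrightarrow> \<psi> z = 0"
    by (rule test_functionE[OF assms], rule that)
  have "Ck_MB n (Rn n) \<infinity> (pd n (Rn n) i \<psi>)"
    using assms by (intro Ck_MB_infinity_dir_deriv unit_vec_in_Rn) (simp add: test_functions_def)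
  moreover have "\<forall>z\<in>Rn n - K. pd n (Rn n) i \<psi> z = 0"
    by (rule ballI) (rule pd_zero_off_compact[OF K(1,3)])
  ultimately show ?thesis using K(1,2) unfolding test_functions_def by blast
qed

lemma partial_deriv_test_function:
  "\<psi> \<in> test_functions n D \<Longrightarrow> partial_deriv n j a \<psi> \<in> test_functions n D"
  unfolding partial_deriv_def by (induction j) (simp_all add: pd_test_function)

lemma test_function_supportE:
  assumes "\<psi> \<in> test_functions n D" "model_open n D"
  obtains K where "compact K" "K \<subseteq> D" "K \<subseteq> Rn n" "\<And>z. z \<in> D - K \<Longrightarrow> \<psi> z = 0" "continuous_on K \<psi>"
proof -
  obtain K where K: "compact K" "K \<subseteq> top_of_set (Rn n) interior_of D" "\<And>z. z \<in> Rn n - K \<Longrightarrow> \<psi> z = 0"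
    by (rule test_functionE[OF assms(1)], rule that)
  have KD: "K \<subseteq> D" by (rule order_trans[OF K(2) interior_of_subset])
  have DR: "D \<subseteq> Rn n" by (rule model_open_subset[OF assms(2)])
  show ?thesis
  proof (rule that[OF K(1) KD order_trans[OF KD DR]])
    show "\<psi> z = 0" if "z \<in> D - K" for z using K(3) that DR by blast
    show "continuous_on K \<psi>"
      by (rule continuous_on_subset[OF smooth_continuous_on[OF test_function_smooth[OF assms(1)]] order_trans[OF KD DR]])
  qed
qed

text \<open>A compact set K carrying \<psi> lies in the interior of D relative to
  \<open>Rn n\<close>, away from the boundary of the half space. The product u \<psi> extended by
  zero is therefore continuously differentiable on all of \<open>Rn n\<close>, and its partial
  derivative integrates to 0 without boundary terms.\<close>

lemma integration_by_parts:
  assumes D: "model_open n D" and u: "smooth n D u" and \<psi>: "\<psi> \<in> test_functions n D" and i: "i < n"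
  shows "set_lebesgue_integral (leb n) D (\<lambda>z. u z * pd n (Rn n) i \<psi> z) =
    - set_lebesgue_integral (leb n) D (\<lambda>z. pd n D i u z * \<psi> z)"
proof -
  obtain K where K: "compact K" "K \<subseteq> top_of_set (Rn n) interior_of D" "\<And>z. z \<in> Rn n - K \<Longrightarrow> \<psi> z = 0"
    by (rule test_functionE[OF \<psi>], rule that)
  define I where "I = top_of_set (Rn n) interior_of D"
  have I: "openin (top_of_set (Rn n)) I" "I \<subseteq> D" "K \<subseteq> I"
    using K(2) by (auto simp: I_def interior_of_subset)
  have DR: "D \<subseteq> Rn n" by (rule model_open_subset[OF D])
  have KR: "K \<subseteq> Rn n" using I DR by blast
  have ID: "openin (top_of_set D) I" by (rule openin_subset_trans[OF I(1,2) DR])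
  have mI: "model_open n I" by (rule model_open_openin[OF model_open_Rn I(1)])
  \<comment> \<open>I and J form an open cover of \<open>Rn n\<close>: on I the product rule
    applies, on J the extended product vanishes.\<close>
  define J where "J = Rn n - K"
  have J: "openin (top_of_set (Rn n)) J" unfolding J_def by (rule openin_Rn_minus_compact[OF K(1)])
  have IJ: "I \<union> J = Rn n" using I DR by (auto simp: J_def)
  have \<psi>s: "smooth n (Rn n) \<psi>" by (rule test_function_smooth[OF \<psi>])
  define h where "h z = indicator D z * (u z * \<psi> z)" for z
  define h' where "h' z = indicator D z * (pd n D i u z * \<psi> z + pd n (Rn n) i \<psi> z * u z)" for z
  have h0: "h z = 0" "h' z = 0" if "z \<in> Rn n - K" for z
    using K(3)[OF that] pd_zero_off_compact[OF K(1,3) that] by (auto simp: h_def h'_def)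
  have hI: "h z = u z * \<psi> z" "h' z = pd n D i u z * \<psi> z + pd n (Rn n) i \<psi> z * u z" if "z \<in> I" for z
    using subsetD[OF I(2) that] by (simp_all add: h_def h'_def)
  have der: "has_dir_deriv n (Rn n) h (unit_vec n i) z (h' z)" if z: "z \<in> Rn n" for z
  proof (cases "z \<in> I")
    case True
    have zD: "z \<in> D" using True I(2) by blast
    have "has_dir_deriv n I u (unit_vec n i) z (pd n D i u z)"
      by (rule has_dir_deriv_open_subset[OF ID True DR, THEN iffD2, OF Ck_real_Suc_has_pd[OF D smoothD[OF u] i zD]])
    moreover have "has_dir_deriv n I \<psi> (unit_vec n i) z (pd n (Rn n) i \<psi> z)"
      by (rule has_dir_deriv_open_subset[OF I(1) True order.refl, THEN iffD2,
            OF Ck_real_Suc_has_pd[OF model_open_Rn smoothD[OF \<psi>s] i z]])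
    ultimately have "has_dir_deriv n I (\<lambda>z. u z * \<psi> z) (unit_vec n i) z (h' z)"
      unfolding hI(2)[OF True] by (rule has_dir_deriv_mult_real[OF mI True])
    then have "has_dir_deriv n I h (unit_vec n i) z (h' z)"
      using has_dir_deriv_cong[OF True, of h "\<lambda>z. u z * \<psi> z"] hI(1) by simp
    then show ?thesis by (rule has_dir_deriv_open_subset[OF I(1) True order.refl, THEN iffD1])
  next
    case False
    then have zJ: "z \<in> J" using z I(3) by (auto simp: J_def)
    have "has_dir_deriv n J (\<lambda>_. 0) (unit_vec n i) z (h' z)"
      using h0(2)[of z] zJ by (simp add: has_dir_deriv_def J_def)
    then have "has_dir_deriv n J h (unit_vec n i) z (h' z)"
      using has_dir_deriv_cong[OF zJ, of h "\<lambda>_. 0"] h0(1) by (simp add: J_def)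
    then show ?thesis by (rule has_dir_deriv_open_subset[OF J zJ order.refl, THEN iffD1])
  qed
  have cont: "continuous_on (Rn n) h'"
  proof -
    have "continuous_on I (\<lambda>z. pd n D i u z * \<psi> z + pd n (Rn n) i \<psi> z * u z)"
      by (intro continuous_on_add continuous_on_mult
          continuous_on_subset[OF smooth_continuous_on[OF smooth_pd[OF u i]] I(2)]
          continuous_on_subset[OF smooth_continuous_on[OF u] I(2)]
          continuous_on_subset[OF smooth_continuous_on[OF smooth_pd[OF \<psi>s i]] order_trans[OF I(2) DR]]
          continuous_on_subset[OF smooth_continuous_on[OF \<psi>s] order_trans[OF I(2) DR]])
    then have "continuous_on I h'" using hI(2) by (simp cong: continuous_on_cong)
    moreover have "continuous_on J h'"
      by (subst continuous_on_cong[OF refl, of J h' "\<lambda>_. 0"]) (auto simp: J_def h0(2))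
    ultimately show ?thesis using continuous_on_Un_local_open[of I J h'] I(1) J by (simp add: IJ)
  qed
  have int: "set_integrable (leb n) D (\<lambda>z. pd n D i u z * \<psi> z)" "set_integrable (leb n) D (\<lambda>z. u z * pd n (Rn n) i \<psi> z)"
  proof -
    have KD: "K \<subseteq> D" using I by blast
    note c = smooth_continuous_on[OF smooth_pd[OF u i]] smooth_continuous_on[OF u]
        smooth_continuous_on[OF smooth_pd[OF \<psi>s i]] smooth_continuous_on[OF \<psi>s]
    note s = continuous_on_subset[OF c(1) KD] continuous_on_subset[OF c(2) KD]
      continuous_on_subset[OF c(3) KR] continuous_on_subset[OF c(4) KR]
    have s1: "set_integrable (leb n) K (\<lambda>z. pd n D i u z * \<psi> z)"
      by (rule set_integrable_continuous_compact[OF K(1) KR continuous_on_mult[OF s(1) s(4)]])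
    have off: "z \<in> Rn n - K" if "z \<in> D - K" for z using that DR by blast
    have "pd n D i u z * \<psi> z = 0" if "z \<in> D - K" for z using K(3)[OF off[OF that]] by simp
    with s1 show "set_integrable (leb n) D (\<lambda>z. pd n D i u z * \<psi> z)"
      using set_integral_restrict(1)[OF KD, of "\<lambda>z. pd n D i u z * \<psi> z"] by simp
    have "set_integrable (leb n) K (\<lambda>z. u z * pd n (Rn n) i \<psi> z)"
      by (rule set_integrable_continuous_compact[OF K(1) KR continuous_on_mult[OF s(2) s(3)]])
    moreover have "u z * pd n (Rn n) i \<psi> z = 0" if "z \<in> D - K" for z
      using pd_zero_off_compact[OF K(1,3) off[OF that]] by simp
    ultimately show "set_integrable (leb n) D (\<lambda>z. u z * pd n (Rn n) i \<psi> z)"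
      using set_integral_restrict(1)[OF KD, of "\<lambda>z. u z * pd n (Rn n) i \<psi> z"] by simp
  qed
  have "0 = set_lebesgue_integral (leb n) (Rn n) h'"
    using integral_partial_zero[OF i der cont K(1) KR h0] by simp
  also have "\<dots> = set_lebesgue_integral (leb n) D h'"
    by (rule set_integral_restrict(2)[OF DR]) (simp add: h'_def)
  also have "\<dots> = set_lebesgue_integral (leb n) D (\<lambda>z. pd n D i u z * \<psi> z + u z * pd n (Rn n) i \<psi> z)"
    unfolding set_lebesgue_integral_def by (rule Bochner_Integration.integral_cong) (auto simp: h'_def indicator_def)
  also have "\<dots> = set_lebesgue_integral (leb n) D (\<lambda>z. pd n D i u z * \<psi> z) +
      set_lebesgue_integral (leb n) D (\<lambda>z. u z * pd n (Rn n) i \<psi> z)"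
    by (rule set_integral_add(2)[OF int])
  finally show ?thesis by simp
qed

text \<open>G is found before \<psi>, as a weak derivative requires. The outermost derivative of
  \<psi> is moved first, so u is differentiated along \<open>a j\<close> before the induction
  hypothesis is used.\<close>

lemma iterated_integration_by_parts:
  assumes D: "model_open n D" and a: "\<And>i. i < j \<Longrightarrow> a i < n"
  shows "smooth n D u \<Longrightarrow> \<exists>G. smooth n D G \<and> (\<forall>\<psi>\<in>test_functions n D.
    set_lebesgue_integral (leb n) D (\<lambda>z. u z * partial_deriv n j a \<psi> z) =
      (- 1) ^ j * set_lebesgue_integral (leb n) D (\<lambda>z. G z * \<psi> z))"
  using a
proof (induction j arbitrary: u)
  case 0
  then show ?case by (intro exI[of _ u]) (simp add: partial_deriv_def)
next
  case (Suc j)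
  have aj: "a j < n" and a: "\<And>i. i < j \<Longrightarrow> a i < n" using Suc.prems(2) by auto
  obtain G where G: "smooth n D G" "\<And>\<psi>. \<psi> \<in> test_functions n D \<Longrightarrow>
      set_lebesgue_integral (leb n) D (\<lambda>z. pd n D (a j) u z * partial_deriv n j a \<psi> z) =
        (- 1) ^ j * set_lebesgue_integral (leb n) D (\<lambda>z. G z * \<psi> z)"
    using Suc.IH[OF smooth_pd[OF Suc.prems(1) aj] a] by blast
  have "set_lebesgue_integral (leb n) D (\<lambda>z. u z * partial_deriv n (Suc j) a \<psi> z) =
      (- 1) ^ Suc j * set_lebesgue_integral (leb n) D (\<lambda>z. G z * \<psi> z)" if \<psi>: "\<psi> \<in> test_functions n D" for \<psi>
  proof -
    have "partial_deriv n (Suc j) a \<psi> = pd n (Rn n) (a j) (partial_deriv n j a \<psi>)"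
      by (simp add: partial_deriv_def)
    then show ?thesis
      using integration_by_parts[OF D Suc.prems(1) partial_deriv_test_function[OF \<psi>] aj] G(2)[OF \<psi>] by simp
  qed
  then show ?case using G(1) by blast
qed

subsection \<open>Sobolev classes\<close>

text \<open>\<open>Lp_loc\<close> asks for measurability on the whole space, while G is controlled
  on D only; the cut-off outside D changes no integral over D.\<close>

lemma smooth_imp_Lp_loc:
  assumes D: "model_open n D" and G: "smooth n D G" and p: "p \<ge> 1"
  shows "Lp_loc n D p (\<lambda>z. indicator D z * G z)"
  unfolding Lp_loc_def
proof (intro conjI allI impI)
  note c = smooth_continuous_on[OF G]
  show "(\<lambda>z. indicator D z * G z) \<in> borel_measurable (leb n)"
    by (rule borel_measurable_indicator_leb[OF model_open_borel[OF D] c])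
  fix K assume K: "compact K \<and> K \<subseteq> D"
  then have KR: "K \<subseteq> Rn n" using model_open_subset[OF D] by blast
  have "continuous_on K (\<lambda>z. \<bar>G z\<bar> powr p)"
    using p K by (intro continuous_on_powr' continuous_on_rabs continuous_on_const continuous_on_subset[OF c]) auto
  then have "set_integrable (leb n) K (\<lambda>z. \<bar>G z\<bar> powr p)"
    using set_integrable_continuous_compact[OF _ KR] K by blast
  moreover have "(\<lambda>z. indicator K z *\<^sub>R \<bar>G z\<bar> powr p) = (\<lambda>z. indicator K z *\<^sub>R \<bar>indicator D z * G z\<bar> powr p)"
    by (rule ext) (use K in \<open>auto simp: indicator_def\<close>)
  ultimately show "set_integrable (leb n) K (\<lambda>z. \<bar>indicator D z * G z\<bar> powr p)"
    by (simp only: set_integrable_def)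
qed

lemma smooth_imp_Sobolev_real:
  assumes D: "model_open n D" and u: "smooth n D u" and p: "p \<ge> 1"
  shows "Sobolev_real n D k p u"
  unfolding Sobolev_real_def
proof (intro conjI allI impI ballI)
  show "continuous_on D u" by (rule smooth_continuous_on[OF u])
  fix j :: nat and a :: "nat \<Rightarrow> nat" assume a: "a \<in> {..<j} \<rightarrow>\<^sub>E {..<n}"
  have "a i < n" if "i < j" for i using PiE_mem[OF a, of i] that by simp
  then obtain G where G: "smooth n D G" "\<And>\<psi>. \<psi> \<in> test_functions n D \<Longrightarrow>
      set_lebesgue_integral (leb n) D (\<lambda>z. u z * partial_deriv n j a \<psi> z) =
        (- 1) ^ j * set_lebesgue_integral (leb n) D (\<lambda>z. G z * \<psi> z)"
    using iterated_integration_by_parts[OF D _ u, of j a] by blast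
  have "set_lebesgue_integral (leb n) D (\<lambda>z. (indicator D z * G z) * \<psi> z) =
      set_lebesgue_integral (leb n) D (\<lambda>z. G z * \<psi> z)" for \<psi>
    unfolding set_lebesgue_integral_def
    by (rule Bochner_Integration.integral_cong) (auto simp: indicator_def)
  then show "\<exists>g. Lp_loc n D p g \<and> (\<forall>\<psi>\<in>test_functions n D.
      set_lebesgue_integral (leb n) D (\<lambda>z. u z * partial_deriv n j a \<psi> z) =
        (- 1) ^ j * set_lebesgue_integral (leb n) D (\<lambda>z. g z * \<psi> z))"
    using smooth_imp_Lp_loc[OF D G(1) p] G(2) by (intro exI[of _ "\<lambda>z. indicator D z * G z"]) simp
qed

text \<open>For p \<ge> 1 the bound |g| \<le> 1 + |g| powr p takes the place of the Hoelder
  inequality, because \<psi> is bounded and vanishes off a compact set.\<close>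

lemma Lp_loc_set_integrable_mult:
  assumes D: "model_open n D" and p: "p \<ge> 1" and g: "Lp_loc n D p g" and \<psi>: "\<psi> \<in> test_functions n D"
  shows "set_integrable (leb n) D (\<lambda>z. g z * \<psi> z)"
proof -
  obtain K where K: "compact K" "K \<subseteq> D" "K \<subseteq> Rn n" "\<And>z. z \<in> D - K \<Longrightarrow> \<psi> z = 0" "continuous_on K \<psi>"
    by (rule test_function_supportE[OF \<psi> D], rule that)
  have gm: "g \<in> borel_measurable (leb n)" and gi: "set_integrable (leb n) K (\<lambda>z. \<bar>g z\<bar> powr p)"
    using g K(1,2) by (auto simp: Lp_loc_def)
  have "bounded (\<psi> ` K)" by (rule compact_imp_bounded[OF compact_continuous_image[OF K(5,1)]])
  then obtain B where B: "\<forall>z\<in>K. \<bar>\<psi> z\<bar> \<le> B" "B > 0" by (auto simp: bounded_pos)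
  have "set_integrable (leb n) K (\<lambda>z. B * (1 + \<bar>g z\<bar> powr p))"
    by (intro set_integrable_mult_right set_integral_add gi set_integrable_continuous_compact K continuous_on_const)
  then have int: "integrable (leb n) (\<lambda>z. indicator K z *\<^sub>R (B * (1 + \<bar>g z\<bar> powr p)))"
    by (simp add: set_integrable_def)
  have "integrable (leb n) (\<lambda>z. g z * (indicator K z * \<psi> z))"
  proof (rule Bochner_Integration.integrable_bound[OF int])
    show "(\<lambda>z. g z * (indicator K z * \<psi> z)) \<in> borel_measurable (leb n)"
      by (rule borel_measurable_times[OF gm borel_measurable_indicator_leb[OF compact_borel[OF K(1)] K(5)]])
    have "norm (g z * (indicator K z * \<psi> z)) \<le> norm (indicator K z *\<^sub>R (B * (1 + \<bar>g z\<bar> powr p)))" for z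
    proof (cases "z \<in> K")
      case True
      have "\<bar>g z\<bar> \<le> 1 + \<bar>g z\<bar> powr p"
      proof (cases "\<bar>g z\<bar> \<le> 1")
        case True
        then show ?thesis by (smt (verit) powr_ge_zero)
      next
        case False
        then have "\<bar>g z\<bar> powr 1 \<le> \<bar>g z\<bar> powr p" using p by (intro powr_mono) auto
        then show ?thesis using False by simp
      qed
      then have "\<bar>\<psi> z\<bar> * \<bar>g z\<bar> \<le> B * (1 + \<bar>g z\<bar> powr p)" using B True by (intro mult_mono) auto
      then show ?thesis using True B by (simp add: abs_mult mult.commute)
    qed simp
    then show "AE z in leb n. norm (g z * (indicator K z * \<psi> z)) \<le> norm (indicator K z *\<^sub>R (B * (1 + \<bar>g z\<bar> powr p)))"
      by (rule AE_I2)
  qed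
  then have "set_integrable (leb n) K (\<lambda>z. g z * \<psi> z)" by (simp add: set_integrable_def mult_ac)
  then show ?thesis using set_integral_restrict(1)[OF K(2), of "\<lambda>z. g z * \<psi> z"] K(4) by simp
qed

lemma Lp_loc_add:
  assumes p: "p \<ge> 1" and g: "Lp_loc n D p g" and g': "Lp_loc n D p g'"
  shows "Lp_loc n D p (\<lambda>z. g z + g' z)"
  unfolding Lp_loc_def
proof (intro conjI allI impI)
  have m: "g \<in> borel_measurable (leb n)" "g' \<in> borel_measurable (leb n)" using g g' by (auto simp: Lp_loc_def)
  then show ms: "(\<lambda>z. g z + g' z) \<in> borel_measurable (leb n)" by (rule borel_measurable_add)
  fix K assume K: "compact K \<and> K \<subseteq> D"
  then have i: "set_integrable (leb n) K (\<lambda>z. \<bar>g z\<bar> powr p)" "set_integrable (leb n) K (\<lambda>z. \<bar>g' z\<bar> powr p)"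
    using g g' by (auto simp: Lp_loc_def)
  \<comment> \<open>A crude substitute for convexity: |x + y| is at most twice the larger of |x| and
    |y|.\<close>
  have le: "\<bar>x + y\<bar> powr p \<le> 2 powr p * (\<bar>x\<bar> powr p + \<bar>y\<bar> powr p)" for x y :: real
  proof -
    have "\<bar>x + y\<bar> powr p \<le> (2 * max \<bar>x\<bar> \<bar>y\<bar>) powr p" using p by (intro powr_mono2) auto
    also have "\<dots> = 2 powr p * max \<bar>x\<bar> \<bar>y\<bar> powr p" by (simp add: powr_mult)
    also have "\<dots> \<le> 2 powr p * (\<bar>x\<bar> powr p + \<bar>y\<bar> powr p)" by (intro mult_left_mono) (auto simp: max_def)
    finally show ?thesis .
  qed
  have "set_integrable (leb n) K (\<lambda>z. 2 powr p * (\<bar>g z\<bar> powr p + \<bar>g' z\<bar> powr p))"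
    by (intro set_integrable_mult_right set_integral_add i)
  then show "set_integrable (leb n) K (\<lambda>z. \<bar>g z + g' z\<bar> powr p)"
  proof (rule set_integrable_bound)
    show "set_borel_measurable (leb n) K (\<lambda>z. \<bar>g z + g' z\<bar> powr p)"
    proof -
      \<comment> \<open>K is only known to be a compact subset of D, and D is arbitrary here; the
        intersection is a measurable set with the same indicator on the space of
        \<open>leb n\<close>.\<close>
      have "K \<inter> Rn n \<in> sets (leb n)"
        using K closed_Rn[of n] by (intro borel_imp_sets_leb) (auto simp: compact_imp_closed)
      then have m1: "(\<lambda>z. indicator (K \<inter> Rn n) z *\<^sub>R (\<bar>g z + g' z\<bar> powr p)) \<in> borel_measurable (leb n)"
        using ms by measurable
      show ?thesis
        unfolding set_borel_measurable_def
        by (rule measurable_cong[THEN iffD1, OF _ m1]) (simp add: indicator_def)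
    qed
    show "AE z in leb n. z \<in> K \<longrightarrow> norm (\<bar>g z + g' z\<bar> powr p) \<le> norm (2 powr p * (\<bar>g z\<bar> powr p + \<bar>g' z\<bar> powr p))"
      using le by (intro AE_I2) simp
  qed
qed

text \<open>An integral splits over a sum of integrable terms. Integrability comes from continuity
  and compact support for u and w, and from \<open>Lp_loc\<close> for the weak derivatives.\<close>

lemma Sobolev_real_add:
  assumes D: "model_open n D" and p: "p \<ge> 1" and u: "Sobolev_real n D k p u" and w: "Sobolev_real n D k p w"
  shows "Sobolev_real n D k p (\<lambda>z. u z + w z)"
  unfolding Sobolev_real_def
proof (intro conjI allI impI ballI)
  have c: "continuous_on D u" "continuous_on D w" using u w by (auto simp: Sobolev_real_def)
  then show "continuous_on D (\<lambda>z. u z + w z)" by (rule continuous_on_add)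
  fix j :: nat and a :: "nat \<Rightarrow> nat" assume j: "j \<le> k" and a: "a \<in> {..<j} \<rightarrow>\<^sub>E {..<n}"
  obtain g where g: "Lp_loc n D p g" "\<And>\<psi>. \<psi> \<in> test_functions n D \<Longrightarrow>
      set_lebesgue_integral (leb n) D (\<lambda>z. u z * partial_deriv n j a \<psi> z) =
        (- 1) ^ j * set_lebesgue_integral (leb n) D (\<lambda>z. g z * \<psi> z)"
    using u j a unfolding Sobolev_real_def by blast
  obtain g' where g': "Lp_loc n D p g'" "\<And>\<psi>. \<psi> \<in> test_functions n D \<Longrightarrow>
      set_lebesgue_integral (leb n) D (\<lambda>z. w z * partial_deriv n j a \<psi> z) =
        (- 1) ^ j * set_lebesgue_integral (leb n) D (\<lambda>z. g' z * \<psi> z)"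
    using w j a unfolding Sobolev_real_def by blast
  have cint: "set_integrable (leb n) D (\<lambda>z. x z * \<psi> z)" if x: "continuous_on D x" and \<psi>: "\<psi> \<in> test_functions n D" for x \<psi>
  proof -
    obtain K where K: "compact K" "K \<subseteq> D" "K \<subseteq> Rn n" "\<And>z. z \<in> D - K \<Longrightarrow> \<psi> z = 0" "continuous_on K \<psi>"
      by (rule test_function_supportE[OF \<psi> D], rule that)
    have "set_integrable (leb n) K (\<lambda>z. x z * \<psi> z)"
      by (rule set_integrable_continuous_compact[OF K(1,3) continuous_on_mult[OF continuous_on_subset[OF x K(2)] K(5)]])
    then show ?thesis using set_integral_restrict(1)[OF K(2), of "\<lambda>z. x z * \<psi> z"] K(4) by simp
  qed
  have "set_lebesgue_integral (leb n) D (\<lambda>z. (u z + w z) * partial_deriv n j a \<psi> z) =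
      (- 1) ^ j * set_lebesgue_integral (leb n) D (\<lambda>z. (g z + g' z) * \<psi> z)" if \<psi>: "\<psi> \<in> test_functions n D" for \<psi>
    unfolding distrib_right
    using set_integral_add(2)[OF cint[OF c(1)] cint[OF c(2)], OF partial_deriv_test_function[OF \<psi>] partial_deriv_test_function[OF \<psi>]]
      set_integral_add(2)[OF Lp_loc_set_integrable_mult[OF D p g(1) \<psi>] Lp_loc_set_integrable_mult[OF D p g'(1) \<psi>]]
      g(2)[OF \<psi>] g'(2)[OF \<psi>]
    by (simp add: distrib_left)
  then show "\<exists>g. Lp_loc n D p g \<and> (\<forall>\<psi>\<in>test_functions n D.
      set_lebesgue_integral (leb n) D (\<lambda>z. (u z + w z) * partial_deriv n j a \<psi> z) =
        (- 1) ^ j * set_lebesgue_integral (leb n) D (\<lambda>z. g z * \<psi> z))"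
    using Lp_loc_add[OF p g(1) g'(1)] by (intro exI[of _ "\<lambda>z. g z + g' z"]) simp
qed

subsection \<open>Bump functions\<close>

text \<open>\<open>flat 0\<close> is the classical exp (- 1 / t). Its derivatives produce the powers
  of 1 / t, so the span of the family is closed under differentiation.\<close>

definition flat :: "nat \<Rightarrow> real \<Rightarrow> real" where
  "flat m t = (if t > 0 then (1 / t) ^ m * exp (- (1 / t)) else 0)"

lemma flat_nonneg [simp]: "0 \<le> flat m t"
  by (simp add: flat_def)

text \<open>From the right this is the limit of s ^ m / exp s for s = 1 / t tending to
  infinity.\<close>

lemma flat_tendsto_0: "(flat m \<longlongrightarrow> 0) (at 0)"
proof (rule filterlim_split_at)
  have "\<forall>\<^sub>F t in at_left 0. flat m t = 0"
    by (simp add: eventually_at_filter flat_def)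
  then show "(flat m \<longlongrightarrow> 0) (at_left 0)" by (rule tendsto_eventually)
  have "((\<lambda>t. (inverse t) ^ m / exp (inverse t)) \<longlongrightarrow> 0) (at_right (0 :: real))"
    by (rule filterlim_compose[OF tendsto_power_div_exp_0 filterlim_inverse_at_top_right])
  moreover have "\<forall>\<^sub>F t in at_right 0. (inverse t) ^ m / exp (inverse t) = flat m t"
    by (rule eventually_mono[OF eventually_at_right_less]) (auto simp: flat_def exp_minus field_simps)
  ultimately show "(flat m \<longlongrightarrow> 0) (at_right 0)" by (rule Lim_transform_eventually)
qed

lemma flat_has_derivative:
  "(flat m has_real_derivative flat (m + 2) t - real m * flat (m + 1) t) (at t)"
proof -
  consider "t > 0" | "t < 0" | "t = 0" by linarith
  then show ?thesis
  proof cases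
    case 1
    define s where "s = 1 / t"
    have d: "((\<lambda>t. 1 / t) has_real_derivative - (s\<^sup>2)) (at t)"
      using 1 by (auto intro!: derivative_eq_intros simp: s_def power2_eq_square)
    have e: "((\<lambda>t. exp (- (1 / t))) has_real_derivative exp (- s) * s\<^sup>2) (at t)"
      using DERIV_exp[THEN DERIV_chain2, OF DERIV_minus[OF d]] by (simp add: s_def)
    \<comment> \<open>The exponent m - 1 truncates to 0 at m = 0, where the factor m vanishes; hence
      the case distinction.\<close>
    have "flat (m + 2) t - real m * flat (m + 1) t =
        real m * (- (s\<^sup>2) * (1 / t) ^ (m - Suc 0)) * exp (- (1 / t)) + exp (- s) * s\<^sup>2 * (1 / t) ^ m"
      unfolding s_def[symmetric]
      by (cases m) (use 1 in \<open>simp_all add: flat_def power2_eq_square algebra_simps flip: s_def\<close>)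
    then have "((\<lambda>t. (1 / t) ^ m * exp (- (1 / t))) has_real_derivative
        flat (m + 2) t - real m * flat (m + 1) t) (at t)"
      using DERIV_mult[OF DERIV_power[OF d, of m] e] by simp
    then show ?thesis
      by (rule has_field_derivative_transform_within_open[of _ _ _ "{0<..}"]) (use 1 in \<open>auto simp: flat_def\<close>)
  next
    case 2
    have "((\<lambda>t. 0) has_real_derivative flat (m + 2) t - real m * flat (m + 1) t) (at t)"
      using 2 by (simp add: flat_def)
    then show ?thesis
      by (rule has_field_derivative_transform_within_open[of _ _ _ "{..<0}"]) (use 2 in \<open>auto simp: flat_def\<close>)
  next
    case 3
    \<comment> \<open>At 0 the difference quotient of \<open>flat m\<close> is
      \<open>flat (m + 1)\<close> itself, whose limit is known.\<close>
    have "(flat m y - flat m 0) / (y - 0) = flat (m + 1) y" if "y \<noteq> 0" for y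
      using that by (auto simp: flat_def)
    then have "((\<lambda>y. (flat m y - flat m 0) / (y - 0)) \<longlongrightarrow> 0) (at 0) \<longleftrightarrow> (flat (m + 1) \<longlongrightarrow> 0) (at 0)"
      by (intro Lim_cong_within) auto
    then have "(flat m has_real_derivative 0) (at 0)"
      using flat_tendsto_0 by (simp add: has_field_derivative_iff)
    then show ?thesis using 3 by (simp add: flat_def)
  qed
qed

lemma smooth_flat:
  assumes D: "model_open n D" and u: "smooth n D u"
  shows "smooth n D (\<lambda>p. flat m (u p))"
proof -
  have "(flat m has_real_derivative
      (\<Sum>j<(2::nat). (if j = 0 then 1 else - real m) * flat (if j = 0 then m + 2 else m + 1) t)) (at t)" for m t
    using flat_has_derivative[of m t] by (simp add: numeral_2_eq_2)
  from Ck_real_compose[OF D, where h = flat and c = "\<lambda>_. 2" and a = "\<lambda>m j. if j = 0 then 1 else - real m"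
      and b = "\<lambda>m j. if j = 0 then m + 2 else m + 1", OF this smoothD[OF u]]
  show ?thesis by (simp add: smooth_def)
qed

lemma smooth_const: "model_open n D \<Longrightarrow> smooth n D (\<lambda>_. c)"
  by (simp add: smooth_def Ck_real_const)

lemma smooth_add: "model_open n D \<Longrightarrow> smooth n D u \<Longrightarrow> smooth n D w \<Longrightarrow> smooth n D (\<lambda>p. u p + w p)"
  by (simp add: smooth_def Ck_real_add)

lemma smooth_mult: "model_open n D \<Longrightarrow> smooth n D u \<Longrightarrow> smooth n D w \<Longrightarrow> smooth n D (\<lambda>p. u p * w p)"
  by (simp add: smooth_def Ck_real_mult)

lemma smooth_sum: "model_open n D \<Longrightarrow> (\<And>i. i \<in> A \<Longrightarrow> smooth n D (u i)) \<Longrightarrow> smooth n D (\<lambda>p. \<Sum>i\<in>A. u i p)"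
  by (simp add: smooth_def Ck_real_sum)

lemma smooth_local:
  assumes "model_open n D" "openin (top_of_set D) D1" "openin (top_of_set D) D2" "D = D1 \<union> D2"
    "smooth n D1 u" "smooth n D2 u"
  shows "smooth n D u"
  using Ck_real_locally[OF assms(1-4)] assms(5,6) unfolding smooth_def by blast

text \<open>Extensional functions form a full product whose factors from index n on are the
  singleton of \<open>undefined\<close>, so Tychonoff's theorem applies.\<close>

lemma compact_box: "compact ({..<n} \<rightarrow>\<^sub>E {- B..B :: real})"
proof -
  have "({..<n} \<rightarrow>\<^sub>E {- B..B}) = (\<Pi>\<^sub>E i\<in>UNIV. if i < n then {- B..B} else {undefined})"
    by (auto simp: PiE_def extensional_def Pi_def split: if_splits)
  moreover have "compactin (product_topology (\<lambda>i. euclidean) UNIV) (\<Pi>\<^sub>E i\<in>UNIV. if i < n then {- B..B} else {undefined :: real})"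
    unfolding compactin_PiE by auto
  ultimately show ?thesis by (simp add: euclidean_product_topology)
qed

lemma compact_model_ball:
  assumes H: "model_space n H" and p: "p \<in> H" and d: "d > 0"
  shows "compact {q \<in> H. (\<Sum>i<n. (q i - p i)\<^sup>2) \<le> d\<^sup>2}"
    "\<And>q i. (\<Sum>i<n. (q i - p i)\<^sup>2) \<le> d\<^sup>2 \<Longrightarrow> i < n \<Longrightarrow> \<bar>q i - p i\<bar> \<le> d"
proof -
  show near: "\<bar>q i - p i\<bar> \<le> d" if "(\<Sum>i<n. (q i - p i)\<^sup>2) \<le> d\<^sup>2" "i < n" for q i
  proof -
    have "(q i - p i)\<^sup>2 \<le> (\<Sum>i<n. (q i - p i)\<^sup>2)" using that(2) by (intro member_le_sum) auto
    then have "(q i - p i)\<^sup>2 \<le> d\<^sup>2" using that(1) by simp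
    then show ?thesis using d abs_le_square_iff[of "q i - p i" d] by simp
  qed
  define B where "B = d + (\<Sum>i<n. \<bar>p i\<bar>)"
  have pB: "\<bar>p i\<bar> + d \<le> B" if "i < n" for i
    using member_le_sum[of i "{..<n}" "\<lambda>i. \<bar>p i\<bar>"] that by (simp add: B_def)
  have sub: "{q \<in> H. (\<Sum>i<n. (q i - p i)\<^sup>2) \<le> d\<^sup>2} \<subseteq> {..<n} \<rightarrow>\<^sub>E {- B..B}"
  proof
    fix q assume "q \<in> {q \<in> H. (\<Sum>i<n. (q i - p i)\<^sup>2) \<le> d\<^sup>2}"
    then have q: "q \<in> Rn n" "(\<Sum>i<n. (q i - p i)\<^sup>2) \<le> d\<^sup>2" using model_space_subset[OF H] by auto
    show "q \<in> {..<n} \<rightarrow>\<^sub>E {- B..B}"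
    proof (rule PiE_I)
      fix i assume "i \<in> {..<n}"
      then have "\<bar>q i\<bar> \<le> B" using near[OF q(2), of i] pB[of i] by simp
      then show "q i \<in> {- B..B}" by (simp add: abs_le_iff)
    qed (rule PiE_arb[OF q(1)])
  qed
  have "closed H" using H closed_Rn closed_half_space unfolding model_space_def by metis
  moreover have "closed {q :: nat \<Rightarrow> real. (\<Sum>i<n. (q i - p i)\<^sup>2) \<le> d\<^sup>2}"
    by (rule closed_Collect_le) (rule continuous_intros continuous_on_product_coordinates)+
  ultimately have "closed (H \<inter> {q. (\<Sum>i<n. (q i - p i)\<^sup>2) \<le> d\<^sup>2})" by (rule closed_Int)
  then have "closed {q \<in> H. (\<Sum>i<n. (q i - p i)\<^sup>2) \<le> d\<^sup>2}" by (simp only: Collect_conj_eq Collect_mem_eq)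
  from compact_Int_closed[OF compact_box this, of n B]
  show "compact {q \<in> H. (\<Sum>i<n. (q i - p i)\<^sup>2) \<le> d\<^sup>2}"
    unfolding Int_absorb1[OF sub] .
qed

section \<open>Charts, transition maps and bump functions on the manifold\<close>

context
  fixes n :: nat and \<A> :: "'v::t2_space chart set"
  assumes M: "smooth_manifold n \<A>"
begin

lemma chart_properties:
  assumes "(U, \<phi>) \<in> \<A>"
  shows "open U" "model_open n (\<phi> ` U)" "homeomorphism U (\<phi> ` U) \<phi> (inv_into U \<phi>)" "inj_on \<phi> U"
proof -
  have "is_chart n (U, \<phi>)" using M assms unfolding smooth_manifold_def by blast
  then show "open U" "model_open n (\<phi> ` U)" and h: "homeomorphism U (\<phi> ` U) \<phi> (inv_into U \<phi>)"
    by (simp_all add: is_chart_def)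
  show "inj_on \<phi> U" by (rule inj_on_inverseI) (rule homeomorphism_apply1[OF h])
qed

lemma chart_openin:
  assumes "(U, \<phi>) \<in> \<A>" "open N"
  shows "openin (top_of_set (\<phi> ` U)) (\<phi> ` (U \<inter> N))"
  using homeomorphism_imp_open_map[OF chart_properties(3)[OF assms(1)]] assms(2) by (simp add: openin_open_Int)

lemma ex_chart: "\<exists>U \<phi>. (U, \<phi>) \<in> \<A> \<and> v \<in> U"
proof -
  have "v \<in> (\<Union>c\<in>\<A>. fst c)" using M by (simp add: smooth_manifold_def)
  then show ?thesis by force
qed

lemma transition_smooth:
  assumes "(U, \<phi>) \<in> \<A>" "(W, \<theta>) \<in> \<A>" "i < n"
  shows "smooth n (\<phi> ` (U \<inter> W)) (\<lambda>p. \<theta> (inv_into U \<phi> p) i)"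
proof -
  have "model_open n (\<phi> ` (U \<inter> W))"
    by (rule model_open_openin[OF chart_properties(2)[OF assms(1)] chart_openin[OF assms(1) chart_properties(1)[OF assms(2)]]])
  moreover have "Ck_MB n (\<phi> ` (U \<inter> W)) \<infinity> (\<lambda>p. \<theta> (inv_into U \<phi> p) i)"
    using M assms unfolding smooth_manifold_def by blast
  ultimately show ?thesis using Ck_MB_infinity_imp_Ck_real by (simp add: smooth_def)
qed

lemma continuous_on_via_charts:
  fixes x :: "'v \<Rightarrow> 'b::topological_space"
  assumes "\<And>U \<phi>. (U, \<phi>) \<in> \<A> \<Longrightarrow> continuous_on (\<phi> ` U) (\<lambda>p. x (inv_into U \<phi> p))"
  shows "continuous_on UNIV x"
proof -
  have "isCont x v" for v
  proof -
    obtain U \<phi> where U: "(U, \<phi>) \<in> \<A>" "v \<in> U" using ex_chart by blast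
    note c = chart_properties[OF U(1)]
    have "continuous_on U (\<lambda>w. x (inv_into U \<phi> (\<phi> w)))"
      by (rule continuous_on_compose2[OF assms[OF U(1)] homeomorphism_cont1[OF c(3)]]) simp
    then have "continuous_on U x" using c(4) by (simp cong: continuous_on_cong)
    then show ?thesis using c(1) U(2) by (simp add: continuous_on_eq_continuous_at)
  qed
  then show ?thesis by (simp add: continuous_on_eq_continuous_at)
qed

text \<open>A bump \<open>flat 0 (d^2 - r)\<close> is transported from a chart around v and extended
  by zero. It vanishes off a compact Q, which is closed since the manifold is Hausdorff; so in any
  other chart it is smooth on the overlap and zero on the open set off Q.\<close>

lemma ex_bump:
  assumes N: "open N" "v \<in> N"
  shows "\<exists>\<psi>. (\<forall>(W, \<theta>)\<in>\<A>. smooth n (\<theta> ` W) (\<lambda>p. \<psi> (inv_into W \<theta> p))) \<and>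
    (\<forall>w. 0 \<le> \<psi> w) \<and> 0 < \<psi> v \<and> (\<forall>w. w \<notin> N \<longrightarrow> \<psi> w = 0)"
proof -
  obtain U \<phi> where U: "(U, \<phi>) \<in> \<A>" "v \<in> U" using ex_chart by blast
  note c = chart_properties[OF U(1)]
  have inv: "inv_into U \<phi> (\<phi> w) = w" if "w \<in> U" for w using c(4) that by simp
  obtain H where H: "model_space n H" "openin (top_of_set H) (\<phi> ` U)" using c(2) by (auto simp: model_open_iff)
  define p where "p = \<phi> v"
  have pU: "p \<in> \<phi> ` U" using U by (simp add: p_def)
  have pH: "p \<in> H" using pU openin_imp_subset[OF H(2)] by blast
  have opH: "openin (top_of_set H) (\<phi> ` (U \<inter> N))" by (rule openin_trans[OF chart_openin[OF U(1) N(1)] H(2)])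
  have pUN: "p \<in> \<phi> ` (U \<inter> N)" using U N by (simp add: p_def)
  obtain \<delta> where \<delta>: "\<delta> > 0" "\<And>q. q \<in> H \<Longrightarrow> (\<forall>i<n. \<bar>q i - p i\<bar> < \<delta>) \<Longrightarrow> q \<in> \<phi> ` (U \<inter> N)"
    using openin_contains_box[OF opH pUN model_space_subset[OF H(1)]] by blast
  \<comment> \<open>Half the radius, so that the closed ball B lies in the open cube of half-width
    \<delta>.\<close>
  define d where "d = \<delta> / 2"
  have d: "d > 0" "d < \<delta>" using \<delta>(1) by (simp_all add: d_def)
  define r where "r q = (\<Sum>i<n. (q i - p i)\<^sup>2)" for q :: "nat \<Rightarrow> real"
  define B where "B = {q \<in> H. r q \<le> d\<^sup>2}"
  have compB: "compact B" unfolding B_def r_def by (rule compact_model_ball(1)[OF H(1) pH d(1)])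
  have BUN: "B \<subseteq> \<phi> ` (U \<inter> N)"
  proof
    fix q assume q: "q \<in> B"
    then have "\<bar>q i - p i\<bar> \<le> d" if "i < n" for i
      using compact_model_ball(2)[OF H(1) pH d(1), of q i] that by (simp add: B_def r_def)
    then have "\<forall>i<n. \<bar>q i - p i\<bar> < \<delta>" using d(2) le_less_trans by blast
    then show "q \<in> \<phi> ` (U \<inter> N)" using q \<delta>(2) by (simp add: B_def)
  qed
  define Q where "Q = inv_into U \<phi> ` B"
  have "continuous_on B (inv_into U \<phi>)"
    by (rule continuous_on_subset[OF homeomorphism_cont2[OF c(3)]]) (use BUN in blast)
  then have "compact Q" unfolding Q_def by (rule compact_continuous_image[OF _ compB])
  then have closedQ: "closed Q" by (rule compact_imp_closed)
  have QUN: "Q \<subseteq> U \<inter> N"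
  proof
    fix w assume "w \<in> Q"
    then obtain q where q: "q \<in> B" "w = inv_into U \<phi> q" by (auto simp: Q_def)
    then obtain w' where "w' \<in> U \<inter> N" "q = \<phi> w'" using BUN by blast
    then show "w \<in> U \<inter> N" using q inv by simp
  qed
  define \<psi> where "\<psi> w = (if w \<in> U then flat 0 (d\<^sup>2 - r (\<phi> w)) else 0)" for w
  have off: "\<psi> w = 0" if "w \<notin> Q" for w
  proof (rule ccontr)
    assume "\<psi> w \<noteq> 0"
    then have w: "w \<in> U" "r (\<phi> w) \<le> d\<^sup>2" by (auto simp: \<psi>_def flat_def split: if_splits)
    then have "\<phi> w \<in> B" using openin_imp_subset[OF H(2)] by (auto simp: B_def)
    then have "inv_into U \<phi> (\<phi> w) \<in> Q" unfolding Q_def by (rule imageI)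
    then show False using that inv[OF w(1)] by simp
  qed
  have "smooth n (\<theta> ` W) (\<lambda>p. \<psi> (inv_into W \<theta> p))" if W: "(W, \<theta>) \<in> \<A>" for W \<theta>
  proof -
    note cW = chart_properties[OF W]
    have invW: "inv_into W \<theta> (\<theta> w) = w" if "w \<in> W" for w using cW(4) that by simp
    let ?D = "\<theta> ` W" and ?D1 = "\<theta> ` (W \<inter> U)" and ?D2 = "\<theta> ` (W \<inter> - Q)"
    have op1: "openin (top_of_set ?D) ?D1" by (rule chart_openin[OF W c(1)])
    have op2: "openin (top_of_set ?D) ?D2" using closedQ by (intro chart_openin[OF W]) (simp add: open_Compl)
    \<comment> \<open>Q is contained in U, so the overlap with U and the complement of Q cover the
      chart.\<close>
    have un: "?D = ?D1 \<union> ?D2" using QUN by blast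
    note m1 = model_open_openin[OF cW(2) op1] and m2 = model_open_openin[OF cW(2) op2]
    show ?thesis
    proof (rule smooth_local[OF cW(2) op1 op2 un])
      have "smooth n ?D1 (\<lambda>q. \<phi> (inv_into W \<theta> q) i + - p i)" if "i < n" for i
        by (rule smooth_add[OF m1 transition_smooth[OF W U(1) that] smooth_const[OF m1]])
      then have "smooth n ?D1 (\<lambda>q. \<Sum>i<n. (\<phi> (inv_into W \<theta> q) i + - p i) * (\<phi> (inv_into W \<theta> q) i + - p i))"
        by (intro smooth_sum[OF m1] smooth_mult[OF m1]) simp_all
      then have "smooth n ?D1 (\<lambda>q. d\<^sup>2 + - 1 * (\<Sum>i<n. (\<phi> (inv_into W \<theta> q) i + - p i) * (\<phi> (inv_into W \<theta> q) i + - p i)))"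
        by (intro smooth_add[OF m1] smooth_mult[OF m1] smooth_const[OF m1])
      then have "smooth n ?D1 (\<lambda>q. d\<^sup>2 - r (\<phi> (inv_into W \<theta> q)))"
        by (simp add: r_def power2_eq_square)
      then have flat: "smooth n ?D1 (\<lambda>q. flat 0 (d\<^sup>2 - r (\<phi> (inv_into W \<theta> q))))" by (rule smooth_flat[OF m1])
      have "\<psi> (inv_into W \<theta> q) = flat 0 (d\<^sup>2 - r (\<phi> (inv_into W \<theta> q)))" if "q \<in> ?D1" for q
        using that invW by (auto simp: \<psi>_def)
      then show "smooth n ?D1 (\<lambda>q. \<psi> (inv_into W \<theta> q))"
        by (rule smooth_cong[THEN iffD2, OF _ flat])
      have "\<psi> (inv_into W \<theta> q) = 0" if "q \<in> ?D2" for q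
        using that invW off by auto
      then show "smooth n ?D2 (\<lambda>q. \<psi> (inv_into W \<theta> q))"
        by (rule smooth_cong[THEN iffD2, OF _ smooth_const[OF m2]])
    qed
  qed
  moreover have "0 \<le> \<psi> w" for w by (simp add: \<psi>_def)
  moreover have "0 < \<psi> v" using U(2) d(1) by (simp add: \<psi>_def flat_def r_def p_def)
  moreover have "\<psi> w = 0" if "w \<notin> N" for w using that off QUN by blast
  ultimately show ?thesis by blast
qed

end

subsection \<open>Closure properties of the admissible classes\<close>

lemma linear_scaleR_left: "linear (\<lambda>r. r *\<^sub>R c)"
  by (rule linearI) (simp_all add: scaleR_left_distrib)

lemma continuous_on_scaleR_left_lcs: "continuous_on A (\<lambda>r. r *\<^sub>R (c :: 'e::seq_complete_lcs))"
  by (rule continuous_on_scaleR_lcs[OF continuous_on_id continuous_on_const])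

lemma of_class_linear:
  fixes x :: "(nat \<Rightarrow> real) \<Rightarrow> 'e::seq_complete_lcs"
  assumes D: "model_open n D" and S: "admissible n S" and x: "of_class S n D x"
    and T: "linear T" "continuous_on UNIV T"
  shows "of_class S n D (\<lambda>p. T (x p))"
proof (cases S)
  case (MB k)
  then show ?thesis using Ck_MB_linear[OF D _ T] x by simp
next
  case (Frechet N k)
  then show ?thesis using Ck_Frechet_linear[OF _ _ T] x S by simp
next
  case (Hoelder N k \<alpha>)
  then show ?thesis using Ck_Hoelder_linear[OF D _ _ T] x S by simp
next
  case (SobolevW k p)
  have "Sobolev_real n D k p (\<lambda>z. l (T (x z)))" if "linear l" for l :: "'e \<Rightarrow> real"
  proof -
    \<comment> \<open>A component of T x is again a component of x, because l T is linear.\<close>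
    have "linear (\<lambda>e. l (T e))" using linear_compose[OF T(1) that] by (simp add: o_def)
    moreover have "\<forall>l. linear l \<longrightarrow> Sobolev_real n D k p (\<lambda>z. l (x z))"
      using x SobolevW by (simp add: Sobolev_def)
    ultimately show ?thesis by blast
  qed
  then show ?thesis using SobolevW by (simp add: Sobolev_def)
qed

lemma of_class_add:
  assumes D: "model_open n D" and S: "admissible n S" and x: "of_class S n D x" and y: "of_class S n D y"
  shows "of_class S n D (\<lambda>p. x p + y p)"
proof (cases S)
  case (MB k)
  then show ?thesis using Ck_MB_add[OF D] x y by simp
next
  case (Frechet N k)
  then show ?thesis using Ck_Frechet_add x y S by simp
next
  case (Hoelder N k \<alpha>)
  then have "defining_norm N" "Ck_Hoelder N n D k \<alpha> x" "Ck_Hoelder N n D k \<alpha> y"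
    using x y S by simp_all
  then have "Ck_Hoelder N n D k \<alpha> (\<lambda>p. x p + y p)" by (rule Ck_Hoelder_add[OF D])
  then show ?thesis using Hoelder by simp
next
  case (SobolevW k p)
  then show ?thesis using x y S Sobolev_real_add[OF D]
    by (simp add: Sobolev_def linear_add)
qed

lemma of_class_smooth:
  fixes c :: "'e::seq_complete_lcs"
  assumes D: "model_open n D" and S: "admissible n S" and u: "smooth n D u"
  shows "of_class S n D (\<lambda>p. u p *\<^sub>R c)"
proof (cases S)
  case (MB k)
  then show ?thesis
    using Ck_MB_linear[OF D smooth_imp_Ck_MB[OF D u] linear_scaleR_left continuous_on_scaleR_left_lcs] by simp
next
  case (Frechet N k)
  then show ?thesis using smooth_imp_Ck_Frechet[OF D u] S by simp
next
  case (Hoelder N k \<alpha>)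
  then have "defining_norm N" "0 \<le> \<alpha>" "\<alpha> \<le> 1" using S by simp_all
  then have "Ck_Hoelder N n D k \<alpha> (\<lambda>p. u p *\<^sub>R c)"
    by (intro smooth_imp_Ck_Hoelder[OF D _ u continuous_on_scaleR_left_lcs])
  then show ?thesis using Hoelder by simp
next
  case (SobolevW k p)
  have "Sobolev_real n D k p (\<lambda>z. l (u z *\<^sub>R c))" if "linear l" for l :: "'e \<Rightarrow> real"
    using smooth_imp_Sobolev_real[OF D smooth_mult[OF D u smooth_const[OF D]], of p k "l c"] S SobolevW
    by (simp add: linear_cmul[OF that])
  then show ?thesis using SobolevW by (simp add: Sobolev_def)
qed

text \<open>The order 0 case of the continuity of the Frechet derivatives, combined with boundedness
  of l for the norm N.\<close>

lemma Ck_Frechet_continuous_functional: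
  fixes l :: "'e::{real_vector,topological_space} \<Rightarrow> real"
  assumes D: "D \<subseteq> Rn n" and N: "defining_norm N" and x: "Ck_Frechet N n D k x"
    and l: "linear l" "continuous_on UNIV l"
  shows "continuous_on D (\<lambda>p. l (x p))"
  unfolding continuous_on_topological
proof (intro ballI allI impI)
  fix p O' assume p: "p \<in> D" and O': "open O'" "l (x p) \<in> O'"
  obtain e where e: "e > 0" "\<And>y. \<bar>y - l (x p)\<bar> < e \<Longrightarrow> y \<in> O'"
    using O' by (auto simp: open_dist dist_real_def)
  obtain B where B: "B \<ge> 0" "\<And>y. \<bar>l y\<bar> \<le> B * N y" using continuous_functional_bounded[OF N l] by blast
  obtain A where A: "frechet_jet N n D k x A" using x by (auto simp: Ck_Frechet_iff)
  \<comment> \<open>The empty tuple, the only element of \<open>unit_tuples n 0\<close>.\<close>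
  let ?v = "\<lambda>_ :: nat. undefined :: nat \<Rightarrow> real"
  have A0: "A 0 q ?v = x q" if "q \<in> D" for q
    using A[unfolded frechet_jet_def, THEN conjunct1, rule_format, OF that, of ?v] by simp
  have v: "?v \<in> unit_tuples n 0" by (simp add: unit_tuples_def)
  have k: "enat 0 \<le> k" by (simp add: zero_enat_def[symmetric])
  have "e / (B + 1) / 2 > 0" using e(1) B(1) by simp
  then obtain d where d: "d > 0" "\<And>q. q \<in> D \<Longrightarrow> enorm n (lincomb n 1 q (- 1) p) < d \<Longrightarrow>
      \<forall>v\<in>unit_tuples n 0. N (A 0 q v - A 0 p v) \<le> e / (B + 1) / 2"
    using A[unfolded frechet_jet_def, THEN conjunct2, THEN conjunct2, THEN conjunct1, rule_format, OF k p] by blast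
  define \<delta> where "\<delta> = d / (real n + 1)"
  have \<delta>: "\<delta> > 0" "real n * \<delta> < d" using d(1) by (simp_all add: \<delta>_def field_simps)
  obtain W where W: "open W" "{q \<in> D. \<forall>i<n. \<bar>q i - p i\<bar> < \<delta>} = D \<inter> W"
    using openin_box[of D n p \<delta>] by (auto simp: openin_open)
  have "l (x q) \<in> O'" if q: "q \<in> D" "q \<in> W" for q
  proof -
    have near: "\<forall>i<n. \<bar>q i - p i\<bar> < \<delta>" using W(2) q by blast
    have "enorm n (lincomb n 1 q (- 1) p) \<le> (\<Sum>i<n. \<bar>lincomb n 1 q (- 1) p i\<bar>)" by (rule enorm_le_sum)
    also have "\<dots> \<le> (\<Sum>i<n. \<delta>)" using near by (intro sum_mono) (simp add: less_imp_le)
    also have "\<dots> < d" using \<delta>(2) by simp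
    finally have "N (x q - x p) \<le> e / (B + 1) / 2" using d(2)[OF q(1)] v A0[OF q(1)] A0[OF p] by auto
    have "\<bar>l (x q - x p)\<bar> \<le> B * N (x q - x p)" by (rule B(2))
    also have "\<dots> \<le> (B + 1) * (e / (B + 1) / 2)"
      using \<open>N (x q - x p) \<le> _\<close> B(1) defining_norm_properties(1)[OF N] by (intro mult_mono) auto
    also have "\<dots> = e / 2" using B(1) by (simp add: field_simps)
    also have "\<dots> < e" using e(1) by simp
    finally show ?thesis using e(2) by (simp add: linear_diff[OF l(1)])
  qed
  moreover have "p \<in> W" using W(2) p \<delta>(1) by auto
  ultimately show "\<exists>A. open A \<and> p \<in> A \<and> (\<forall>y\<in>D. y \<in> A \<longrightarrow> l (x y) \<in> O')" using W(1) by blast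
qed

text \<open>Continuity is stated for l x rather than for x because the Sobolev class is defined
  through components; functionals of x are all that the main argument needs.\<close>

lemma of_class_continuous_functional:
  fixes l :: "'e::seq_complete_lcs \<Rightarrow> real"
  assumes D: "model_open n D" and S: "admissible n S" and x: "of_class S n D x"
    and l: "linear l" "continuous_on UNIV l"
  shows "continuous_on D (\<lambda>p. l (x p))"
proof (cases S)
  case (MB k)
  then show ?thesis using Ck_MB_continuous_on x by (intro continuous_on_compose2[OF l(2)]) auto
next
  case (Frechet N k)
  then show ?thesis using Ck_Frechet_continuous_functional[OF model_open_subset[OF D] _ _ l] x S by simp
next
  case (Hoelder N k \<alpha>)
  then have "continuous_on D x" using x Ck_MB_continuous_on by (auto simp: Ck_Hoelder_def)
  then show ?thesis by (intro continuous_on_compose2[OF l(2)]) auto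
next
  case (SobolevW k p)
  then show ?thesis using x l(1) by (simp add: Sobolev_def Sobolev_real_def)
qed

section \<open>The mapping group on the manifold, chart by chart\<close>

context
  fixes n :: nat and \<A> :: "'v::t2_space chart set" and S :: "'e::seq_complete_lcs smoothness"
  assumes M: "smooth_manifold n \<A>" and S: "admissible n S"
begin

lemma maps_of_classD:
  "x \<in> maps_of_class S n \<A> \<Longrightarrow> (U, \<phi>) \<in> \<A> \<Longrightarrow> of_class S n (\<phi> ` U) (\<lambda>p. x (inv_into U \<phi> p))"
  by (auto simp: maps_of_class_def)

lemma maps_of_classI:
  "(\<And>U \<phi>. (U, \<phi>) \<in> \<A> \<Longrightarrow> of_class S n (\<phi> ` U) (\<lambda>p. x (inv_into U \<phi> p))) \<Longrightarrow> x \<in> maps_of_class S n \<A>"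
  by (auto simp: maps_of_class_def)

lemma maps_of_class_add:
  "x \<in> maps_of_class S n \<A> \<Longrightarrow> y \<in> maps_of_class S n \<A> \<Longrightarrow> (\<lambda>v. x v + y v) \<in> maps_of_class S n \<A>"
  by (rule maps_of_classI) (rule of_class_add[OF chart_properties(2)[OF M] S maps_of_classD maps_of_classD])

lemma maps_of_class_linear:
  assumes "x \<in> maps_of_class S n \<A>" "linear T" "continuous_on UNIV T"
  shows "(\<lambda>v. T (x v)) \<in> maps_of_class S n \<A>"
  by (rule maps_of_classI) (rule of_class_linear[OF chart_properties(2)[OF M] S maps_of_classD[OF assms(1)] assms(2,3)])

lemma maps_of_class_continuous_functional:
  fixes l :: "'e \<Rightarrow> real"
  assumes "x \<in> maps_of_class S n \<A>" "linear l" "continuous_on UNIV l"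
  shows "continuous_on UNIV (\<lambda>v. l (x v))"
  by (rule continuous_on_via_charts[OF M])
    (rule of_class_continuous_functional[OF chart_properties(2)[OF M] S maps_of_classD[OF assms(1)] assms(2,3)])

lemma maps_of_class_bump:
  assumes "open N" "v \<in> N"
  shows "\<exists>\<psi>. continuous_on UNIV \<psi> \<and> (\<forall>c. (\<lambda>w. \<psi> w *\<^sub>R c) \<in> maps_of_class S n \<A>) \<and>
    (\<forall>w. 0 \<le> \<psi> w) \<and> 0 < \<psi> v \<and> (\<forall>w. w \<notin> N \<longrightarrow> \<psi> w = (0 :: real))"
proof -
  obtain \<psi> where \<psi>: "\<forall>(W, \<theta>)\<in>\<A>. smooth n (\<theta> ` W) (\<lambda>p. \<psi> (inv_into W \<theta> p))"
    "\<forall>w. 0 \<le> \<psi> w" "0 < \<psi> v" "\<forall>w. w \<notin> N \<longrightarrow> \<psi> w = 0"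
    using ex_bump[OF M assms] by blast
  have sm: "smooth n (\<theta> ` W) (\<lambda>p. \<psi> (inv_into W \<theta> p))" if "(W, \<theta>) \<in> \<A>" for W \<theta>
    using \<psi>(1) that by blast
  have "continuous_on UNIV \<psi>"
    by (rule continuous_on_via_charts[OF M smooth_continuous_on[OF sm]])
  moreover have "(\<lambda>w. \<psi> w *\<^sub>R c) \<in> maps_of_class S n \<A>" for c
    by (rule maps_of_classI) (rule of_class_smooth[OF chart_properties(2)[OF M] S sm])
  ultimately show ?thesis using \<psi>(2-4) by blast
qed

end

subsection \<open>Range decreasing homomorphisms are evaluations\<close>

lemma independent_pairD:
  fixes a b :: "'e::real_vector"
  assumes "independent {a, b}" "a \<noteq> b" "s *\<^sub>R a + t *\<^sub>R b = 0"
  shows "s = 0 \<and> t = 0"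
proof -
  let ?u = "\<lambda>x. if x = a then s else t"
  have sum: "(\<Sum>x\<in>{a, b}. ?u x *\<^sub>R x) = 0" using assms(2,3) by auto
  have "?u a = 0" "?u b = 0"
    by (rule real_vector.independentD[OF assms(1) _ order.refl sum]; simp)+
  then show ?thesis using assms(2) by auto
qed

text \<open>Independence of the set \<open>{a, b}\<close> with a and b distinct, in the form in
  which it is used: comparison of coefficients.\<close>

definition linearly_independent_pair :: "'e::real_vector \<Rightarrow> 'e \<Rightarrow> bool" where
  "linearly_independent_pair a b \<longleftrightarrow> (\<forall>s t. s *\<^sub>R a + t *\<^sub>R b = 0 \<longrightarrow> s = 0 \<and> t = 0)"

lemma linearly_independent_pair_eqD:
  assumes "linearly_independent_pair a b" "s *\<^sub>R a + t *\<^sub>R b = s' *\<^sub>R a + t' *\<^sub>R b"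
  shows "s = s'" "t = t'"
proof -
  have "(s - s') *\<^sub>R a + (t - t') *\<^sub>R b = 0" using assms(2) by (simp add: algebra_simps)
  then have "s - s' = 0 \<and> t - t' = 0" using assms(1) unfolding linearly_independent_pair_def by blast
  then show "s = s'" "t = t'" by simp_all
qed

lemma linearly_independent_pair_nonzero:
  assumes "linearly_independent_pair a b"
  shows "a \<noteq> 0" "b \<noteq> 0"
  using assms[unfolded linearly_independent_pair_def, rule_format, of 1 0]
    assms[unfolded linearly_independent_pair_def, rule_format, of 0 1] by auto

text \<open>Everything about the smoothness class that the algebraic argument uses. In
  \<open>bump\<close> the real function is multiplied by vectors because the class consists of maps
  into \<open>'e\<close>.\<close>

locale evaluation_setting =
  fixes X :: "('v::t2_space \<Rightarrow> 'e::seq_complete_lcs) set" and f :: "('v \<Rightarrow> 'e) \<Rightarrow> 'e"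
    and a b :: 'e
  assumes add: "\<And>x y. x \<in> X \<Longrightarrow> y \<in> X \<Longrightarrow> (\<lambda>v. x v + y v) \<in> X"
    and lin: "\<And>x T. x \<in> X \<Longrightarrow> linear T \<Longrightarrow> continuous_on UNIV T \<Longrightarrow> (\<lambda>v. T (x v)) \<in> X"
    and cont: "\<And>x l. x \<in> X \<Longrightarrow> linear l \<Longrightarrow> continuous_on UNIV l \<Longrightarrow> continuous_on UNIV (\<lambda>v. l (x v) :: real)"
    and bump: "\<And>v N. open N \<Longrightarrow> v \<in> N \<Longrightarrow> \<exists>\<psi>. continuous_on UNIV \<psi> \<and> (\<forall>c. (\<lambda>w. \<psi> w *\<^sub>R c) \<in> X) \<and>
          (\<forall>w. 0 \<le> \<psi> w) \<and> 0 < \<psi> v \<and> (\<forall>w. w \<notin> N \<longrightarrow> \<psi> w = (0 :: real))"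
    and range: "\<And>x. x \<in> X \<Longrightarrow> \<exists>v. f x = x v"
    and hom: "\<And>x y. x \<in> X \<Longrightarrow> y \<in> X \<Longrightarrow> f (\<lambda>v. x v + y v) = f x + f y"
    and ab: "linearly_independent_pair a b"
begin

text \<open>Real functions of the class, described through X: membership is tested on the multiples
  of all vectors. Continuity is recorded so that the set where such a function differs from a given
  number is open.\<close>

definition scalar_functions :: "('v \<Rightarrow> real) set" where
  "scalar_functions = {\<phi>. continuous_on UNIV \<phi> \<and> (\<forall>c. (\<lambda>v. \<phi> v *\<^sub>R c) \<in> X)}"

lemma scalar_functions_mem: "\<phi> \<in> scalar_functions \<Longrightarrow> (\<lambda>v. \<phi> v *\<^sub>R c) \<in> X"
  by (simp add: scalar_functions_def)

lemma scalar_functions_add: "\<phi> \<in> scalar_functions \<Longrightarrow> \<psi> \<in> scalar_functions \<Longrightarrow> (\<lambda>v. \<phi> v + \<psi> v) \<in> scalar_functions"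
  by (auto simp: scalar_functions_def scaleR_left_distrib intro: add continuous_intros)

text \<open>The map sending e to l e times c is continuous and linear, so \<open>lin\<close> applies
  to it.\<close>

lemma scalar_functions_functional:
  assumes "x \<in> X" "linear l" "continuous_on UNIV l"
  shows "(\<lambda>v. l (x v)) \<in> scalar_functions"
proof -
  have "linear (\<lambda>e. l e *\<^sub>R c)" for c :: 'e
    by (rule linearI) (simp_all add: linear_add[OF assms(2)] linear_cmul[OF assms(2)] scaleR_left_distrib)
  moreover have "continuous_on UNIV (\<lambda>e. l e *\<^sub>R c)" for c :: 'e
    by (rule continuous_on_scaleR_lcs[OF assms(3) continuous_on_const])
  ultimately have "(\<lambda>v. l (x v) *\<^sub>R c) \<in> X" for c
    by (rule lin[OF assms(1), of "\<lambda>e. l e *\<^sub>R c"])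
  then show ?thesis using cont[OF assms] by (simp add: scalar_functions_def)
qed

text \<open>The number L of the overview, still depending on c. For c = 0 every r satisfies the
  equation, so the value carries information for nonzero c only.\<close>

definition coeff :: "'e \<Rightarrow> ('v \<Rightarrow> real) \<Rightarrow> real" where
  "coeff c \<phi> = (SOME r. f (\<lambda>v. \<phi> v *\<^sub>R c) = r *\<^sub>R c)"

lemma f_coeff: "\<phi> \<in> scalar_functions \<Longrightarrow> f (\<lambda>v. \<phi> v *\<^sub>R c) = coeff c \<phi> *\<^sub>R c"
  unfolding coeff_def by (rule someI_ex) (use range[OF scalar_functions_mem] in blast)

text \<open>The point where \<phi> c + \<psi> d takes the value that f assigns to it serves both
  functions, because coefficients of independent vectors can be compared.\<close>

lemma coeff_common_point:
  assumes "linearly_independent_pair c d" "\<phi> \<in> scalar_functions" "\<psi> \<in> scalar_functions"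
  shows "\<exists>v. \<phi> v = coeff c \<phi> \<and> \<psi> v = coeff d \<psi>"
proof -
  note X = scalar_functions_mem[OF assms(2), of c] scalar_functions_mem[OF assms(3), of d]
  obtain v where "f (\<lambda>v. \<phi> v *\<^sub>R c + \<psi> v *\<^sub>R d) = \<phi> v *\<^sub>R c + \<psi> v *\<^sub>R d"
    using range[OF add[OF X]] by blast
  then have "\<phi> v *\<^sub>R c + \<psi> v *\<^sub>R d = coeff c \<phi> *\<^sub>R c + coeff d \<psi> *\<^sub>R d"
    by (simp add: hom[OF X] f_coeff assms)
  then show ?thesis using linearly_independent_pair_eqD[OF assms(1)] by blast
qed

text \<open>f (\<phi> (c + d)) is computed in two ways: as a multiple of c + d, and by
  additivity.\<close>

lemma coeff_eq:
  assumes "linearly_independent_pair c d" "\<phi> \<in> scalar_functions"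
  shows "coeff c \<phi> = coeff d \<phi>"
proof -
  have "coeff (c + d) \<phi> *\<^sub>R (c + d) = coeff c \<phi> *\<^sub>R c + coeff d \<phi> *\<^sub>R d"
    using hom[OF scalar_functions_mem[OF assms(2), of c] scalar_functions_mem[OF assms(2), of d]] f_coeff[OF assms(2), of "c + d"]
    by (simp add: f_coeff[OF assms(2)] scaleR_right_distrib)
  then have "coeff (c + d) \<phi> *\<^sub>R c + coeff (c + d) \<phi> *\<^sub>R d = coeff c \<phi> *\<^sub>R c + coeff d \<phi> *\<^sub>R d"
    by (simp add: scaleR_right_distrib)
  from linearly_independent_pair_eqD[OF assms(1) this] show ?thesis by simp
qed

text \<open>A vector c parallel to a is compared with a by way of b, which is independent of both;
  this rests on dimension at least 2.\<close>

lemma coeff_eq_coeff_a: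
  assumes c: "c \<noteq> 0" and \<phi>: "\<phi> \<in> scalar_functions"
  shows "coeff c \<phi> = coeff a \<phi>"
proof (cases "linearly_independent_pair a c")
  case True
  then show ?thesis using coeff_eq[OF _ \<phi>] by simp
next
  case False
  then obtain s t where st: "s *\<^sub>R a + t *\<^sub>R c = 0" "\<not> (s = 0 \<and> t = 0)"
    unfolding linearly_independent_pair_def by blast
  then have t: "t \<noteq> 0" using linearly_independent_pair_nonzero(1)[OF ab] by auto
  define r where "r = - s / t"
  have "c = (1 / t) *\<^sub>R (t *\<^sub>R c)" using t by simp
  also have "t *\<^sub>R c = (- s) *\<^sub>R a" using st(1) by (simp add: eq_neg_iff_add_eq_0 add.commute)
  finally have cr: "c = r *\<^sub>R a" by (simp add: r_def)
  then have r: "r \<noteq> 0" using c by auto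
  have "linearly_independent_pair c b"
    unfolding linearly_independent_pair_def
  proof (intro allI impI)
    fix s t assume "s *\<^sub>R c + t *\<^sub>R b = 0"
    then have "(s * r) *\<^sub>R a + t *\<^sub>R b = 0" by (simp add: cr)
    then have "s * r = 0 \<and> t = 0" using ab unfolding linearly_independent_pair_def by blast
    then show "s = 0 \<and> t = 0" using r by simp
  qed
  then have "coeff c \<phi> = coeff b \<phi>" using coeff_eq[OF _ \<phi>] by blast
  then show ?thesis using coeff_eq[OF ab \<phi>] by simp
qed

lemma common_point:
  assumes "\<phi> \<in> scalar_functions" "\<psi> \<in> scalar_functions"
  shows "\<exists>v. \<phi> v = coeff a \<phi> \<and> \<psi> v = coeff a \<psi>"
  using coeff_common_point[OF ab assms] coeff_eq[OF ab assms(2)] by simp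

lemma coeff_add:
  assumes "\<phi> \<in> scalar_functions" "\<psi> \<in> scalar_functions"
  shows "coeff a (\<lambda>v. \<phi> v + \<psi> v) = coeff a \<phi> + coeff a \<psi>"
proof -
  have "coeff a (\<lambda>v. \<phi> v + \<psi> v) *\<^sub>R a = (coeff a \<phi> + coeff a \<psi>) *\<^sub>R a"
    using hom[OF scalar_functions_mem[OF assms(1), of a] scalar_functions_mem[OF assms(2), of a]] f_coeff[OF scalar_functions_add[OF assms], of a]
    by (simp add: f_coeff assms scaleR_left_distrib)
  then show ?thesis using linearly_independent_pair_nonzero(1)[OF ab] by simp
qed

lemma functional_f:
  assumes x: "x \<in> X" and l: "linear l" "continuous_on UNIV l"
  shows "l (f x) = coeff a (\<lambda>v. l (x v))"
proof (cases "\<exists>e. l e \<noteq> 0")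
  case False
  \<comment> \<open>For l = 0 the left side is 0, and the coefficient of the zero function is one of
    its values.\<close>
  then show ?thesis using common_point[OF scalar_functions_functional[OF x l] scalar_functions_functional[OF x l]] by auto
next
  case True
  then obtain e where e: "l e \<noteq> 0" by blast
  \<comment> \<open>Normalised so that l c = 1; then T below is the projection onto the kernel of l
    along c.\<close>
  define c where "c = (1 / l e) *\<^sub>R e"
  have lc: "l c = 1" using e by (simp add: c_def linear_cmul[OF l(1)])
  then have c0: "c \<noteq> 0" using linear_0[OF l(1)] by auto
  define T where "T e = e - l e *\<^sub>R c" for e
  have "linear T"
    unfolding T_def
    by (rule linearI) (simp_all add: linear_add[OF l(1)] linear_cmul[OF l(1)] algebra_simps)
  moreover have "continuous_on UNIV T"
    unfolding T_def diff_conv_add_uminus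
    by (intro continuous_on_add continuous_on_minus continuous_on_id continuous_on_scaleR_lcs l(2) continuous_on_const)
  ultimately have TX: "(\<lambda>v. T (x v)) \<in> X" by (rule lin[OF x])
  have lT: "l (T e) = 0" for e using lc by (simp add: T_def linear_diff[OF l(1)] linear_cmul[OF l(1)])
  note \<phi> = scalar_functions_functional[OF x l]
  have "x = (\<lambda>v. T (x v) + l (x v) *\<^sub>R c)" by (simp add: T_def)
  then have "f x = f (\<lambda>v. T (x v)) + coeff c (\<lambda>v. l (x v)) *\<^sub>R c"
    using hom[OF TX scalar_functions_mem[OF \<phi>, of c]] f_coeff[OF \<phi>, of c] by simp
  \<comment> \<open>Whatever the point v is, the value T (x v) lies in the kernel of l.\<close>
  moreover obtain v where "f (\<lambda>v. T (x v)) = T (x v)" using range[OF TX] by blast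
  ultimately have "l (f x) = coeff c (\<lambda>v. l (x v))"
    using lc by (simp add: linear_add[OF l(1)] linear_cmul[OF l(1)] lT)
  then show ?thesis using coeff_eq_coeff_a[OF c0 \<phi>] by simp
qed

lemma ex_common_point_all:
  assumes x: "x \<in> X" "compact (closure {v. x v \<noteq> 0})" "f x \<noteq> 0"
  shows "\<exists>v. \<forall>\<phi>\<in>scalar_functions. \<phi> v = coeff a \<phi>"
proof (rule ccontr)
  assume contra: "\<nexists>v. \<forall>\<phi>\<in>scalar_functions. \<phi> v = coeff a \<phi>"
  obtain l where l: "linear l" "continuous_on UNIV l" "l (f x) \<noteq> (0 :: real)"
    using ex_continuous_linear_functional[OF x(3)] by blast
  define \<rho> where "\<rho> v = l (x v)" for v
  have \<rho>: "\<rho> \<in> scalar_functions" "coeff a \<rho> \<noteq> 0"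
    using scalar_functions_functional[OF x(1) l(1,2)] functional_f[OF x(1) l(1,2)] l(3) by (simp_all add: \<rho>_def[abs_def])
  have "\<exists>\<psi>. \<psi> \<in> scalar_functions \<and> (\<forall>w. 0 \<le> \<psi> w) \<and> 0 < \<psi> v \<and> coeff a \<psi> = 0" for v
  proof -
    obtain \<phi> where \<phi>: "\<phi> \<in> scalar_functions" "\<phi> v \<noteq> coeff a \<phi>" using contra by blast
    define N where "N = {w. \<phi> w \<noteq> coeff a \<phi>}"
    have "open N" unfolding N_def
      using \<phi>(1) by (intro open_Collect_neq continuous_on_const) (simp add: scalar_functions_def)
    moreover have "v \<in> N" using \<phi>(2) by (simp add: N_def)
    ultimately obtain \<psi> where \<psi>: "continuous_on UNIV \<psi>" "\<forall>c. (\<lambda>w. \<psi> w *\<^sub>R c) \<in> X"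
      "\<forall>w. 0 \<le> \<psi> w" "0 < \<psi> v" "\<forall>w. w \<notin> N \<longrightarrow> \<psi> w = 0"
      using bump[of N v] by blast
    have \<psi>scalar_functions: "\<psi> \<in> scalar_functions" using \<psi>(1,2) by (simp add: scalar_functions_def)
    \<comment> \<open>The common point lies outside N, where the bump vanishes; so the coefficient
      of the bump is 0.\<close>
    obtain w where "\<phi> w = coeff a \<phi>" "\<psi> w = coeff a \<psi>" using common_point[OF \<phi>(1) \<psi>scalar_functions] by blast
    then have "coeff a \<psi> = 0" using \<psi>(5) by (simp add: N_def)
    then show ?thesis using \<psi>scalar_functions \<psi>(3,4) by blast
  qed
  then obtain \<psi> where \<psi>: "\<And>v. \<psi> v \<in> scalar_functions" "\<And>v w. 0 \<le> \<psi> v w" "\<And>v. 0 < \<psi> v v" "\<And>v. coeff a (\<psi> v) = 0"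
    by metis
  define K where "K = closure {v. x v \<noteq> 0}"
  have opn: "open {w. 0 < \<psi> v w}" for v
    using \<psi>(1)[of v] by (intro open_Collect_less continuous_on_const) (simp add: scalar_functions_def)
  have "K \<subseteq> (\<Union>v\<in>K. {w. 0 < \<psi> v w})" using \<psi>(3) by blast
  then obtain F where F: "F \<subseteq> K" "finite F" "K \<subseteq> (\<Union>v\<in>F. {w. 0 < \<psi> v w})"
    using compactE_image[OF x(2)[folded K_def], of K "\<lambda>v. {w. 0 < \<psi> v w}"] opn by metis
  \<comment> \<open>Obtained by composing x with the zero map; it is the start of the induction over
    F.\<close>
  have zero: "(\<lambda>v. 0) \<in> scalar_functions"
    using lin[OF x(1) linear_zero continuous_on_const] by (simp add: scalar_functions_def)
  have zero_coeff: "coeff a (\<lambda>v. 0) = 0" using common_point[OF zero zero] by simp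
  have g: "(\<lambda>w. \<Sum>v\<in>F. \<psi> v w) \<in> scalar_functions \<and> coeff a (\<lambda>w. \<Sum>v\<in>F. \<psi> v w) = 0"
    using F(2)
  proof induction
    case empty
    then show ?case using zero zero_coeff by simp
  next
    case (insert v F)
    then show ?case
      using scalar_functions_add[OF \<psi>(1)[of v], of "\<lambda>w. \<Sum>v\<in>F. \<psi> v w"] coeff_add[OF \<psi>(1)[of v], of "\<lambda>w. \<Sum>v\<in>F. \<psi> v w"] \<psi>(4)[of v]
      by simp
  qed
  \<comment> \<open>At the common point the sum takes its coefficient 0 and \<rho> a nonzero one. So
    w lies in the support of x, where some summand is positive.\<close>
  obtain w where w: "(\<Sum>v\<in>F. \<psi> v w) = 0" "\<rho> w \<noteq> 0"
    using common_point[of "\<lambda>w. \<Sum>v\<in>F. \<psi> v w" \<rho>] g \<rho> by auto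
  have "x w \<noteq> 0" using w(2) linear_0[OF l(1)] by (auto simp: \<rho>_def)
  then have "w \<in> K" using closure_subset[of "{v. x v \<noteq> 0}"] by (auto simp: K_def)
  then obtain v where v: "v \<in> F" "0 < \<psi> v w" using F(3) by blast
  have "\<psi> v w = 0" using w(1) v(1) F(2) \<psi>(2) sum_nonneg_eq_0_iff[of F "\<lambda>v. \<psi> v w"] by blast
  then show False using v(2) by simp
qed

lemma evaluation:
  assumes "\<exists>x\<in>X. compact (closure {v. x v \<noteq> 0}) \<and> f x \<noteq> 0"
  shows "\<exists>v. \<forall>x\<in>X. f x = x v"
proof -
  obtain v where v: "\<And>\<phi>. \<phi> \<in> scalar_functions \<Longrightarrow> \<phi> v = coeff a \<phi>" using ex_common_point_all assms by blast
  have "f x = x v" if x: "x \<in> X" for x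
  proof (rule ccontr)
    assume "f x \<noteq> x v"
    then obtain l where l: "linear l" "continuous_on UNIV l" "l (f x - x v) \<noteq> (0 :: real)"
      using ex_continuous_linear_functional[of "f x - x v"] by auto
    have "l (f x) = l (x v)" using functional_f[OF x l(1,2)] v[OF scalar_functions_functional[OF x l(1,2)]] by simp
    then show False using l(3) by (simp add: linear_diff[OF l(1)])
  qed
  then show ?thesis by blast
qed

end

theorem theorem4p1:
  fixes n :: nat
    and \<A> :: "'v::t2_space chart set"
    and S :: "'e::seq_complete_lcs smoothness"
    and f :: "('v \<Rightarrow> 'e) \<Rightarrow> 'e"
  assumes "smooth_manifold n \<A>"
    and "admissible n S"
    and "dim_at_least_2 TYPE('e)"
    and "range_decreasing (maps_of_class S n \<A>) f"
    and "additive_hom_on (maps_of_class S n \<A>) f"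
    and "\<exists>x\<in>maps_of_class_c S n \<A>. f x \<noteq> 0"
  shows "\<exists>v. \<forall>x\<in>maps_of_class S n \<A>. f x = x v"
proof -
  obtain a b :: 'e where ab: "a \<noteq> b" "independent {a, b}"
    using assms(3) by (auto simp: dim_at_least_2_def)
  interpret evaluation_setting "maps_of_class S n \<A>" f a b
  proof
    show "\<exists>v. f x = x v" if "x \<in> maps_of_class S n \<A>" for x
      using assms(4) that by (auto simp: range_decreasing_def)
    show "f (\<lambda>v. x v + y v) = f x + f y" if "x \<in> maps_of_class S n \<A>" "y \<in> maps_of_class S n \<A>" for x y
      using assms(5) that by (simp add: additive_hom_on_def)
    show "linearly_independent_pair a b"
      using independent_pairD[OF ab(2,1)] by (simp add: linearly_independent_pair_def)
  qed (fact maps_of_class_add[OF assms(1,2)] maps_of_class_linear[OF assms(1,2)]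
      maps_of_class_continuous_functional[OF assms(1,2)] maps_of_class_bump[OF assms(1,2)])+
  show ?thesis
    by (rule evaluation) (use assms(6) in \<open>auto simp: maps_of_class_c_def\<close>)
qed

end
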